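(* Let $N\in\mathbb N$, let $X_0,X_1,\dots,X_N$ be Banach spaces over $\mathbb K\in\{\mathbb R,\mathbb C\}$, and suppose $X_0$ is II-polyhedral. If $$\mathcal N\Big(\prod_{i=1}^NX_i\Big)\equiv\mathcal I\Big(\prod_{i=1}^NX_i\Big)\ \text{isometrically}\quad\text{and}\quad \mathcal N\Big(\prod_{i=1}^NX_i\Big)=\mathrm{NA}_{\mathrm{nu}}\Big(\prod_{i=1}^NX_i\Big),$$ then $$\mathcal N\Big(\prod_{i=0}^NX_i\Big)\equiv\mathcal I\Big(\prod_{i=0}^NX_i\Big)\ \text{isometrically}\quad\text{and}\quad \mathcal N\Big(\prod_{i=0}^NX_i\Big)=\mathrm{NA}_{\mathrm{nu}}\Big(\prod_{i=0}^NX_i\Big).$$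
   Context: A Banach space $X$ is II-polyhedral if there is $0\le r<1$ such that all $w^*$-cluster points of the set $\mathrm{Ext}(B_{X^*})$ of extreme points of $B_{X^*}$ lie in $rB_{X^*}$. Let $E_1,\dots,E_m$ be Banach spaces. A bounded $m$-linear form $T$ on $\prod_iE_i$ is integral if there is a Radon measure ($\mathbb K$-valued finite regular Borel measure) $\mu$ on $\prod_iB_{E_i^*}$ with the product of the $w^*$-topologies such that $T((x_i)_i)=\int\prod_ix_i^*(x_i)\,d\mu((x_i^* )_i)$ for all $(x_i)_i\in\prod_iE_i$; $\|T\|_{\mathcal I}$ is the infimum of the total variations of such $\mu$, and $\mathcal I(\prod_iE_i)$ is the space of integral forms with this norm (canonically the dual of the $m$-fold completed injective tensor product of the $E_i$). A bounded $m$-linear form $M$ is nuclear if there are $x^*_{i,j}\in E_i^*$ ($1\le i\le m$, $j\in\mathbb N$) with $\sum_{j=1}^\infty\prod_{i=1}^m\|x^*_{i,j}\|<\infty$ and $M((x_i)_i)=\sum_{j=1}^\infty\prod_{i=1}^mx^*_{i,j}(x_i)$ for all $(x_i)_i$; $\|M\|_{\mathrm{nu}}$ is the infimum of $\sum_j\prod_i\|x^*_{i,j}\|$ over all such representations. $\mathcal N(\prod_iE_i)$ is the space of nuclear forms with norm $\|\cdot\|_{\mathrm{nu}}$, and $\mathrm{NA}_{\mathrm{nu}}(\prod_iE_i)$ is the set of nuclear forms for which this infimum is attained. Every nuclear form is integral with $\|\cdot\|_{\mathcal I}\le\|\cdot\|_{\mathrm{nu}}$. "$\mathcal N\equiv\mathcal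 I$ isometrically" means that the canonical inclusion $\mathcal N(\prod_iE_i)\subset\mathcal I(\prod_iE_i)$ is onto and $\|\cdot\|_{\mathrm{nu}}=\|\cdot\|_{\mathcal I}$. *)

theory Defs
  imports "HOL-Analysis.Analysis" "HOL-Algebra.Module"
begin

section \<open>Banach spaces over the real or complex field\<close>

text \<open>
  A family \<open>X\<^sub>0, \<dots>, X\<^sub>N\<close> of different Banach spaces, with \<open>N\<close> arbitrary, cannot be a family of
  types.  A Banach space is therefore a structure with an explicit carrier, a module in the sense
  of HOL-Algebra together with a norm.  The carriers of a family live in one type, for instance
  the disjoint union of the underlying sets.

  The scalar field is a set \<open>K\<close> of complex numbers, either \<open>\<real>\<close> or \<open>UNIV\<close>.  The modulus of a
  scalar is \<open>cmod\<close> in both cases.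
\<close>

definition scalar_ring :: "complex set \<Rightarrow> complex ring" where
  "scalar_ring K = \<lparr>carrier = K, mult = (*), one = 1, zero = 0, add = (+)\<rparr>"

text \<open>The multiplicative fields \<open>mult\<close> and \<open>one\<close> inherited from the ring record are unused.\<close>

record 'a nspace = "(complex, 'a) module" +
  nrm :: "'a \<Rightarrow> real"

text \<open>The value 0 off the carrier is there because \<open>Metric_space\<close> asks for non-negativity and
  symmetry of the distance on the whole type.\<close>

definition ndist :: "'a nspace \<Rightarrow> 'a \<Rightarrow> 'a \<Rightarrow> real" where
  "ndist X x y = (if x \<in> carrier X \<and> y \<in> carrier X then nrm X (x \<ominus>\<^bsub>X\<^esub> y) else 0)"

locale normed_space_over = Module.module "scalar_ring K" X
  for K :: "complex set" and X :: "'a nspace" (structure) +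
  assumes nrm_nonneg: "x \<in> carrier X \<Longrightarrow> 0 \<le> nrm X x"
    and nrm_eq_0_iff: "x \<in> carrier X \<Longrightarrow> nrm X x = 0 \<longleftrightarrow> x = \<zero>"
    and nrm_smult: "\<lbrakk>c \<in> K; x \<in> carrier X\<rbrakk> \<Longrightarrow> nrm X (c \<odot>\<^bsub>X\<^esub> x) = cmod c * nrm X x"
    and nrm_triangle: "\<lbrakk>x \<in> carrier X; y \<in> carrier X\<rbrakk> \<Longrightarrow> nrm X (x \<oplus> y) \<le> nrm X x + nrm X y"

locale banach_space_over = normed_space_over +
  assumes complete: "Metric_space.mcomplete (carrier X) (ndist X)"

section \<open>The dual space and its weak-star topology\<close>

text \<open>Functionals are set to 0 off the carrier, so that equality of functions is equality of
  functionals.\<close>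

definition dual :: "complex set \<Rightarrow> 'a nspace \<Rightarrow> ('a \<Rightarrow> complex) set" where
  "dual K X = {f.
     (\<forall>x\<in>carrier X. f x \<in> K) \<and>
     (\<forall>x. x \<notin> carrier X \<longrightarrow> f x = 0) \<and>
     (\<forall>x\<in>carrier X. \<forall>y\<in>carrier X. f (x \<oplus>\<^bsub>X\<^esub> y) = f x + f y) \<and>
     (\<forall>c\<in>K. \<forall>x\<in>carrier X. f (c \<odot>\<^bsub>X\<^esub> x) = c * f x) \<and>
     (\<exists>C. \<forall>x\<in>carrier X. cmod (f x) \<le> C * nrm X x)}"

definition dual_norm :: "'a nspace \<Rightarrow> ('a \<Rightarrow> complex) \<Rightarrow> real" where
  "dual_norm X f = (SUP x\<in>{x \<in> carrier X. nrm X x \<le> 1}. cmod (f x))"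

definition dual_ball :: "complex set \<Rightarrow> 'a nspace \<Rightarrow> ('a \<Rightarrow> complex) set" where
  "dual_ball K X = {f \<in> dual K X. dual_norm X f \<le> 1}"

text \<open>Functionals vanish off the carrier, so pointwise convergence on the whole type is pointwise
  convergence on the carrier.\<close>

definition weak_star :: "complex set \<Rightarrow> 'a nspace \<Rightarrow> ('a \<Rightarrow> complex) topology" where
  "weak_star K X = subtopology (product_topology (\<lambda>_. euclidean) UNIV) (dual K X)"

text \<open>The library constant \<open>extreme_point_of\<close> needs a type of class \<open>real_vector\<close>, which the
  function type is not.  This is the same notion, written out for functions.\<close>

definition ext_points :: "('a \<Rightarrow> complex) set \<Rightarrow> ('a \<Rightarrow> complex) set" where
  "ext_points B = {f \<in> B. \<not> (\<exists>g\<in>B. \<exists>h\<in>B. g \<noteq> h \<and>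
     (\<exists>t::real. 0 < t \<and> t < 1 \<and> f = (\<lambda>x. of_real (1 - t) * g x + of_real t * h x)))}"

definition II_polyhedral :: "complex set \<Rightarrow> 'a nspace \<Rightarrow> bool" where
  "II_polyhedral K X \<longleftrightarrow> (\<exists>r. 0 \<le> r \<and> r < 1 \<and>
     weak_star K X derived_set_of ext_points (dual_ball K X)
       \<subseteq> {f \<in> dual K X. dual_norm X f \<le> r})"

section \<open>Scalar-valued Radon measures on a topological space\<close>

definition borel_sets :: "'b topology \<Rightarrow> 'b set set" where
  "borel_sets T = sigma_sets (topspace T) {U. openin T U}"

definition variation :: "'b topology \<Rightarrow> ('b set \<Rightarrow> complex) \<Rightarrow> 'b set \<Rightarrow> ennreal" where
  "variation T \<mu> A =
     (SUP P\<in>{P. finite P \<and> P \<subseteq> borel_sets T \<and> disjoint P \<and> \<Union>P = A}. \<Sum>B\<in>P. ennreal (cmod (\<mu> B)))"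

definition radon_measure :: "complex set \<Rightarrow> 'b topology \<Rightarrow> ('b set \<Rightarrow> complex) \<Rightarrow> bool" where
  "radon_measure K T \<mu> \<longleftrightarrow>
     (\<forall>A\<in>borel_sets T. \<mu> A \<in> K) \<and>
     (\<forall>A::nat \<Rightarrow> 'b set. range A \<subseteq> borel_sets T \<longrightarrow> disjoint_family A \<longrightarrow>
        (\<lambda>n. \<mu> (A n)) sums \<mu> (\<Union>n. A n)) \<and>
     variation T \<mu> (topspace T) < \<infinity> \<and>
     (\<forall>A\<in>borel_sets T. \<forall>e>0. \<exists>C U. compactin T C \<and> openin T U \<and> C \<subseteq> A \<and> A \<subseteq> U \<and>
        variation T \<mu> (U - C) < e)"

definition total_variation :: "'b topology \<Rightarrow> ('b set \<Rightarrow> complex) \<Rightarrow> real" where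
  "total_variation T \<mu> = enn2real (variation T \<mu> (topspace T))"

text \<open>
  The positive part \<open>\<nu>\<^sup>+(A) = sup {\<nu>(B) | B \<subseteq> A}\<close> in the Jordan decomposition of a real measure
  \<open>\<nu>\<close>; the negative part is the positive part of \<open>-\<nu>\<close>.  The supremum is unchanged by the clipping
  of negative values in \<open>ennreal\<close>, because \<open>B = {}\<close> contributes 0.
\<close>

definition positive_part :: "'b topology \<Rightarrow> ('b set \<Rightarrow> real) \<Rightarrow> 'b measure" where
  "positive_part T \<nu> = measure_of (topspace T) (borel_sets T)
     (\<lambda>A. SUP B\<in>{B \<in> borel_sets T. B \<subseteq> A}. ennreal (\<nu> B))"

definition real_measure_integral ::
    "'b topology \<Rightarrow> ('b set \<Rightarrow> real) \<Rightarrow> ('b \<Rightarrow> complex) \<Rightarrow> complex" where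
  "real_measure_integral T \<nu> f =
     integral\<^sup>L (positive_part T \<nu>) f - integral\<^sup>L (positive_part T (\<lambda>A. - \<nu> A)) f"

definition measure_integral ::
    "'b topology \<Rightarrow> ('b set \<Rightarrow> complex) \<Rightarrow> ('b \<Rightarrow> complex) \<Rightarrow> complex" where
  "measure_integral T \<mu> f =
     real_measure_integral T (\<lambda>A. Re (\<mu> A)) f + \<i> * real_measure_integral T (\<lambda>A. Im (\<mu> A)) f"

section \<open>Multilinear, integral and nuclear forms\<close>

text \<open>
  The spaces are \<open>E i\<close> for \<open>i\<close> in a finite index set \<open>I\<close>.  As for functionals, a form is 0 off
  the product of the carriers.
\<close>

definition multilinear_forms ::
    "complex set \<Rightarrow> (nat \<Rightarrow> 'a nspace) \<Rightarrow> nat set \<Rightarrow> ((nat \<Rightarrow> 'a) \<Rightarrow> complex) set" where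
  "multilinear_forms K E I = {T.
     (\<forall>x\<in>(\<Pi>\<^sub>E i\<in>I. carrier (E i)). T x \<in> K) \<and>
     (\<forall>x. x \<notin> (\<Pi>\<^sub>E i\<in>I. carrier (E i)) \<longrightarrow> T x = 0) \<and>
     (\<forall>x\<in>(\<Pi>\<^sub>E i\<in>I. carrier (E i)). \<forall>i\<in>I. \<forall>u\<in>carrier (E i). \<forall>v\<in>carrier (E i).
        T (x(i := u \<oplus>\<^bsub>E i\<^esub> v)) = T (x(i := u)) + T (x(i := v))) \<and>
     (\<forall>x\<in>(\<Pi>\<^sub>E i\<in>I. carrier (E i)). \<forall>i\<in>I. \<forall>c\<in>K. \<forall>u\<in>carrier (E i).
        T (x(i := c \<odot>\<^bsub>E i\<^esub> u)) = c * T (x(i := u))) \<and>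
     (\<exists>C. \<forall>x\<in>(\<Pi>\<^sub>E i\<in>I. carrier (E i)). cmod (T x) \<le> C * (\<Prod>i\<in>I. nrm (E i) (x i)))}"

definition ball_product ::
    "complex set \<Rightarrow> (nat \<Rightarrow> 'a nspace) \<Rightarrow> nat set \<Rightarrow> (nat \<Rightarrow> 'a \<Rightarrow> complex) topology" where
  "ball_product K E I =
     product_topology (\<lambda>i. subtopology (weak_star K (E i)) (dual_ball K (E i))) I"

definition represents_integral ::
    "complex set \<Rightarrow> (nat \<Rightarrow> 'a nspace) \<Rightarrow> nat set \<Rightarrow> ((nat \<Rightarrow> 'a) \<Rightarrow> complex) \<Rightarrow>
     ((nat \<Rightarrow> 'a \<Rightarrow> complex) set \<Rightarrow> complex) \<Rightarrow> bool" where
  "represents_integral K E I T \<mu> \<longleftrightarrow>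
     radon_measure K (ball_product K E I) \<mu> \<and>
     (\<forall>x\<in>(\<Pi>\<^sub>E i\<in>I. carrier (E i)).
        T x = measure_integral (ball_product K E I) \<mu> (\<lambda>\<phi>. \<Prod>i\<in>I. \<phi> i (x i)))"

definition integral_forms ::
    "complex set \<Rightarrow> (nat \<Rightarrow> 'a nspace) \<Rightarrow> nat set \<Rightarrow> ((nat \<Rightarrow> 'a) \<Rightarrow> complex) set" where
  "integral_forms K E I = {T \<in> multilinear_forms K E I. \<exists>\<mu>. represents_integral K E I T \<mu>}"

definition integral_norm ::
    "complex set \<Rightarrow> (nat \<Rightarrow> 'a nspace) \<Rightarrow> nat set \<Rightarrow> ((nat \<Rightarrow> 'a) \<Rightarrow> complex) \<Rightarrow> real" where
  "integral_norm K E I T =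
     (INF \<mu>\<in>{\<mu>. represents_integral K E I T \<mu>}. total_variation (ball_product K E I) \<mu>)"

text \<open>The functional written \<open>x\<^sup>*\<close> with indices \<open>i, j\<close> in the usual notation is \<open>\<xi> i j\<close>;
  the series index \<open>j\<close> starts at 0.\<close>

definition represents_nuclear ::
    "complex set \<Rightarrow> (nat \<Rightarrow> 'a nspace) \<Rightarrow> nat set \<Rightarrow> ((nat \<Rightarrow> 'a) \<Rightarrow> complex) \<Rightarrow>
     (nat \<Rightarrow> nat \<Rightarrow> 'a \<Rightarrow> complex) \<Rightarrow> bool" where
  "represents_nuclear K E I M \<xi> \<longleftrightarrow>
     (\<forall>i\<in>I. \<forall>j. \<xi> i j \<in> dual K (E i)) \<and>
     summable (\<lambda>j. \<Prod>i\<in>I. dual_norm (E i) (\<xi> i j)) \<and>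
     (\<forall>x\<in>(\<Pi>\<^sub>E i\<in>I. carrier (E i)). (\<lambda>j. \<Prod>i\<in>I. \<xi> i j (x i)) sums M x)"

definition representation_sum ::
    "(nat \<Rightarrow> 'a nspace) \<Rightarrow> nat set \<Rightarrow> (nat \<Rightarrow> nat \<Rightarrow> 'a \<Rightarrow> complex) \<Rightarrow> real" where
  "representation_sum E I \<xi> = (\<Sum>j. \<Prod>i\<in>I. dual_norm (E i) (\<xi> i j))"

definition nuclear_forms ::
    "complex set \<Rightarrow> (nat \<Rightarrow> 'a nspace) \<Rightarrow> nat set \<Rightarrow> ((nat \<Rightarrow> 'a) \<Rightarrow> complex) set" where
  "nuclear_forms K E I = {M \<in> multilinear_forms K E I. \<exists>\<xi>. represents_nuclear K E I M \<xi>}"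

definition nuclear_norm ::
    "complex set \<Rightarrow> (nat \<Rightarrow> 'a nspace) \<Rightarrow> nat set \<Rightarrow> ((nat \<Rightarrow> 'a) \<Rightarrow> complex) \<Rightarrow> real" where
  "nuclear_norm K E I M =
     (INF \<xi>\<in>{\<xi>. represents_nuclear K E I M \<xi>}. representation_sum E I \<xi>)"

definition NA_nu ::
    "complex set \<Rightarrow> (nat \<Rightarrow> 'a nspace) \<Rightarrow> nat set \<Rightarrow> ((nat \<Rightarrow> 'a) \<Rightarrow> complex) set" where
  "NA_nu K E I = {M \<in> nuclear_forms K E I.
     \<exists>\<xi>. represents_nuclear K E I M \<xi> \<and> representation_sum E I \<xi> = nuclear_norm K E I M}"

definition nuclear_eq_integral_isometrically ::
    "complex set \<Rightarrow> (nat \<Rightarrow> 'a nspace) \<Rightarrow> nat set \<Rightarrow> bool" where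
  "nuclear_eq_integral_isometrically K E I \<longleftrightarrow>
     nuclear_forms K E I = integral_forms K E I \<and>
     (\<forall>M\<in>nuclear_forms K E I. nuclear_norm K E I M = integral_norm K E I M)"

end

theory Submission
  imports Defs
begin

text \<open>
  A form \<open>T\<close> on \<open>X\<^sub>0 \<times> \<dots> \<times> X\<^sub>N\<close> is integral with norm at most \<open>C\<close> iff it is bounded by \<open>C\<close> times the
  injective norm on formal tensors (Hahn-Banach and Riesz).  The injective norm is already attained
  on extreme points \<open>e\<close> of the dual ball of \<open>X\<^sub>0\<close>, so \<open>T\<close> is given by a positive functional \<open>L\<close> of mass
  at most the integral norm of \<open>T\<close> on scalars, extreme points and functionals of the other factors.
  Let \<open>w\<close> be the mass that \<open>L\<close> gives to the single extreme points.  Outside a finite set the extreme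
  points are close to cluster points, which lie in the ball of radius \<open>r < 1\<close>; hence the integral norm
  of \<open>T\<close> is at most \<open>w + r (mass L - w)\<close>, and this forces \<open>w = mass L\<close>.  Therefore \<open>T\<close> is the sum of
  \<open>e \<otimes> M\<^sub>e\<close> with integral forms \<open>M\<^sub>e\<close> whose norms sum up to the integral norm of \<open>T\<close>, and optimal nuclear
  representations of the \<open>M\<^sub>e\<close> combine to one of \<open>T\<close>.
\<close>

section \<open>Hahn-Banach for spaces of functions\<close>

text \<open>\<open>L\<close> acts on all bounded functions on the bare set of extreme points, not on
  continuous functions on its weak-star closure. Indicators of single extreme points are then
  legitimate test functions, with no question of measurability. The price is that \<open>L\<close>
  is only finitely additive, so a priori it may charge no single point at all; that it is atomic is
  forced by comparing norms. Let \<open>C\<close> be the integral norm of \<open>T\<close>, the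
  least dominating constant. Then \<open>mass L \<le> C \<le> (1 - r) w + r mass L\<close>, hence
  \<open>(1 - r) mass L \<le> (1 - r) w\<close>, and \<open>r < 1\<close> may be cancelled. A unit
  scalar is carried along as an extra coordinate: it plays the part of the density of a scalar
  measure with respect to its variation, so that everything can be phrased with positive
  functionals. Radon measures enter only through the definition of the integral norm. Once that norm
  is identified with the least dominating constant, the splitting works with domination alone.
  Attainment for the remaining factors matters because infinitely many slices are recombined and no
  error may be lost in any of them.\<close>

definition function_space :: "('q \<Rightarrow> real) set \<Rightarrow> bool" where
  "function_space V \<longleftrightarrow> (\<lambda>x. 0) \<in> V \<and> (\<forall>f\<in>V. \<forall>g\<in>V. (\<lambda>x. f x + g x) \<in> V) \<and>
     (\<forall>c. \<forall>f\<in>V. (\<lambda>x. c * f x) \<in> V)"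

definition sublinear_on :: "('q \<Rightarrow> real) set \<Rightarrow> (('q \<Rightarrow> real) \<Rightarrow> real) \<Rightarrow> bool" where
  "sublinear_on V p \<longleftrightarrow> (\<forall>f\<in>V. \<forall>g\<in>V. p (\<lambda>x. f x + g x) \<le> p f + p g) \<and>
     (\<forall>f\<in>V. \<forall>c\<ge>0. p (\<lambda>x. c * f x) = c * p f)"

lemma function_space_add:
  "function_space V \<Longrightarrow> f \<in> V \<Longrightarrow> g \<in> V \<Longrightarrow> (\<lambda>x. f x + g x) \<in> V"
  by (simp add: function_space_def)

lemma function_space_scale:
  "function_space V \<Longrightarrow> f \<in> V \<Longrightarrow> (\<lambda>x. c * f x) \<in> V"
  by (simp add: function_space_def)

lemma sublinear_on_add:
  "sublinear_on V p \<Longrightarrow> f \<in> V \<Longrightarrow> g \<in> V \<Longrightarrow> p (\<lambda>x. f x + g x) \<le> p f + p g"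
  by (simp add: sublinear_on_def)

lemma sublinear_on_scale:
  "sublinear_on V p \<Longrightarrow> f \<in> V \<Longrightarrow> 0 \<le> c \<Longrightarrow> p (\<lambda>x. c * f x) = c * p f"
  by (simp add: sublinear_on_def)

lemma function_space_diff:
  assumes "function_space V" "f \<in> V" "g \<in> V"
  shows "(\<lambda>x. f x - g x) \<in> V" and "(\<lambda>x. - g x) \<in> V"
proof -
  have "(\<lambda>x. (-1) * g x) \<in> V" by (rule function_space_scale[OF assms(1,3)])
  then show g: "(\<lambda>x. - g x) \<in> V" by simp
  have "(\<lambda>x. f x + (- g x)) \<in> V" by (rule function_space_add[OF assms(1,2) g])
  then show "(\<lambda>x. f x - g x) \<in> V" by simp
qed

lemma sublinear_on_zero:
  assumes "function_space V" "sublinear_on V q"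
  shows "q (\<lambda>x. 0) = 0"
proof -
  have "q (\<lambda>x. 0 * (0::real)) = 0 * q (\<lambda>x. 0)"
    by (rule sublinear_on_scale[OF assms(2)]) (use assms(1) in \<open>simp_all add: function_space_def\<close>)
  then show ?thesis by simp
qed

lemma sublinear_on_neg:
  assumes "function_space V" "sublinear_on V q" "f \<in> V"
  shows "- q (\<lambda>x. - f x) \<le> q f"
proof -
  have "q (\<lambda>x. f x + - f x) \<le> q f + q (\<lambda>x. - f x)"
    by (rule sublinear_on_add[OF assms(2,3) function_space_diff(2)[OF assms(1,3,3)]])
  then show ?thesis using sublinear_on_zero[OF assms(1,2)] by simp
qed

text \<open>The functional is an infimal convolution: \<open>r f\<close> is the infimum of
  \<open>q (f - w) + l\<close> over \<open>(w, l)\<close> in the cone \<open>G\<close>. The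
  hypothesis \<open>lower\<close> bounds this infimum below by \<open>- q (- f)\<close>. It serves
  twice: for the graph of a prescribed functional and, in the proof of linearity, for a single
  ray.\<close>

lemma sublinear_on_inf_cone:
  assumes V: "function_space V" and q: "sublinear_on V q"
    and G0: "((\<lambda>x. 0), 0) \<in> G" and GV: "\<And>w l. (w, l) \<in> G \<Longrightarrow> w \<in> V"
    and Gadd: "\<And>w l w' l'. (w, l) \<in> G \<Longrightarrow> (w', l') \<in> G \<Longrightarrow> ((\<lambda>x. w x + w' x), l + l') \<in> G"
    and Gscale: "\<And>w l c. (w, l) \<in> G \<Longrightarrow> 0 < c \<Longrightarrow> ((\<lambda>x. c * w x), c * l) \<in> G"
    and lower: "\<And>w l. (w, l) \<in> G \<Longrightarrow> - q (\<lambda>x. - w x) \<le> l"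
  obtains r where "sublinear_on V r" "\<And>f. f \<in> V \<Longrightarrow> r f \<le> q f"
    "\<And>w l. (w, l) \<in> G \<Longrightarrow> r w \<le> l" "\<And>f. f \<notin> V \<Longrightarrow> r f = 0"
proof -
  define S where "S f = (\<lambda>(w, l). q (\<lambda>x. f x - w x) + l) ` G" for f
  define r where "r f = (if f \<in> V then Inf (S f) else 0)" for f
  have add: "\<And>f g. f \<in> V \<Longrightarrow> g \<in> V \<Longrightarrow> q (\<lambda>x. f x + g x) \<le> q f + q g"
    and scale: "\<And>f c. f \<in> V \<Longrightarrow> 0 \<le> c \<Longrightarrow> q (\<lambda>x. c * f x) = c * q f"
    using sublinear_on_add[OF q] sublinear_on_scale[OF q] by simp_all
  note Vd = function_space_diff[OF V]
  have Vadd: "\<And>f g. f \<in> V \<Longrightarrow> g \<in> V \<Longrightarrow> (\<lambda>x. f x + g x) \<in> V"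
    and Vscale: "\<And>f c. f \<in> V \<Longrightarrow> (\<lambda>x. c * f x) \<in> V" and V0: "(\<lambda>x. 0) \<in> V"
    using V by (simp_all add: function_space_def)
  have bd: "- q (\<lambda>x. - f x) \<le> q (\<lambda>x. f x - w x) + l" if "f \<in> V" "(w, l) \<in> G" for f w l
  proof -
    have "q (\<lambda>x. (f x - w x) + - f x) \<le> q (\<lambda>x. f x - w x) + q (\<lambda>x. - f x)"
      by (rule add) (use Vd that GV in auto)
    then have "q (\<lambda>x. - w x) \<le> q (\<lambda>x. f x - w x) + q (\<lambda>x. - f x)" by simp
    then show ?thesis using lower[OF that(2)] by linarith
  qed
  have bdd: "bdd_below (S f)" if "f \<in> V" for f
    unfolding S_def by (rule bdd_belowI[of _ "- q (\<lambda>x. - f x)"]) (use bd that in auto)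
  have le: "r f \<le> q (\<lambda>x. f x - w x) + l" if "f \<in> V" "(w, l) \<in> G" for f w l
    using that bdd by (auto simp: r_def S_def intro!: cInf_lower)
  have ge: "z \<le> r f" if "f \<in> V" "\<And>w l. (w, l) \<in> G \<Longrightarrow> z \<le> q (\<lambda>x. f x - w x) + l" for f z
    using that G0 by (auto simp: r_def S_def intro!: cInf_greatest)
  have r_add: "r (\<lambda>x. f x + g x) \<le> r f + r g" if fg: "f \<in> V" "g \<in> V" for f g
  proof -
    have "r (\<lambda>x. f x + g x) - r g \<le> r f"
    proof (rule ge[OF fg(1)])
      fix w l assume wl: "(w, l) \<in> G"
      have "r (\<lambda>x. f x + g x) - (q (\<lambda>x. f x - w x) + l) \<le> r g"
      proof (rule ge[OF fg(2)])
        fix w' l' assume wl': "(w', l') \<in> G"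
        have "r (\<lambda>x. f x + g x) \<le> q (\<lambda>x. (f x + g x) - (w x + w' x)) + (l + l')"
          by (rule le[OF Vadd[OF fg] Gadd[OF wl wl']])
        also have "q (\<lambda>x. (f x + g x) - (w x + w' x)) = q (\<lambda>x. (f x - w x) + (g x - w' x))"
          by (simp add: algebra_simps)
        also have "\<dots> \<le> q (\<lambda>x. f x - w x) + q (\<lambda>x. g x - w' x)"
          by (rule add) (use fg GV wl wl' Vd in auto)
        finally show "r (\<lambda>x. f x + g x) - (q (\<lambda>x. f x - w x) + l) \<le> q (\<lambda>x. g x - w' x) + l'"
          by linarith
      qed
      then show "r (\<lambda>x. f x + g x) - r g \<le> q (\<lambda>x. f x - w x) + l" by linarith
    qed
    then show ?thesis by linarith
  qed
  have r_scale_le: "r (\<lambda>x. c * f x) \<le> c * r f" if f: "f \<in> V" and c: "0 < c" for f c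
  proof -
    have "r (\<lambda>x. c * f x) / c \<le> r f"
    proof (rule ge[OF f])
      fix w l assume wl: "(w, l) \<in> G"
      have "r (\<lambda>x. c * f x) \<le> q (\<lambda>x. c * f x - c * w x) + c * l"
        by (rule le[OF Vscale[OF f] Gscale[OF wl c]])
      also have "q (\<lambda>x. c * f x - c * w x) = c * q (\<lambda>x. f x - w x)"
        using scale[of "\<lambda>x. f x - w x" c] Vd(1)[OF f GV[OF wl]] c by (simp add: algebra_simps)
      finally show "r (\<lambda>x. c * f x) / c \<le> q (\<lambda>x. f x - w x) + l"
        using c by (simp add: field_simps)
    qed
    then show ?thesis using c by (simp add: field_simps)
  qed
  have r0: "r (\<lambda>x. 0) = 0"
  proof (rule antisym)
    show "r (\<lambda>x. 0) \<le> 0" using le[OF V0 G0] sublinear_on_zero[OF V q] by simp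
    show "0 \<le> r (\<lambda>x. 0)" by (rule ge[OF V0]) (use lower in force)
  qed
  have r_scale: "r (\<lambda>x. c * f x) = c * r f" if f: "f \<in> V" and c: "0 \<le> c" for f c
  proof (cases "c = 0")
    case True
    then show ?thesis using r0 by simp
  next
    case False
    then have c: "0 < c" using c by simp
    \<comment> \<open>The reverse inequality is \<open>r_scale_le\<close> again, for the factor
      \<open>inverse c\<close> and the function \<open>c f\<close>.\<close>
    have "r (\<lambda>x. inverse c * (c * f x)) \<le> inverse c * r (\<lambda>x. c * f x)"
      by (rule r_scale_le[OF Vscale[OF f]]) (use c in simp)
    then have "r f \<le> inverse c * r (\<lambda>x. c * f x)"
      using c by (simp add: mult.assoc[symmetric])
    then have "c * r f \<le> r (\<lambda>x. c * f x)" using c by (simp add: field_simps)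
    then show ?thesis using r_scale_le[OF f c] by linarith
  qed
  show ?thesis
  proof
    show "sublinear_on V r" by (simp add: sublinear_on_def r_add r_scale)
    show "r f \<le> q f" if "f \<in> V" for f using le[OF that G0] by simp
    show "r w \<le> l" if "(w, l) \<in> G" for w l
      using le[OF GV[OF that] that] sublinear_on_zero[OF V q] by simp
    show "r f = 0" if "f \<notin> V" for f using that by (simp add: r_def)
  qed
qed

text \<open>Zorn's lemma for the reversed pointwise order. The pointwise infimum of a chain is
  finite because every member satisfies \<open>- p (- f) \<le> q f\<close>, and it is subadditive
  because of any two members one lies below the other.\<close>

lemma minimal_sublinear_exists:
  assumes V: "function_space V" and p: "sublinear_on V p"
  obtains q where "sublinear_on V q" "\<And>f. f \<in> V \<Longrightarrow> q f \<le> p f"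
    "\<And>r f. sublinear_on V r \<Longrightarrow> (\<And>g. g \<in> V \<Longrightarrow> r g \<le> q g) \<Longrightarrow> f \<in> V \<Longrightarrow> r f = q f"
proof -
  \<comment> \<open>The value 0 off \<open>V\<close> turns the order of the function type into
    comparison on \<open>V\<close>, which makes it antisymmetric on these functionals.\<close>
  define A where "A = {q. sublinear_on V q \<and> (\<forall>f\<in>V. q f \<le> p f) \<and> (\<forall>f. f \<notin> V \<longrightarrow> q f = 0)}"
  have "\<exists>m\<in>A. \<forall>a\<in>A. a \<le> m \<longrightarrow> a = m"
  proof (rule predicate_Zorn[where P="\<lambda>x y. y \<le> x"])
    show "partial_order_on A (relation_of (\<lambda>x y. y \<le> x) A)"
      by (auto simp: partial_order_on_def preorder_on_def refl_on_def trans_def antisym_def relation_of_def)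
  next
    fix C assume C: "C \<in> Chains (relation_of (\<lambda>x y. y \<le> x) A)"
    then have CA: "C \<subseteq> A" and ch: "\<And>a b. a \<in> C \<Longrightarrow> b \<in> C \<Longrightarrow> a \<le> b \<or> b \<le> a"
      unfolding Chains_def relation_of_def by auto
    show "\<exists>u\<in>A. \<forall>a\<in>C. u \<le> a"
    proof (cases "C = {}")
      case True
      define u where "u f = (if f \<in> V then p f else 0)" for f
      have "sublinear_on V u"
        using p V by (simp add: sublinear_on_def u_def function_space_def)
      then have "u \<in> A" unfolding A_def u_def by auto
      then show ?thesis using True by auto
    next
      case False
      define u where "u f = (if f \<in> V then INF q\<in>C. q f else 0)" for f
      have sub: "sublinear_on V q" if "q \<in> C" for q using that CA A_def by auto
      have "- p (\<lambda>x. - f x) \<le> q f" if "q \<in> C" "f \<in> V" for q f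
      proof -
        have "q (\<lambda>x. - f x) \<le> p (\<lambda>x. - f x)"
          using that(1) CA function_space_diff(2)[OF V that(2) that(2)] A_def by blast
        then show ?thesis using sublinear_on_neg[OF V sub[OF that(1)] that(2)] by linarith
      qed
      then have bdd: "bdd_below ((\<lambda>q. q f) ` C)" if "f \<in> V" for f
        using that by (intro bdd_belowI[of _ "- p (\<lambda>x. - f x)"]) auto
      have le: "u f \<le> q f" if "f \<in> V" "q \<in> C" for f q
        using that bdd unfolding u_def by (auto intro: cINF_lower)
      have ge: "z \<le> u f" if "f \<in> V" "\<And>q. q \<in> C \<Longrightarrow> z \<le> q f" for f z
        using that False unfolding u_def by (auto intro: cINF_greatest)
      have "sublinear_on V u"
        unfolding sublinear_on_def
      proof (intro conjI ballI allI impI)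
        fix f g assume fg: "f \<in> V" "g \<in> V"
        have fgV: "(\<lambda>x. f x + g x) \<in> V" by (rule function_space_add[OF V fg])
        have *: "u (\<lambda>x. f x + g x) \<le> q1 f + q2 g" if q: "q1 \<in> C" "q2 \<in> C" for q1 q2
        proof -
          obtain q where qq: "q \<in> C" "q \<le> q1" "q \<le> q2" using ch[OF q] q by blast
          have "u (\<lambda>x. f x + g x) \<le> q (\<lambda>x. f x + g x)" by (rule le[OF fgV qq(1)])
          also have "\<dots> \<le> q f + q g" by (rule sublinear_on_add[OF sub[OF qq(1)] fg])
          also have "\<dots> \<le> q1 f + q2 g" using qq by (intro add_mono) (auto simp: le_fun_def)
          finally show ?thesis .
        qed
        have "u (\<lambda>x. f x + g x) - u g \<le> u f"
        proof (rule ge[OF fg(1)])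
          fix q1 assume q1: "q1 \<in> C"
          have "u (\<lambda>x. f x + g x) - q1 f \<le> u g"
            by (rule ge[OF fg(2)]) (use *[OF q1] in \<open>simp add: algebra_simps\<close>)
          then show "u (\<lambda>x. f x + g x) - u g \<le> q1 f" by linarith
        qed
        then show "u (\<lambda>x. f x + g x) \<le> u f + u g" by linarith
      next
        fix f and c :: real assume f: "f \<in> V" and c: "0 \<le> c"
        have cf: "(\<lambda>x. c * f x) \<in> V" by (rule function_space_scale[OF V f])
        have sc: "q (\<lambda>x. c * f x) = c * q f" if "q \<in> C" for q
          by (rule sublinear_on_scale[OF sub[OF that] f c])
        show "u (\<lambda>x. c * f x) = c * u f"
        proof (cases "c = 0")
          case True
          obtain q where q: "q \<in> C" using False by auto
          have V0: "(\<lambda>x. 0) \<in> V" using V unfolding function_space_def by blast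
          have "u (\<lambda>x. 0) = 0"
            using le[OF V0 q] sublinear_on_zero[OF V sub[OF q]] ge[OF V0, of 0]
              sublinear_on_zero[OF V sub] by force
          then show ?thesis using True by simp
        next
          case False
          then have c: "0 < c" using c by simp
          show ?thesis
          proof (rule antisym)
            have "u (\<lambda>x. c * f x) / c \<le> u f"
              by (rule ge[OF f]) (use le[OF cf] sc c in \<open>force simp: field_simps\<close>)
            then show "u (\<lambda>x. c * f x) \<le> c * u f" using c by (simp add: field_simps)
            show "c * u f \<le> u (\<lambda>x. c * f x)"
              by (rule ge[OF cf]) (simp add: sc le[OF f] c)
          qed
        qed
      qed
      moreover have "\<forall>f\<in>V. u f \<le> p f"
      proof
        fix f assume f: "f \<in> V"
        obtain q where q: "q \<in> C" using False by auto
        then have "q f \<le> p f" using CA f unfolding A_def by auto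
        then show "u f \<le> p f" using le[OF f q] by linarith
      qed
      ultimately have "u \<in> A" unfolding A_def u_def by auto
      moreover have "\<forall>a\<in>C. u \<le> a"
        using le CA by (fastforce simp: le_fun_def u_def A_def)
      ultimately show ?thesis by blast
    qed
  qed
  then obtain m where m: "m \<in> A" and min: "\<And>a. a \<in> A \<Longrightarrow> a \<le> m \<Longrightarrow> a = m" by blast
  show ?thesis
  proof
    show "sublinear_on V m" "\<And>f. f \<in> V \<Longrightarrow> m f \<le> p f" using m unfolding A_def by auto
    fix r f assume r: "sublinear_on V r" "\<And>g. g \<in> V \<Longrightarrow> r g \<le> m g" "f \<in> V"
    define r' where "r' f = (if f \<in> V then r f else 0)" for f
    have "sublinear_on V r'"
      using r(1) V by (simp add: sublinear_on_def r'_def function_space_def)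
    moreover have "\<And>g. g \<in> V \<Longrightarrow> r g \<le> p g"
      using r(2) m unfolding A_def by force
    ultimately have "r' \<in> A" unfolding A_def r'_def by simp
    moreover have "r' \<le> m" using r(2) m by (auto simp: le_fun_def r'_def A_def)
    ultimately have "r' = m" by (rule min)
    then show "r f = m f" using r(3) by (metis r'_def)
  qed
qed

text \<open>The prescribed functional is a linear relation \<open>G\<close> between functions and values.  Domination
  by \<open>p\<close> makes it single-valued.  A minimal sublinear functional is linear, because passing to the
  infimum of \<open>q (f + t g) - t q g\<close> over \<open>t \<ge> 0\<close> cannot decrease it.\<close>

lemma hahn_banach_functions:
  assumes V: "function_space V" and p: "sublinear_on V p"
    and G0: "((\<lambda>x. 0), 0) \<in> G" and GV: "\<And>w l. (w, l) \<in> G \<Longrightarrow> w \<in> V"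
    and Gadd: "\<And>w l w' l'. (w, l) \<in> G \<Longrightarrow> (w', l') \<in> G \<Longrightarrow> ((\<lambda>x. w x + w' x), l + l') \<in> G"
    and Gscale: "\<And>w l c. (w, l) \<in> G \<Longrightarrow> ((\<lambda>x. c * w x), c * l) \<in> G"
    and dom: "\<And>w l. (w, l) \<in> G \<Longrightarrow> l \<le> p w"
  obtains L where "\<And>f g. f \<in> V \<Longrightarrow> g \<in> V \<Longrightarrow> L (\<lambda>x. f x + g x) = L f + L g"
    "\<And>f c. f \<in> V \<Longrightarrow> L (\<lambda>x. c * f x) = c * L f"
    "\<And>f. f \<in> V \<Longrightarrow> L f \<le> p f" "\<And>w l. (w, l) \<in> G \<Longrightarrow> L w = l"
proof -
  have Gneg: "((\<lambda>x. - w x), - l) \<in> G" if "(w, l) \<in> G" for w l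
    using Gscale[OF that, of "-1"] by simp
  have low: "- p (\<lambda>x. - w x) \<le> l" if "(w, l) \<in> G" for w l
    using dom[OF Gneg[OF that]] by linarith
  \<comment> \<open>A linear functional below \<open>s\<close> automatically has the prescribed
    values: it is at most \<open>l\<close> at \<open>w\<close>, and \<open>G\<close> is closed under
    negation.\<close>
  obtain s where s: "sublinear_on V s" "\<And>f. f \<in> V \<Longrightarrow> s f \<le> p f" "\<And>w l. (w, l) \<in> G \<Longrightarrow> s w \<le> l"
    by (rule sublinear_on_inf_cone[OF V p G0 GV Gadd Gscale low]) auto
  obtain q where q: "sublinear_on V q" and qs: "\<And>f. f \<in> V \<Longrightarrow> q f \<le> s f"
    and min: "\<And>r f. sublinear_on V r \<Longrightarrow> (\<And>g. g \<in> V \<Longrightarrow> r g \<le> q g) \<Longrightarrow> f \<in> V \<Longrightarrow> r f = q f"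
    by (rule minimal_sublinear_exists[OF V s(1)]) metis
  have add: "\<And>f g. f \<in> V \<Longrightarrow> g \<in> V \<Longrightarrow> q (\<lambda>x. f x + g x) \<le> q f + q g"
    and scale: "\<And>f c. f \<in> V \<Longrightarrow> 0 \<le> c \<Longrightarrow> q (\<lambda>x. c * f x) = c * q f"
    using sublinear_on_add[OF q] sublinear_on_scale[OF q] by simp_all
  have Vadd: "\<And>f g. f \<in> V \<Longrightarrow> g \<in> V \<Longrightarrow> (\<lambda>x. f x + g x) \<in> V"
    and Vscale: "\<And>f c. f \<in> V \<Longrightarrow> (\<lambda>x. c * f x) \<in> V" and V0: "(\<lambda>x. 0) \<in> V"
    using V by (simp_all add: function_space_def)
  note Vneg = function_space_diff(2)[OF V]
  have odd: "q (\<lambda>x. - g x) = - q g" if g: "g \<in> V" for g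
  proof -
    \<comment> \<open>The ray through \<open>(- g, - q g)\<close>. Its infimal convolution with
      \<open>q\<close> stays below \<open>q\<close>, hence equals \<open>q\<close> by minimality,
      and its value at \<open>- g\<close> is at most \<open>- q g\<close>.\<close>
    define H where "H = {((\<lambda>x. - t * g x), - t * q g) |t. 0 \<le> (t::real)}"
    have H1: "((\<lambda>x. - g x), - q g) \<in> H" unfolding H_def by (rule CollectI, rule exI[of _ 1]) simp
    obtain r where r: "sublinear_on V r" "\<And>f. f \<in> V \<Longrightarrow> r f \<le> q f" "\<And>w l. (w, l) \<in> H \<Longrightarrow> r w \<le> l"
    proof (rule sublinear_on_inf_cone[OF V q, of H])
      show "((\<lambda>x. 0), 0) \<in> H" unfolding H_def by (rule CollectI, rule exI[of _ 0]) simp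
      show "w \<in> V" if "(w, l) \<in> H" for w l
        using that unfolding H_def by (auto simp: Vneg[OF g Vscale[OF g]])
      show "((\<lambda>x. w x + w' x), l + l') \<in> H" if wl: "(w, l) \<in> H" "(w', l') \<in> H" for w l w' l'
      proof -
        obtain t t' where t: "0 \<le> t" "w = (\<lambda>x. - t * g x)" "l = - t * q g"
          "0 \<le> t'" "w' = (\<lambda>x. - t' * g x)" "l' = - t' * q g" using wl unfolding H_def by blast
        show ?thesis unfolding H_def
          by (rule CollectI, rule exI[of _ "t + t'"]) (use t in \<open>simp add: algebra_simps\<close>)
      qed
      show "((\<lambda>x. c * w x), c * l) \<in> H" if wl: "(w, l) \<in> H" "0 < c" for w l c
      proof -
        obtain t where t: "0 \<le> t" "w = (\<lambda>x. - t * g x)" "l = - t * q g"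
          using wl unfolding H_def by blast
        show ?thesis unfolding H_def
          by (rule CollectI, rule exI[of _ "c * t"]) (use t wl(2) in \<open>simp add: algebra_simps\<close>)
      qed
      show "- q (\<lambda>x. - w x) \<le> l" if wl: "(w, l) \<in> H" for w l
      proof -
        obtain t where t: "0 \<le> t" "w = (\<lambda>x. - t * g x)" "l = - t * q g"
          using wl unfolding H_def by blast
        then show ?thesis using scale[OF g t(1)] by simp
      qed
    qed metis
    have "r (\<lambda>x. - g x) \<le> - q g" by (rule r(3)[OF H1])
    moreover have "r (\<lambda>x. - g x) = q (\<lambda>x. - g x)"
      by (rule min[OF r(1,2) Vneg[OF g g]])
    moreover have "- q (\<lambda>x. - g x) \<le> q g" by (rule sublinear_on_neg[OF V q g])
    ultimately show ?thesis by linarith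
  qed
  show ?thesis
  proof
    fix f g assume fg: "f \<in> V" "g \<in> V"
    have "q (\<lambda>x. (f x + g x) + - g x) \<le> q (\<lambda>x. f x + g x) + q (\<lambda>x. - g x)"
      by (rule add) (use fg Vadd Vneg in auto)
    then show "q (\<lambda>x. f x + g x) = q f + q g" using odd[OF fg(2)] add[OF fg] by simp
  next
    fix f c assume f: "f \<in> V"
    show "q (\<lambda>x. c * f x) = c * q f"
    proof (cases "0 \<le> c")
      case False
      then have "q (\<lambda>x. - c * f x) = - c * q f" by (intro scale[OF f]) simp
      then show ?thesis using odd[OF Vscale[OF f, of "-c"]] by simp
    qed (use scale[OF f] in simp)
  next
    show "q f \<le> p f" if "f \<in> V" for f using qs[OF that] s(2)[OF that] by linarith
  next
    fix w l assume wl: "(w, l) \<in> G"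
    have "q w \<le> l" using qs[OF GV[OF wl]] s(3)[OF wl] by linarith
    moreover have "q (\<lambda>x. - w x) \<le> - l"
      using qs[OF GV[OF Gneg[OF wl]]] s(3)[OF Gneg[OF wl]] by linarith
    ultimately show "q w = l" using odd[OF GV[OF wl]] by linarith
  qed
qed

section \<open>Positive functionals on bounded functions\<close>

lemma bounded_const_image [simp]: "bounded ((\<lambda>x. c) ` A)"
  by (cases "A = {}") (auto simp: image_constant_conv)

text \<open>The last conclusion keeps the multiplier inside the scalar field when that field is
  \<real>.\<close>

lemma unimodular_multiplier:
  obtains u where "cmod u = 1" "u * z = complex_of_real (cmod z)" "z \<in> \<real> \<Longrightarrow> u \<in> \<real>"
proof (cases "z = 0")
  case True
  then show ?thesis using that[of 1] by simp
next
  case False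
  show ?thesis
  proof (rule that[of "cnj z / complex_of_real (cmod z)"])
    show "cmod (cnj z / complex_of_real (cmod z)) = 1" using False by (simp add: norm_divide)
    have "cnj z * z = complex_of_real (cmod z) * complex_of_real (cmod z)"
      using complex_norm_square[of z] by (metis mult.commute of_real_power power2_eq_square)
    then show "cnj z / complex_of_real (cmod z) * z = complex_of_real (cmod z)"
      using False by simp
    show "cnj z / complex_of_real (cmod z) \<in> \<real>" if "z \<in> \<real>"
      using that by (simp add: Reals_cnj_iff)
  qed
qed

lemma bounded_sum_image:
  fixes f :: "'i \<Rightarrow> 'b \<Rightarrow> 'c::real_normed_vector"
  assumes "\<And>i. i \<in> I \<Longrightarrow> bounded (f i ` A)"
  shows "bounded ((\<lambda>x. \<Sum>i\<in>I. f i x) ` A)"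
  using assms
proof (induction I rule: infinite_finite_induct)
  case (insert i I)
  have "bounded ((\<lambda>x. f i x + (\<Sum>i\<in>I. f i x)) ` A)"
    by (rule bounded_plus_comp) (simp_all add: insert)
  then show ?case using insert.hyps by simp
qed simp_all

lemma bounded_Re_image: "bounded (g ` A) \<Longrightarrow> bounded ((\<lambda>x. Re (g x)) ` A)"
  and bounded_Im_image: "bounded (g ` A) \<Longrightarrow> bounded ((\<lambda>x. Im (g x)) ` A)"
  by (rule bounded_linear_image[OF _ bounded_linear_Re, of "g ` A", unfolded image_image]
      bounded_linear_image[OF _ bounded_linear_Im, of "g ` A", unfolded image_image], assumption)+

lemma bounded_mult_image:
  fixes f g :: "'b \<Rightarrow> 'c::real_normed_algebra"
  assumes "bounded (f ` A)" "bounded (g ` A)"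
  shows "bounded ((\<lambda>x. f x * g x) ` A)"
proof -
  obtain B1 where B1: "\<forall>x\<in>A. norm (f x) \<le> B1" using assms(1) by (auto simp: bounded_iff)
  obtain B2 where B2: "\<forall>x\<in>A. norm (g x) \<le> B2" using assms(2) by (auto simp: bounded_iff)
  have "norm (f x * g x) \<le> B1 * B2" if "x \<in> A" for x
  proof -
    have "norm (f x * g x) \<le> norm (f x) * norm (g x)" by (rule norm_mult_ineq)
    also have "\<dots> \<le> B1 * B2"
      by (intro mult_mono) (use B1 B2 that order_trans[OF norm_ge_zero] in auto)
    finally show ?thesis .
  qed
  then show ?thesis by (auto simp: bounded_iff)
qed

text \<open>Neither a topology on \<open>Q\<close> nor any continuity of \<open>L\<close> is
  involved; such an \<open>L\<close> is integration against a finitely additive measure on all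
  subsets of \<open>Q\<close>.\<close>

locale positive_functional =
  fixes Q :: "'q set" and L :: "('q \<Rightarrow> real) \<Rightarrow> real"
  assumes L_add: "bounded (f ` Q) \<Longrightarrow> bounded (g ` Q) \<Longrightarrow> L (\<lambda>x. f x + g x) = L f + L g"
    and L_scale: "bounded (f ` Q) \<Longrightarrow> L (\<lambda>x. c * f x) = c * L f"
    and L_nonneg: "bounded (f ` Q) \<Longrightarrow> (\<And>x. x \<in> Q \<Longrightarrow> 0 \<le> f x) \<Longrightarrow> 0 \<le> L f"
begin

lemma L_zero: "L (\<lambda>x. 0) = 0"
  using L_scale[of "\<lambda>x. 0" 0] by simp

lemma L_const: "L (\<lambda>x. c) = c * L (\<lambda>x. 1)"
  using L_scale[of "\<lambda>x. 1" c] by simp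

lemma L_uminus: "bounded (f ` Q) \<Longrightarrow> L (\<lambda>x. - f x) = - L f"
  using L_scale[of f "-1"] by simp

lemma L_diff:
  assumes "bounded (f ` Q)" "bounded (g ` Q)"
  shows "L (\<lambda>x. f x - g x) = L f - L g"
proof -
  have "bounded ((\<lambda>x. - g x) ` Q)" using assms(2) by (simp add: bounded_iff)
  then have "L (\<lambda>x. f x + - g x) = L f + L (\<lambda>x. - g x)" by (rule L_add[OF assms(1)])
  then show ?thesis using L_uminus[OF assms(2)] by simp
qed

lemma L_mono:
  assumes "bounded (f ` Q)" "bounded (g ` Q)" "\<And>x. x \<in> Q \<Longrightarrow> f x \<le> g x"
  shows "L f \<le> L g"
proof -
  have "0 \<le> L (\<lambda>x. g x - f x)"
    by (rule L_nonneg[OF bounded_minus_comp[OF assms(2,1)]]) (use assms(3) in simp)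
  then show ?thesis using L_diff[OF assms(2,1)] by simp
qed

text \<open>Values off \<open>Q\<close> are invisible to \<open>L\<close> by positivity alone: each
  function dominates the other on \<open>Q\<close>.\<close>

lemma L_cong:
  assumes "bounded (f ` Q)" "\<And>x. x \<in> Q \<Longrightarrow> f x = g x"
  shows "L f = L g"
proof -
  have "bounded (g ` Q)" using assms by (metis image_cong)
  then show ?thesis using assms by (intro antisym L_mono) auto
qed

lemma L_sum:
  assumes "\<And>i. i \<in> I \<Longrightarrow> bounded (f i ` Q)"
  shows "L (\<lambda>x. \<Sum>i\<in>I. f i x) = (\<Sum>i\<in>I. L (f i))"
  using assms
proof (induction I rule: infinite_finite_induct)
  case (insert i I)
  have "L (\<lambda>x. f i x + (\<Sum>i\<in>I. f i x)) = L (f i) + L (\<lambda>x. \<Sum>i\<in>I. f i x)"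
    by (rule L_add) (use insert in \<open>auto intro: bounded_sum_image\<close>)
  then show ?case using insert by simp
qed (auto simp: L_zero)

text \<open>The complex-linear extension of \<open>L\<close> to complex-valued functions.\<close>

definition clift :: "('q \<Rightarrow> complex) \<Rightarrow> complex" where
  "clift g = Complex (L (\<lambda>x. Re (g x))) (L (\<lambda>x. Im (g x)))"

lemma clift_add:
  assumes "bounded (f ` Q)" "bounded (g ` Q)"
  shows "clift (\<lambda>x. f x + g x) = clift f + clift g"
  using assms by (simp add: clift_def complex_eq_iff L_add bounded_Re_image bounded_Im_image)

lemma clift_scale:
  assumes "bounded (f ` Q)"
  shows "clift (\<lambda>x. c * f x) = c * clift f"
proof -
  have b: "bounded ((\<lambda>x. a * Re (f x)) ` Q)" "bounded ((\<lambda>x. a * Im (f x)) ` Q)" for a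
    using assms
    by (simp_all add: bounded_mult_image bounded_Re_image[OF assms] bounded_Im_image[OF assms])
  show ?thesis using assms b
    by (simp add: clift_def complex_eq_iff L_add L_diff L_scale bounded_Re_image bounded_Im_image)
qed

lemma clift_zero: "clift (\<lambda>x. 0) = 0"
  by (simp add: clift_def L_zero complex_eq_iff)

lemma clift_sum:
  assumes "\<And>i. i \<in> I \<Longrightarrow> bounded (f i ` Q)"
  shows "clift (\<lambda>x. \<Sum>i\<in>I. f i x) = (\<Sum>i\<in>I. clift (f i))"
  using assms
proof (induction I rule: infinite_finite_induct)
  case (insert i I)
  have "clift (\<lambda>x. f i x + (\<Sum>i\<in>I. f i x)) = clift (f i) + clift (\<lambda>x. \<Sum>i\<in>I. f i x)"
    by (rule clift_add) (use insert in \<open>auto intro: bounded_sum_image\<close>)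
  then show ?case using insert by simp
qed (auto simp: clift_zero)

lemma clift_sum_list:
  assumes "\<And>a. a \<in> set l \<Longrightarrow> bounded (f a ` Q)"
  shows "clift (\<lambda>x. \<Sum>a\<leftarrow>l. f a x) = (\<Sum>a\<leftarrow>l. clift (f a)) \<and> bounded ((\<lambda>x. \<Sum>a\<leftarrow>l. f a x) ` Q)"
  using assms
proof (induction l)
  case (Cons a l)
  then have IH: "clift (\<lambda>x. \<Sum>a\<leftarrow>l. f a x) = (\<Sum>a\<leftarrow>l. clift (f a))"
    and b: "bounded (f a ` Q)" "bounded ((\<lambda>x. \<Sum>a\<leftarrow>l. f a x) ` Q)" by simp_all
  show ?case using clift_add[OF b] bounded_plus_comp[OF b] by (simp add: IH)
qed (auto simp: clift_zero bounded_iff)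

lemma clift_cong:
  assumes "bounded (f ` Q)" "\<And>x. x \<in> Q \<Longrightarrow> f x = g x"
  shows "clift f = clift g"
  using L_cong[OF bounded_Re_image[OF assms(1)], of "\<lambda>x. Re (g x)"]
    L_cong[OF bounded_Im_image[OF assms(1)], of "\<lambda>x. Im (g x)"] assms(2)
  by (simp add: clift_def)

text \<open>Rotating \<open>g\<close> by a unit scalar makes the value of \<open>clift\<close> a
  nonnegative real; it is then \<open>L\<close> of a real part, which \<open>h\<close>
  dominates.\<close>

lemma cmod_clift_le:
  assumes h: "bounded (h ` Q)" and gh: "\<And>x. x \<in> Q \<Longrightarrow> cmod (g x) \<le> h x"
  shows "cmod (clift g) \<le> L h"
proof -
  obtain B where B: "\<forall>x\<in>Q. \<bar>h x\<bar> \<le> B" using h by (auto simp: bounded_iff)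
  have "cmod (g x) \<le> B" if "x \<in> Q" for x using gh[OF that] B that by fastforce
  then have g: "bounded (g ` Q)" unfolding bounded_iff by auto
  obtain u where u: "cmod u = 1" "u * clift g = cmod (clift g)" by (rule unimodular_multiplier)
  have ug: "bounded ((\<lambda>x. u * g x) ` Q)" using g by (intro bounded_mult_image) auto
  have "cmod (clift g) = Re (clift (\<lambda>x. u * g x))" using u(2) clift_scale[OF g] by simp
  also have "\<dots> = L (\<lambda>x. Re (u * g x))" by (simp add: clift_def)
  also have "\<dots> \<le> L h"
  proof (rule L_mono[OF bounded_Re_image[OF ug] h])
    fix x assume "x \<in> Q"
    have "Re (u * g x) \<le> cmod (u * g x)" by (rule complex_Re_le_cmod)
    then show "Re (u * g x) \<le> h x" using gh[OF \<open>x \<in> Q\<close>] u(1) by (simp add: norm_mult)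
  qed
  finally show ?thesis .
qed

end

section \<open>Functionals dominated by an injective norm\<close>

definition unit_scalars :: "complex set \<Rightarrow> complex set" where
  "unit_scalars K = {u \<in> K. cmod u = 1}"

text \<open>A list of pairs \<open>(c, x)\<close> stands for the formal combination of the \<open>x\<close> with coefficients \<open>c\<close>.  When
  \<open>ev\<close> evaluates elementary tensors at tuples of functionals, the supremum over \<open>Y\<close> of the left-hand sum
  is the injective norm of the combination.\<close>

definition dominated :: "complex set \<Rightarrow> 'y set \<Rightarrow> ('y \<Rightarrow> 'x \<Rightarrow> complex) \<Rightarrow> 'x set \<Rightarrow>
    ('x \<Rightarrow> complex) \<Rightarrow> real \<Rightarrow> bool" where
  "dominated K Y ev D T C \<longleftrightarrow> (\<forall>l M. set l \<subseteq> K \<times> D \<longrightarrow>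
     (\<forall>y\<in>Y. cmod (\<Sum>(c, x)\<leftarrow>l. c * ev y x) \<le> M) \<longrightarrow> cmod (\<Sum>(c, x)\<leftarrow>l. c * T x) \<le> C * M)"

lemma dominatedD:
  assumes "dominated K Y ev D T C" "set l \<subseteq> K \<times> D"
    "\<And>y. y \<in> Y \<Longrightarrow> cmod (\<Sum>(c, x)\<leftarrow>l. c * ev y x) \<le> M"
  shows "cmod (\<Sum>(c, x)\<leftarrow>l. c * T x) \<le> C * M"
  using assms unfolding dominated_def by blast

lemma scalar_sum_list_closed:
  assumes "K = \<real> \<or> K = UNIV" "\<And>a. a \<in> set l \<Longrightarrow> f a \<in> K"
  shows "(\<Sum>a\<leftarrow>l. f a) \<in> K"
  using assms(2) by (induction l) (use assms(1) in auto)

text \<open>Hahn-Banach below the sublinear functional \<open>C\<close> times the supremum. The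
  coordinate \<open>u\<close> turns moduli into suprema of real parts, as the supremum of
  \<open>Re (u z)\<close> over unit scalars is the modulus of \<open>z\<close>; domination of
  \<open>T\<close> thus becomes domination by \<open>p\<close> on the functions \<open>W l\<close>.
  A bound by a supremum, not by a norm, yields positivity: for \<open>f \<ge> 0\<close> the value at
  \<open>- f\<close> is at most 0. Since \<open>Y\<close> is a bare set, it may later be built from
  the extreme points.\<close>

lemma positive_functional_representation:
  fixes ev :: "'y \<Rightarrow> 'x \<Rightarrow> complex"
  assumes K: "K = \<real> \<or> K = UNIV" and Y: "Y \<noteq> {}" and C: "0 \<le> C"
    and evK: "\<And>y x. y \<in> Y \<Longrightarrow> x \<in> D \<Longrightarrow> ev y x \<in> K" and TK: "\<And>x. x \<in> D \<Longrightarrow> T x \<in> K"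
    and bdd: "\<And>x. x \<in> D \<Longrightarrow> bounded ((\<lambda>y. ev y x) ` Y)"
    and dom: "dominated K Y ev D T C"
  obtains L where "positive_functional (unit_scalars K \<times> Y) L" "L (\<lambda>_. 1) \<le> C"
    "\<And>x. x \<in> D \<Longrightarrow> T x = positive_functional.clift L (\<lambda>(u, y). u * ev y x)"
proof -
  define Q where "Q = unit_scalars K \<times> Y"
  define V where "V = {f :: complex \<times> 'y \<Rightarrow> real. bounded (f ` Q)}"
  define p where "p f = C * (SUP q\<in>Q. f q)" for f :: "complex \<times> 'y \<Rightarrow> real"
  define W where "W l = (\<lambda>(u, y). Re (u * (\<Sum>(c, x)\<leftarrow>l. c * ev y x)))" for l
  define G where "G = {(W l, Re (\<Sum>(c, x)\<leftarrow>l. c * T x)) |l. set l \<subseteq> K \<times> D}"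
  have Q0: "Q \<noteq> {}"
  proof -
    have "1 \<in> unit_scalars K" using K by (auto simp: unit_scalars_def)
    then show ?thesis using Y unfolding Q_def by blast
  qed
  have V: "function_space V"
    unfolding function_space_def V_def
    by (auto intro: bounded_plus_comp bounded_mult_image)
  have ba: "bdd_above (f ` Q)" if "f \<in> V" for f
    using that unfolding V_def by (simp add: bounded_imp_bdd_above)
  have ub: "f q \<le> (SUP q\<in>Q. f q)" if "f \<in> V" "q \<in> Q" for f q
    using that ba by (intro cSUP_upper) auto
  have p: "sublinear_on V p"
    unfolding sublinear_on_def
  proof (intro conjI ballI allI impI)
    fix f g assume fg: "f \<in> V" "g \<in> V"
    have "(SUP q\<in>Q. f q + g q) \<le> (SUP q\<in>Q. f q) + (SUP q\<in>Q. g q)"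
      by (rule cSUP_least[OF Q0]) (use ub fg in \<open>auto intro: add_mono\<close>)
    then show "p (\<lambda>x. f x + g x) \<le> p f + p g"
      unfolding p_def using C by (simp add: distrib_left[symmetric] mult_left_mono)
  next
    fix f and c :: real assume f: "f \<in> V" and c: "0 \<le> c"
    have le: "(SUP q\<in>Q. c * f q) \<le> c * (SUP q\<in>Q. f q)" if "f \<in> V" "0 \<le> c" for f c
      by (rule cSUP_least[OF Q0]) (use ub that in \<open>auto intro: mult_left_mono\<close>)
    have "(SUP q\<in>Q. c * f q) = c * (SUP q\<in>Q. f q)"
    proof (cases "c = 0")
      case True
      then show ?thesis using Q0 by simp
    next
      case False
      then have c: "0 < c" using c by simp
      have cf: "(\<lambda>q. c * f q) \<in> V" by (rule function_space_scale[OF V f])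
      have "(SUP q\<in>Q. inverse c * (c * f q)) \<le> inverse c * (SUP q\<in>Q. c * f q)"
        by (rule le[OF cf]) (use c in simp)
      also have "(\<lambda>q. inverse c * (c * f q)) = f" using c by (simp add: fun_eq_iff)
      finally have "c * (SUP q\<in>Q. f q) \<le> (SUP q\<in>Q. c * f q)" using c by (simp add: field_simps)
      then show ?thesis using le[OF f, of c] c by simp
    qed
    then show "p (\<lambda>x. c * f x) = c * p f" by (simp add: p_def)
  qed
  have WV: "W l \<in> V" if l: "set l \<subseteq> K \<times> D" for l
  proof -
    have "bounded ((\<lambda>y. \<Sum>(c, x)\<leftarrow>l. c * ev y x) ` Y)" using l
    proof (induction l)
      case (Cons a l)
      obtain c x where a: "a = (c, x)" "x \<in> D" using Cons.prems by auto
      have "bounded ((\<lambda>y. c * ev y x + (\<Sum>(c, x)\<leftarrow>l. c * ev y x)) ` Y)"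
        using Cons a bdd
        by (intro bounded_plus_comp bounded_mult_image) auto
      then show ?case using a by simp
    qed (auto simp: bounded_iff)
    then obtain B where B: "\<forall>y\<in>Y. cmod (\<Sum>(c, x)\<leftarrow>l. c * ev y x) \<le> B"
      by (auto simp: bounded_iff)
    have "\<bar>W l q\<bar> \<le> B" if "q \<in> Q" for q
    proof -
      obtain u y where q: "q = (u, y)" "cmod u = 1" "y \<in> Y"
        using \<open>q \<in> Q\<close> by (cases q) (auto simp: Q_def unit_scalars_def)
      have "\<bar>W l q\<bar> \<le> cmod (u * (\<Sum>(c, x)\<leftarrow>l. c * ev y x))"
        unfolding W_def q by (simp only: prod.case abs_Re_le_cmod)
      also have "\<dots> = cmod (\<Sum>(c, x)\<leftarrow>l. c * ev y x)" by (simp add: norm_mult q(2))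
      also have "\<dots> \<le> B" by (rule bspec[OF B q(3)])
      finally show ?thesis .
    qed
    then have "\<forall>q\<in>Q. \<bar>W l q\<bar> \<le> B" by blast
    then show ?thesis unfolding V_def mem_Collect_eq bounded_iff ball_simps real_norm_def by (rule exI)
  qed
  have GV: "w \<in> V" if "(w, v) \<in> G" for w v using that WV unfolding G_def by auto
  have dom': "v \<le> p w" if wv: "(w, v) \<in> G" for w v
  proof -
    obtain l where l: "set l \<subseteq> K \<times> D" "w = W l" "v = Re (\<Sum>(c, x)\<leftarrow>l. c * T x)"
      using wv unfolding G_def by auto
    have "cmod (\<Sum>(c, x)\<leftarrow>l. c * T x) \<le> C * (SUP q\<in>Q. w q)"
    proof (rule dominatedD[OF dom l(1)])
      fix y assume y: "y \<in> Y"
      define z where "z = (\<Sum>(c, x)\<leftarrow>l. c * ev y x)"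
      have z: "z \<in> K" unfolding z_def
        by (rule scalar_sum_list_closed[OF K]) (use l(1) evK[OF y] K in auto)
      \<comment> \<open>The multiplier has to be a scalar of \<open>K\<close>: over \<real> the
        number \<open>z\<close> is real, so a sign is enough.\<close>
      obtain u where "cmod u = 1" "u * z = cmod z" "z \<in> \<real> \<Longrightarrow> u \<in> \<real>"
        by (rule unimodular_multiplier[of z]) auto
      then have u: "u \<in> unit_scalars K" "u * z = cmod z"
        using K z by (auto simp: unit_scalars_def)
      have "cmod z = Re (u * z)" unfolding u(2) by simp
      also have "\<dots> = w (u, y)" unfolding l(2) W_def z_def prod.case ..
      also have "\<dots> \<le> (SUP q\<in>Q. w q)" using u(1) y GV[OF wv] by (intro ub) (auto simp: Q_def)
      finally show "cmod (\<Sum>(c, x)\<leftarrow>l. c * ev y x) \<le> (SUP q\<in>Q. w q)" unfolding z_def .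
    qed
    then show ?thesis unfolding p_def l(3) using complex_Re_le_cmod order_trans by blast
  qed
  have Wmap: "W (map (\<lambda>(a, x). (complex_of_real c * a, x)) l) = (\<lambda>q. c * W l q)"
    "Re (\<Sum>(a, x)\<leftarrow>map (\<lambda>(a, x). (complex_of_real c * a, x)) l. a * T x) =
      c * Re (\<Sum>(a, x)\<leftarrow>l. a * T x)" for c l
  proof -
    have *: "(\<Sum>(a, x)\<leftarrow>map (\<lambda>(a, x). (complex_of_real c * a, x)) l. a * h x) =
      c * (\<Sum>(a, x)\<leftarrow>l. a * h x)" for h
      by (induction l) (auto simp: algebra_simps)
    show "W (map (\<lambda>(a, x). (complex_of_real c * a, x)) l) = (\<lambda>q. c * W l q)"
      unfolding W_def * by (auto simp: fun_eq_iff algebra_simps)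
    show "Re (\<Sum>(a, x)\<leftarrow>map (\<lambda>(a, x). (complex_of_real c * a, x)) l. a * T x) =
      c * Re (\<Sum>(a, x)\<leftarrow>l. a * T x)" unfolding * by simp
  qed
  have Wapp: "W (l @ l') = (\<lambda>q. W l q + W l' q)" for l l'
    by (auto simp: W_def fun_eq_iff algebra_simps)
  have G0: "((\<lambda>x. 0), 0) \<in> G" unfolding G_def W_def
    by (rule CollectI, rule exI[of _ "[]"]) auto
  have Gadd: "((\<lambda>x. w x + w' x), v + v') \<in> G" if wv: "(w, v) \<in> G" "(w', v') \<in> G" for w v w' v'
  proof -
    obtain l l' where l: "set l \<subseteq> K \<times> D" "w = W l" "v = Re (\<Sum>(c, x)\<leftarrow>l. c * T x)"
      "set l' \<subseteq> K \<times> D" "w' = W l'" "v' = Re (\<Sum>(c, x)\<leftarrow>l'. c * T x)"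
      using wv unfolding G_def by auto
    show ?thesis unfolding G_def
      by (rule CollectI, rule exI[of _ "l @ l'"])
        (use l(1,4) in \<open>simp add: Wapp l(2,3,5,6)\<close>)
  qed
  have Gscale: "((\<lambda>x. c * w x), c * v) \<in> G" if wv: "(w, v) \<in> G" for w v c
  proof -
    obtain l where l: "set l \<subseteq> K \<times> D" "w = W l" "v = Re (\<Sum>(c, x)\<leftarrow>l. c * T x)"
      using wv unfolding G_def by auto
    show ?thesis unfolding G_def
      by (rule CollectI, rule exI[of _ "map (\<lambda>(a, x). (complex_of_real c * a, x)) l"],
          unfold Wmap l) (use l K in auto)
  qed
  obtain L where L: "\<And>f g. f \<in> V \<Longrightarrow> g \<in> V \<Longrightarrow> L (\<lambda>x. f x + g x) = L f + L g"
    "\<And>f c. f \<in> V \<Longrightarrow> L (\<lambda>x. c * f x) = c * L f"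
    "\<And>f. f \<in> V \<Longrightarrow> L f \<le> p f" "\<And>w v. (w, v) \<in> G \<Longrightarrow> L w = v"
    by (rule hahn_banach_functions[OF V p G0 GV Gadd Gscale dom'], assumption+, rule that)
  have pf: "positive_functional Q L"
  proof
    show "0 \<le> L f" if "bounded (f ` Q)" "\<And>x. x \<in> Q \<Longrightarrow> 0 \<le> f x" for f
    proof -
      have f: "f \<in> V" using that V_def by auto
      have f': "(\<lambda>x. - f x) \<in> V" by (rule function_space_diff(2)[OF V f f])
      have "(SUP q\<in>Q. - f q) \<le> 0" by (rule cSUP_least[OF Q0]) (use that in auto)
      then have "p (\<lambda>x. - f x) \<le> 0" unfolding p_def using C by (simp add: mult_nonneg_nonpos)
      then have "L (\<lambda>x. - f x) \<le> 0" using L(3)[OF f'] by linarith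
      moreover have "L (\<lambda>x. (-1) * f x) = (-1) * L f" by (rule L(2)[OF f])
      ultimately show ?thesis by simp
    qed
  qed (use L(1,2) V_def in auto)
  have one: "L (\<lambda>_. 1) \<le> C"
  proof -
    have "(\<lambda>_. 1) \<in> V" unfolding V_def by (auto simp: bounded_iff)
    from L(3)[OF this] show ?thesis using Q0 by (simp add: p_def)
  qed
  have rep: "T x = positive_functional.clift L (\<lambda>(u, y). u * ev y x)" if x: "x \<in> D" for x
  proof -
    interpret positive_functional Q L by (rule pf)
    have val: "L (\<lambda>(u, y). Re (u * (c * ev y x))) = Re (c * T x)" if "c \<in> K" for c
    proof (rule L(4))
      show "((\<lambda>(u, y). Re (u * (c * ev y x))), Re (c * T x)) \<in> G"
        unfolding G_def W_def
        by (rule CollectI, rule exI[of _ "[(c, x)]"]) (use that x in auto)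
    qed
    \<comment> \<open>The extension prescribes real parts only. The coefficient 1 recovers the real
      part of \<open>T x\<close>, and the coefficient \<open>-\<i>\<close> its imaginary
      part.\<close>
    have val': "L (\<lambda>q. Re (c * (\<lambda>(u, y). u * ev y x) q)) = Re (c * T x)" if "c \<in> K" for c
      using val[OF that] by (simp add: case_prod_unfold mult.left_commute del: times_complex.simps)
    have re: "L (\<lambda>q. Re ((\<lambda>(u, y). u * ev y x) q)) = Re (T x)"
      using val'[of 1] K by auto
    have im: "L (\<lambda>q. Im ((\<lambda>(u, y). u * ev y x) q)) = Im (T x)"
    proof (cases "K = UNIV")
      case True
      then show ?thesis using val'[of "-\<i>"] by (simp del: times_complex.simps case_prod_unfold)
    next
      case False
      then have K: "K = \<real>" using K by simp
      have "Im (u * ev y x) = 0" if "(u, y) \<in> Q" for u y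
        using that evK[of y x] x unfolding Q_def unit_scalars_def K
        by (auto simp: complex_is_Real_iff)
      then have "L (\<lambda>q. 0) = L (\<lambda>q. Im ((\<lambda>(u, y). u * ev y x) q))"
        by (intro L_cong) (auto simp: bounded_iff case_prod_beta)
      then show ?thesis using TK[OF x] K L_zero by (simp add: complex_is_Real_iff)
    qed
    show ?thesis unfolding clift_def re im by simp
  qed
  show ?thesis by (rule that[OF pf[unfolded Q_def] one rep])
qed

section \<open>Riesz representation on a compact Hausdorff space\<close>

text \<open>First half of the classical passage from a content to a regular measure: open sets are
  measured from inside by closed sets (compact ones, in a compact space), and then arbitrary sets
  from outside by open sets.\<close>

definition inner_content :: "'b topology \<Rightarrow> ('b set \<Rightarrow> real) \<Rightarrow> 'b set \<Rightarrow> ennreal" where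
  "inner_content T m U = (SUP C\<in>{C. closedin T C \<and> C \<subseteq> U}. ennreal (m C))"

definition outer_content :: "'b topology \<Rightarrow> ('b set \<Rightarrow> real) \<Rightarrow> 'b set \<Rightarrow> ennreal" where
  "outer_content T m A = (INF U\<in>{U. openin T U \<and> A \<subseteq> U}. inner_content T m U)"

text \<open>Nothing ties \<open>m\<close> to the topology. The regular measure obtained from it can
  therefore differ from \<open>m\<close>; what survives is the total mass and a one-sided comparison
  on closed sets.\<close>

locale content =
  fixes T :: "'b topology" and m :: "'b set \<Rightarrow> real"
  assumes compact: "compact_space T" and Hausdorff: "Hausdorff_space T"
    and m_nonneg: "C \<subseteq> topspace T \<Longrightarrow> 0 \<le> m C"
    and m_mono: "C \<subseteq> D \<Longrightarrow> D \<subseteq> topspace T \<Longrightarrow> m C \<le> m D"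
    and m_disjoint: "C \<subseteq> topspace T \<Longrightarrow> D \<subseteq> topspace T \<Longrightarrow> C \<inter> D = {} \<Longrightarrow> m (C \<union> D) = m C + m D"
begin

lemma m_empty: "m {} = 0"
  using m_disjoint[of "{}" "{}"] by simp

lemma m_subadd:
  assumes "C \<subseteq> topspace T" "D \<subseteq> topspace T"
  shows "m (C \<union> D) \<le> m C + m D"
proof -
  have "m (C \<union> (D - C)) = m C + m (D - C)" using assms by (intro m_disjoint) auto
  moreover have "m (D - C) \<le> m D" using assms by (intro m_mono) auto
  ultimately show ?thesis by simp
qed

lemma inner_content_ge: "closedin T C \<Longrightarrow> C \<subseteq> U \<Longrightarrow> ennreal (m C) \<le> inner_content T m U"
  unfolding inner_content_def by (intro SUP_upper) auto

lemma inner_content_mono: "U \<subseteq> V \<Longrightarrow> inner_content T m U \<le> inner_content T m V"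
  unfolding inner_content_def by (intro SUP_subset_mono) auto

text \<open>Induction on \<open>n\<close>. Normality separates \<open>C - U n\<close> from
  \<open>C - V\<close> by disjoint open sets \<open>A\<close> and \<open>B\<close>. Then
  \<open>C - B\<close> lies in \<open>V\<close>, \<open>C - A\<close> lies in \<open>U n\<close>,
  both are closed, and together they cover \<open>C\<close>.\<close>

lemma inner_content_finite_cover:
  assumes "closedin T C" "C \<subseteq> (\<Union>i<n. U i)" "\<And>i. openin T (U i)"
  shows "ennreal (m C) \<le> (\<Sum>i<n::nat. inner_content T m (U i))"
  using assms(1,2)
proof (induction n arbitrary: C)
  case 0
  then show ?case by (simp add: m_empty)
next
  case (Suc n)
  define V where "V = (\<Union>i<n. U i)"
  have oV: "openin T V" unfolding V_def using assms(3) by (intro openin_Union) auto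
  have CV: "C \<subseteq> V \<union> U n" using Suc.prems(2) unfolding V_def lessThan_Suc by auto
  have "closedin T (C - U n)" "closedin T (C - V)"
    using Suc.prems(1) assms(3) oV by (auto intro: closedin_diff)
  moreover have "disjnt (C - U n) (C - V)" using CV by (auto simp: disjnt_def)
  ultimately obtain A B where AB: "openin T A" "openin T B" "C - U n \<subseteq> A" "C - V \<subseteq> B" "disjnt A B"
    using compact_Hausdorff_or_regular_imp_normal_space[OF compact] Hausdorff
    unfolding normal_space_def by metis
  have CB: "closedin T (C - B)" and CA: "closedin T (C - A)"
    using Suc.prems(1) AB by (auto intro: closedin_diff)
  have "C = (C - B) \<union> (C - A)" using AB(5) by (auto simp: disjnt_def)
  then have "m C \<le> m (C - B) + m (C - A)"
    using m_subadd[OF closedin_subset[OF CB] closedin_subset[OF CA]] by simp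
  then have "ennreal (m C) \<le> ennreal (m (C - B)) + ennreal (m (C - A))"
    using m_nonneg[OF closedin_subset[OF CB]] m_nonneg[OF closedin_subset[OF CA]]
    by (simp add: ennreal_plus[symmetric] del: ennreal_plus)
  also have "\<dots> \<le> (\<Sum>i<n. inner_content T m (U i)) + inner_content T m (U n)"
    using AB by (intro add_mono Suc.IH[OF CB] inner_content_ge[OF CA]) (auto simp: V_def)
  finally show ?case by simp
qed

text \<open>A closed set inside the union is compact, so finitely many of the open sets cover
  it.\<close>

lemma inner_content_Union:
  assumes U: "\<And>i::nat. openin T (U i)"
  shows "inner_content T m (\<Union>i. U i) \<le> (\<Sum>i. inner_content T m (U i))"
  unfolding inner_content_def[of T m "\<Union>i. U i"]
proof (rule SUP_least)
  fix C assume C: "C \<in> {C. closedin T C \<and> C \<subseteq> (\<Union>i. U i)}"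
  then have "compactin T C" using closedin_compact_space compact by auto
  moreover have "\<forall>W\<in>range U. openin T W" "C \<subseteq> \<Union>(range U)" using U C by auto
  ultimately obtain \<F> where F: "finite \<F>" "\<F> \<subseteq> range U" "C \<subseteq> \<Union>\<F>"
    unfolding compactin_def by metis
  then obtain I where I: "finite I" "\<F> = U ` I" by (meson finite_subset_image)
  obtain n where n: "I \<subseteq> {..<n}" using I(1) finite_nat_iff_bounded by auto
  have "ennreal (m C) \<le> (\<Sum>i<n. inner_content T m (U i))"
    by (rule inner_content_finite_cover[OF _ _ U]) (use C F(3) I(2) n in blast)+
  also have "\<dots> \<le> (\<Sum>i. inner_content T m (U i))" by (rule sum_le_suminf) auto
  finally show "ennreal (m C) \<le> (\<Sum>i. inner_content T m (U i))" .
qed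

lemma outer_content_mono: "A \<subseteq> B \<Longrightarrow> outer_content T m A \<le> outer_content T m B"
  unfolding outer_content_def by (intro INF_superset_mono) auto

lemma outer_content_open:
  assumes "openin T U"
  shows "outer_content T m U = inner_content T m U"
  unfolding outer_content_def
  by (rule antisym) (use assms in \<open>auto intro!: INF_lower INF_greatest inner_content_mono\<close>)

lemma outer_content_closed_ge:
  assumes "closedin T C"
  shows "ennreal (m C) \<le> outer_content T m C"
  unfolding outer_content_def by (intro INF_greatest inner_content_ge) (use assms in auto)

lemma inner_content_le_total: "U \<subseteq> topspace T \<Longrightarrow> inner_content T m U \<le> ennreal (m (topspace T))"
  unfolding inner_content_def
  by (intro SUP_least ennreal_leI m_mono) auto

lemma outer_content_le_total:
  assumes "A \<subseteq> topspace T"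
  shows "outer_content T m A \<le> ennreal (m (topspace T))"
proof -
  have "outer_content T m A \<le> outer_content T m (topspace T)" by (rule outer_content_mono[OF assms])
  also have "\<dots> = inner_content T m (topspace T)" by (simp add: outer_content_open)
  also have "\<dots> \<le> ennreal (m (topspace T))" by (rule inner_content_le_total) simp
  finally show ?thesis .
qed

lemma outer_content_approx:
  assumes "A \<subseteq> topspace T" "0 < e"
  obtains U where "openin T U" "A \<subseteq> U" "inner_content T m U \<le> outer_content T m A + ennreal e"
proof -
  have "outer_content T m A \<noteq> \<infinity>"
    using outer_content_le_total[OF assms(1)] by (auto simp: top_unique)
  from INF_approx_ennreal[OF _ outer_content_def this, of e] obtain U where
    "U \<in> {U. openin T U \<and> A \<subseteq> U}" "inner_content T m U < outer_content T m A + ennreal e"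
    using assms(2) by auto
  then show ?thesis using that by auto
qed

lemma outer_measure_space_outer_content:
  "outer_measure_space (Pow (topspace T)) (outer_content T m)"
  unfolding outer_measure_space_def
proof (intro conjI)
  have "inner_content T m {} = 0"
    unfolding inner_content_def by (auto simp: m_empty intro!: antisym SUP_least)
  then show "positive (Pow (topspace T)) (outer_content T m)"
    by (simp add: positive_def outer_content_open)
  show "increasing (Pow (topspace T)) (outer_content T m)"
    by (auto simp: increasing_def intro: outer_content_mono)
  show "countably_subadditive (Pow (topspace T)) (outer_content T m)"
    unfolding countably_subadditive_def
  proof (intro allI impI)
    fix A :: "nat \<Rightarrow> 'b set" assume A: "range A \<subseteq> Pow (topspace T)"
    show "outer_content T m (\<Union>i. A i) \<le> (\<Sum>i. outer_content T m (A i))"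
    proof (rule ennreal_le_epsilon)
      fix e :: real assume e: "0 < e"
      have "\<exists>U. openin T U \<and> A n \<subseteq> U \<and>
          inner_content T m U \<le> outer_content T m (A n) + ennreal (e * (1/2)^Suc n)" for n
      proof -
        have "A n \<subseteq> topspace T" "0 < e * (1/2)^Suc n" using A e by auto
        from outer_content_approx[OF this] show ?thesis by metis
      qed
      then obtain U where U: "\<And>n. openin T (U n)" "\<And>n. A n \<subseteq> U n"
        "\<And>n. inner_content T m (U n) \<le> outer_content T m (A n) + ennreal (e * (1/2)^Suc n)"
        by metis
      have "outer_content T m (\<Union>i. A i) \<le> outer_content T m (\<Union>i. U i)"
        by (rule outer_content_mono) (use U(2) in auto)
      also have "\<dots> = inner_content T m (\<Union>i. U i)"
        by (rule outer_content_open) (use U(1) in auto)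
      also have "\<dots> \<le> (\<Sum>i. inner_content T m (U i))" by (rule inner_content_Union[OF U(1)])
      also have "\<dots> \<le> (\<Sum>n. outer_content T m (A n) + ennreal (e * (1/2)^Suc n))"
        by (intro suminf_le U(3)) auto
      also have "\<dots> = (\<Sum>n. outer_content T m (A n)) + (\<Sum>n. ennreal e * ennreal ((1/2)^Suc n))"
        using e by (subst suminf_add[symmetric])
          (auto simp del: ennreal_suminf_cmult simp add: ennreal_mult[symmetric])
      also have "\<dots> = (\<Sum>n. outer_content T m (A n)) + e"
        unfolding ennreal_suminf_cmult
        by (subst suminf_ennreal_eq[OF zero_le_power power_half_series]) auto
      finally show "outer_content T m (\<Union>i. A i) \<le> (\<Sum>i. outer_content T m (A i)) + ennreal e" .
    qed
  qed
qed

text \<open>For open \<open>U\<close>, exhaust \<open>U \<inter> V\<close> by closed sets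
  \<open>C\<close>, and for each of them exhaust the open set \<open>U - C\<close>, which contains
  \<open>U - V\<close>, by closed sets \<open>D\<close>. Additivity of \<open>m\<close> on the
  disjoint sets \<open>C\<close> and \<open>D\<close> gives the Caratheodory inequality on open
  sets; outer approximation carries it to all sets.\<close>

lemma open_in_lambda_system:
  assumes V: "openin T V"
  shows "V \<in> lambda_system (topspace T) (Pow (topspace T)) (outer_content T m)"
proof -
  have open_split: "inner_content T m (U \<inter> V) + outer_content T m (U - V) \<le> inner_content T m U"
    if U: "openin T U" for U
  proof -
    have "inner_content T m (U \<inter> V) + outer_content T m (U - V)
        = (SUP C\<in>{C. closedin T C \<and> C \<subseteq> U \<inter> V}. ennreal (m C) + outer_content T m (U - V))"
      unfolding inner_content_def[of T m "U \<inter> V"]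
      by (rule ennreal_SUP_add_left[symmetric]) (auto intro: exI[of _ "{}"])
    also have "\<dots> \<le> inner_content T m U"
    proof (rule SUP_least)
      fix C assume "C \<in> {C. closedin T C \<and> C \<subseteq> U \<inter> V}"
      then have C: "closedin T C" "C \<subseteq> U" "C \<subseteq> V" by auto
      have oUC: "openin T (U - C)" using U C(1) by (intro openin_diff)
      have "outer_content T m (U - V) \<le> outer_content T m (U - C)"
        by (rule outer_content_mono) (use C in auto)
      also have "\<dots> = inner_content T m (U - C)" by (rule outer_content_open[OF oUC])
      finally have "ennreal (m C) + outer_content T m (U - V)
          \<le> ennreal (m C) + inner_content T m (U - C)" by (rule add_left_mono)
      also have "\<dots> = (SUP D\<in>{D. closedin T D \<and> D \<subseteq> U - C}. ennreal (m C) + ennreal (m D))"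
        unfolding inner_content_def
        by (rule ennreal_SUP_add_right) (auto intro: exI[of _ "{}"])
      also have "\<dots> \<le> inner_content T m U"
      proof (rule SUP_least)
        fix D assume "D \<in> {D. closedin T D \<and> D \<subseteq> U - C}"
        then have D: "closedin T D" "D \<subseteq> U - C" by auto
        have "ennreal (m C) + ennreal (m D) = ennreal (m (C \<union> D))"
          using D(2) closedin_subset[OF D(1)] closedin_subset[OF C(1)]
          by (subst m_disjoint) (auto intro!: ennreal_plus[symmetric] m_nonneg)
        also have "\<dots> \<le> inner_content T m U"
          using C D by (intro inner_content_ge closedin_Un) auto
        finally show "ennreal (m C) + ennreal (m D) \<le> inner_content T m U" .
      qed
      finally show "ennreal (m C) + outer_content T m (U - V) \<le> inner_content T m U" .
    qed
    finally show ?thesis .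
  qed
  have "outer_content T m (V \<inter> A) + outer_content T m ((topspace T - V) \<inter> A) = outer_content T m A"
    if A: "A \<subseteq> topspace T" for A
  proof (rule antisym)
    show "outer_content T m (V \<inter> A) + outer_content T m ((topspace T - V) \<inter> A) \<le> outer_content T m A"
      unfolding outer_content_def[of T m A]
    proof (rule INF_greatest)
      fix U assume "U \<in> {U. openin T U \<and> A \<subseteq> U}"
      then have U: "openin T U" "A \<subseteq> U" by auto
      have "outer_content T m (V \<inter> A) + outer_content T m ((topspace T - V) \<inter> A)
          \<le> outer_content T m (U \<inter> V) + outer_content T m (U - V)"
        by (intro add_mono outer_content_mono) (use U in auto)
      also have "outer_content T m (U \<inter> V) = inner_content T m (U \<inter> V)"
        using U V by (intro outer_content_open openin_Int)
      also have "\<dots> + outer_content T m (U - V) \<le> inner_content T m U" by (rule open_split[OF U(1)])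
      finally show "outer_content T m (V \<inter> A) + outer_content T m ((topspace T - V) \<inter> A)
          \<le> inner_content T m U" .
    qed
    have "subadditive (Pow (topspace T)) (outer_content T m)"
      using outer_measure_space_outer_content ring_of_sets.countably_subadditive_subadditive
        sigma_algebra_Pow[THEN sigma_algebra.axioms(1), THEN Sigma_Algebra.algebra.axioms(1)]
      unfolding outer_measure_space_def by metis
    from subadditiveD[OF this, of "V \<inter> A" "(topspace T - V) \<inter> A"]
    have "outer_content T m ((V \<inter> A) \<union> ((topspace T - V) \<inter> A))
        \<le> outer_content T m (V \<inter> A) + outer_content T m ((topspace T - V) \<inter> A)"
      using A by auto
    also have "(V \<inter> A) \<union> ((topspace T - V) \<inter> A) = A" using A by auto
    finally show "outer_content T m A
        \<le> outer_content T m (V \<inter> A) + outer_content T m ((topspace T - V) \<inter> A)" .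
  qed
  then show ?thesis unfolding lambda_system_def using openin_subset[OF V] by auto
qed

end

lemma borel_sets_sigma_algebra: "sigma_algebra (topspace T) (borel_sets T)"
  unfolding borel_sets_def using openin_subset by (intro sigma_algebra_sigma_sets) blast

lemma borel_sets_open: "openin T U \<Longrightarrow> U \<in> borel_sets T"
  unfolding borel_sets_def by auto

lemma borel_sets_closed:
  assumes "closedin T C" shows "C \<in> borel_sets T"
proof -
  interpret sigma_algebra "topspace T" "borel_sets T" by (rule borel_sets_sigma_algebra)
  have "topspace T - (topspace T - C) \<in> borel_sets T"
    using assms by (intro compl_sets borel_sets_open) auto
  then show ?thesis using closedin_subset[OF assms] by (simp add: double_diff)
qed

lemma borel_sets_subset: "A \<in> borel_sets T \<Longrightarrow> A \<subseteq> topspace T"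
  unfolding borel_sets_def using openin_subset
  by (intro sigma_sets_into_sp[of "{U. openin T U}" "topspace T"]) auto

context content
begin

text \<open>Caratheodory's theorem applied to the outer content. Outer regularity is built into its
  definition; inner regularity is outer regularity of the complement.\<close>

lemma regular_borel_measure_exists:
  obtains \<pi> where "space \<pi> = topspace T" "sets \<pi> = borel_sets T" "finite_measure \<pi>"
    "measure \<pi> (topspace T) = m (topspace T)" "\<And>C. closedin T C \<Longrightarrow> m C \<le> measure \<pi> C"
    "\<And>A e. A \<in> borel_sets T \<Longrightarrow> 0 < e \<Longrightarrow>
       \<exists>C U. closedin T C \<and> openin T U \<and> C \<subseteq> A \<and> A \<subseteq> U \<and> measure \<pi> (U - C) < e"
proof -
  let ?\<mu> = "outer_content T m" and ?\<Omega> = "topspace T"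
  let ?L = "lambda_system ?\<Omega> (Pow ?\<Omega>) ?\<mu>"
  have ms: "measure_space ?\<Omega> ?L ?\<mu>"
    by (rule sigma_algebra.caratheodory_lemma[OF sigma_algebra_Pow outer_measure_space_outer_content])
  have "borel_sets T \<subseteq> ?L"
    unfolding borel_sets_def using ms open_in_lambda_system
    by (intro sigma_algebra.sigma_sets_subset) (auto simp: measure_space_def)
  then have ms': "measure_space ?\<Omega> (borel_sets T) ?\<mu>"
    by (rule measure_down[OF ms borel_sets_sigma_algebra])
  define \<pi> where "\<pi> = measure_of ?\<Omega> (borel_sets T) ?\<mu>"
  have sp: "space \<pi> = ?\<Omega>" and st: "sets \<pi> = borel_sets T"
    unfolding \<pi>_def using borel_sets_sigma_algebra[of T] borel_sets_subset[of _ T]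
    by (auto simp: space_measure_of_conv sigma_algebra.sets_measure_of_eq)
  have em: "emeasure \<pi> A = ?\<mu> A" if "A \<in> borel_sets T" for A
    unfolding \<pi>_def using ms' that by (intro emeasure_measure_of_sigma) (auto simp: measure_space_def)
  have top: "?\<Omega> \<in> borel_sets T" by (rule borel_sets_open) simp
  have emt: "emeasure \<pi> ?\<Omega> = ennreal (m ?\<Omega>)"
    unfolding em[OF top]
    by (rule antisym[OF outer_content_le_total outer_content_closed_ge]) auto
  have fin: "finite_measure \<pi>" by (rule finite_measureI) (simp add: sp emt)
  interpret finite_measure \<pi> by (rule fin)
  have mt: "measure \<pi> ?\<Omega> = m ?\<Omega>" using emt m_nonneg[of ?\<Omega>] by (simp add: measure_def)
  have closed: "m C \<le> measure \<pi> C" if C: "closedin T C" for C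
    using outer_content_closed_ge[OF C] unfolding em[OF borel_sets_closed[OF C], symmetric]
    by (simp add: emeasure_eq_measure)
  have approx: "\<exists>U. openin T U \<and> A \<subseteq> U \<and> measure \<pi> (U - A) < e"
    if A: "A \<in> borel_sets T" and e: "0 < e" for A e
  proof -
    obtain U where U: "openin T U" "A \<subseteq> U" "inner_content T m U \<le> ?\<mu> A + ennreal (e/2)"
      using outer_content_approx[OF borel_sets_subset[OF A], of "e/2"] e by auto
    have "emeasure \<pi> U \<le> emeasure \<pi> A + ennreal (e/2)"
      using U em[OF A] em[OF borel_sets_open[OF U(1)]] outer_content_open[OF U(1)] by simp
    then have "measure \<pi> U \<le> measure \<pi> A + e/2"
      using e by (simp add: emeasure_eq_measure ennreal_plus[symmetric] del: ennreal_plus)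
    moreover have "measure \<pi> (U - A) = measure \<pi> U - measure \<pi> A"
      using U A st borel_sets_open by (intro finite_measure_Diff) auto
    ultimately show ?thesis using U e by (intro exI[of _ U]) auto
  qed
  show ?thesis
  proof (rule that[OF sp st fin mt closed])
    fix A and e :: real assume A: "A \<in> borel_sets T" and e: "0 < e"
    obtain U where U: "openin T U" "A \<subseteq> U" "measure \<pi> (U - A) < e/2"
      using approx[OF A, of "e/2"] e by auto
    have A': "?\<Omega> - A \<in> borel_sets T" using A st sp sets.compl_sets by metis
    obtain W where W: "openin T W" "?\<Omega> - A \<subseteq> W" "measure \<pi> (W - (?\<Omega> - A)) < e/2"
      using approx[OF A', of "e/2"] e by auto
    have sets: "U - A \<in> sets \<pi>" "W - (?\<Omega> - A) \<in> sets \<pi>"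
      using borel_sets_open[OF U(1)] borel_sets_open[OF W(1)] A A' unfolding st[symmetric]
      by (simp_all add: sets.Diff)
    have "measure \<pi> (U - (?\<Omega> - W)) \<le> measure \<pi> ((U - A) \<union> (W - (?\<Omega> - A)))"
      using openin_subset[OF U(1)] by (intro finite_measure_mono sets.Un sets) auto
    also have "\<dots> \<le> measure \<pi> (U - A) + measure \<pi> (W - (?\<Omega> - A))"
      by (intro measure_Un_le sets)
    finally show "\<exists>C U. closedin T C \<and> openin T U \<and> C \<subseteq> A \<and> A \<subseteq> U \<and> measure \<pi> (U - C) < e"
      using U W borel_sets_subset[OF A] by (intro exI[of _ "?\<Omega> - W"] exI[of _ U]) auto
  qed metis
qed

end

lemma continuous_map_borel_measurable:
  fixes f :: "'b \<Rightarrow> 'c::topological_space"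
  assumes "continuous_map T euclidean f" "space M = topspace T" "sets M = borel_sets T"
  shows "f \<in> borel_measurable M"
proof (rule borel_measurableI)
  fix S :: "'c set" assume "open S"
  then have "openin T {x \<in> topspace T. f x \<in> S}"
    using assms(1) unfolding continuous_map_def by auto
  moreover have "f -` S \<inter> space M = {x \<in> topspace T. f x \<in> S}" using assms(2) by auto
  ultimately show "f -` S \<inter> space M \<in> sets M" using assms(3) borel_sets_open by metis
qed

lemma continuous_map_bounded_image:
  fixes f :: "'b \<Rightarrow> 'c::metric_space"
  assumes "compact_space T" "continuous_map T euclidean f"
  shows "bounded (f ` topspace T)"
  using image_compactin[OF _ assms(2)] assms(1)
  by (auto simp: compact_space_def intro: compact_imp_bounded)

text \<open>Layer-cake approximation: the sum counts the levels \<open>j / n\<close> below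
  \<open>t\<close>, so a function with values in the unit interval is within \<open>1 / n\<close> of
  a combination of indicators of its superlevel sets.\<close>

lemma staircase_bounds:
  fixes t :: real
  assumes "0 \<le> t" "t \<le> 1" "0 < n"
  shows "t \<le> (\<Sum>j<n. (1 / real n) * (if real j / real n \<le> t then 1 else 0))"
    and "(\<Sum>j<n. (1 / real n) * (if real j / real n \<le> t then 1 else 0)) \<le> t + 1 / real n"
proof -
  \<comment> \<open>The cap at \<open>n\<close> takes effect only for \<open>t = 1\<close>, where
    the other term is \<open>n + 1\<close>.\<close>
  define k where "k = min n (nat \<lfloor>real n * t\<rfloor> + 1)"
  have nt: "0 \<le> real n * t" using assms by simp
  have S: "{j. j < n \<and> real j / real n \<le> t} = {..<k}"
  proof -
    have *: "real j / real n \<le> t \<longleftrightarrow> j < nat \<lfloor>real n * t\<rfloor> + 1" for j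
    proof -
      have "real j / real n \<le> t \<longleftrightarrow> real j \<le> real n * t"
        using assms(3) by (simp add: field_simps)
      also have "\<dots> \<longleftrightarrow> j \<le> nat \<lfloor>real n * t\<rfloor>" using nt by (simp add: le_nat_floor le_nat_iff le_floor_iff)
      finally show ?thesis by (simp add: less_Suc_eq_le)
    qed
    show ?thesis by (rule Set.set_eqI) (simp only: mem_Collect_eq lessThan_iff min_less_iff_conj * k_def)
  qed
  have "(\<Sum>j<n. (1 / real n) * (if real j / real n \<le> t then 1 else 0))
      = (1 / real n) * (\<Sum>j<n. (if real j / real n \<le> t then 1 else 0))"
    by (simp only: sum_distrib_left)
  also have "(\<Sum>j<n. (if real j / real n \<le> t then 1 else (0::real)))
      = real (card {j. j < n \<and> real j / real n \<le> t})"
    by (subst sum.If_cases) (auto simp: Int_def)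
  finally have sum: "(\<Sum>j<n. (1 / real n) * (if real j / real n \<le> t then 1 else 0)) = real k / real n"
    unfolding S by simp
  have "real n * t \<le> real k"
  proof -
    have "real n * t \<le> real n" using assms by (simp add: mult_left_le)
    moreover have "real n * t \<le> real (nat \<lfloor>real n * t\<rfloor> + 1)" using nt by linarith
    ultimately show ?thesis unfolding k_def by (simp add: min_def)
  qed
  then show "t \<le> (\<Sum>j<n. (1 / real n) * (if real j / real n \<le> t then 1 else 0))"
    unfolding sum using assms(3) by (simp add: field_simps)
  have "real k \<le> real (nat \<lfloor>real n * t\<rfloor> + 1)" unfolding k_def by (simp add: min_def)
  also have "\<dots> \<le> real n * t + 1" using nt by linarith
  finally show "(\<Sum>j<n. (1 / real n) * (if real j / real n \<le> t then 1 else 0)) \<le> t + 1 / real n"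
    unfolding sum using assms(3) by (simp add: field_simps)
qed

lemma bounded_indicator_image: "bounded ((indicator A :: 'b \<Rightarrow> real) ` S)"
  unfolding bounded_iff by (auto intro!: exI[of _ 1] simp: indicator_def)

text \<open>The content is \<open>L\<close> on indicators. Superlevel sets of a continuous function
  are closed, so \<open>m C \<le> measure \<pi> C\<close> and the staircase sums give
  \<open>L f \<le> integral f\<close> for functions between 0 and 1. Equality of the total masses
  extends this to all continuous functions by affine rescaling, and applying it to
  \<open>- f\<close> gives the reverse inequality.\<close>

theorem riesz_representation:
  assumes T: "compact_space T" "Hausdorff_space T" and L: "positive_functional (topspace T) L"
  obtains \<pi> where "space \<pi> = topspace T" "sets \<pi> = borel_sets T" "finite_measure \<pi>"
    "measure \<pi> (topspace T) = L (\<lambda>_. 1)"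
    "\<And>A e. A \<in> borel_sets T \<Longrightarrow> 0 < e \<Longrightarrow>
       \<exists>C U. closedin T C \<and> openin T U \<and> C \<subseteq> A \<and> A \<subseteq> U \<and> measure \<pi> (U - C) < e"
    "\<And>f. continuous_map T euclideanreal f \<Longrightarrow> integral\<^sup>L \<pi> f = L f"
proof -
  interpret positive_functional "topspace T" L by (rule L)
  define m where "m A = L (indicator A)" for A
  interpret content T m
  proof
    show "0 \<le> m C" for C
      unfolding m_def by (rule L_nonneg) (auto simp: bounded_indicator_image)
    show "m C \<le> m D" if "C \<subseteq> D" for C D
      unfolding m_def by (rule L_mono[OF bounded_indicator_image bounded_indicator_image])
        (use that in \<open>auto simp: indicator_def\<close>)
    show "m (C \<union> D) = m C + m D" if "C \<inter> D = {}" for C D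
    proof -
      have "indicator (C \<union> D) = (\<lambda>x. indicator C x + indicator D x :: real)"
        using that by (auto simp: fun_eq_iff indicator_def)
      then show ?thesis unfolding m_def
        using L_add[OF bounded_indicator_image bounded_indicator_image] by simp
    qed
  qed (use T in auto)
  obtain \<pi> where pi: "space \<pi> = topspace T" "sets \<pi> = borel_sets T" "finite_measure \<pi>"
    "measure \<pi> (topspace T) = m (topspace T)" "\<And>C. closedin T C \<Longrightarrow> m C \<le> measure \<pi> C"
    and reg: "\<And>A e. A \<in> borel_sets T \<Longrightarrow> 0 < e \<Longrightarrow>
       \<exists>C U. closedin T C \<and> openin T U \<and> C \<subseteq> A \<and> A \<subseteq> U \<and> measure \<pi> (U - C) < e"
    by (rule regular_borel_measure_exists) (rule that, assumption+)
  interpret finite_measure \<pi> by (rule pi)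
  have one: "measure \<pi> (topspace T) = L (\<lambda>_. 1)"
    unfolding pi(4) m_def
    by (rule L_cong) (auto simp: bounded_indicator_image)
  have meas: "f \<in> borel_measurable \<pi>" if "continuous_map T euclideanreal f" for f
    by (rule continuous_map_borel_measurable[OF that pi(1,2)])
  have bdd: "bounded (f ` topspace T)" if "continuous_map T euclideanreal f" for f :: "_ \<Rightarrow> real"
    by (rule continuous_map_bounded_image[OF T(1) that])
  have int: "integrable \<pi> f" if f: "continuous_map T euclideanreal f" for f
  proof -
    obtain B where "\<forall>x\<in>topspace T. norm (f x) \<le> B" using bdd[OF f] by (auto simp: bounded_iff)
    then show ?thesis
      by (intro integrable_const_bound[of f B] meas[OF f] AE_I2) (simp add: pi(1))
  qed
  have le01: "L f \<le> integral\<^sup>L \<pi> f"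
    if f: "continuous_map T euclideanreal f" and f01: "\<And>x. x \<in> topspace T \<Longrightarrow> 0 \<le> f x \<and> f x \<le> 1" for f
  proof -
    have step: "L f \<le> integral\<^sup>L \<pi> f + L (\<lambda>_. 1) / real n" if n: "0 < n" for n
    proof -
      define A where "A j = {x \<in> topspace T. f x \<in> {real j / real n..}}" for j
      have Acl: "closedin T (A j)" for j
        unfolding A_def by (rule closedin_continuous_map_preimage[OF f]) auto
      have Aset: "A j \<in> sets \<pi>" for j using Acl pi(2) borel_sets_closed by metis
      define s where "s = (\<lambda>x. \<Sum>j<n. (1 / real n) * indicator (A j) x :: real)"
      have sx: "f x \<le> s x" "s x \<le> f x + 1 / real n" if x: "x \<in> topspace T" for x
      proof -
        have "s x = (\<Sum>j<n. (1 / real n) * (if real j / real n \<le> f x then 1 else 0))"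
          unfolding s_def A_def using x by (intro sum.cong refl) (auto simp: indicator_def)
        then show "f x \<le> s x" "s x \<le> f x + 1 / real n"
          using staircase_bounds[of "f x" n] f01[OF x] n by simp_all
      qed
      have bi: "bounded ((\<lambda>x. (1 / real n) * indicator (A j) x) ` topspace T)" for j
        by (rule bounded_mult_image[OF bounded_const_image bounded_indicator_image])
      have ind_int: "integrable \<pi> (\<lambda>x. (1 / real n) * indicator (A j) x)" for j
        using Aset[of j] by (intro integrable_mult_right integrable_real_indicator)
          (auto simp: emeasure_eq_measure)
      have "L f \<le> L s"
        by (rule L_mono[OF bdd[OF f]]) (use sx(1) bi in \<open>auto simp: s_def intro: bounded_sum_image\<close>)
      also have "L s = (\<Sum>j<n. (1 / real n) * m (A j))"
        unfolding s_def m_def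
        by (simp only: L_sum[OF bi, of "\<lambda>j. j" "{..<n}"] L_scale[OF bounded_indicator_image])
      also have "\<dots> \<le> (\<Sum>j<n. (1 / real n) * measure \<pi> (A j))"
        using pi(5)[OF Acl] by (intro sum_mono mult_left_mono) auto
      also have "\<dots> = integral\<^sup>L \<pi> s"
      proof -
        have "integral\<^sup>L \<pi> (indicator (A j)) = measure \<pi> (A j)" for j
          using sets.sets_into_space[OF Aset, of j] by (simp add: Int_absorb2)
        then show ?thesis unfolding s_def
          by (simp only: Bochner_Integration.integral_sum[OF ind_int] integral_mult_right_zero)
      qed
      also have "\<dots> \<le> integral\<^sup>L \<pi> (\<lambda>x. f x + 1 / real n)"
      proof (rule integral_mono)
        show "integrable \<pi> s" unfolding s_def by (rule Bochner_Integration.integrable_sum[OF ind_int])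
      qed (use sx(2) int[OF f] pi(1) in auto)
      also have "\<dots> = integral\<^sup>L \<pi> f + L (\<lambda>_. 1) / real n"
        using int[OF f] one pi(1) by simp
      finally show ?thesis .
    qed
    have lim: "(\<lambda>n. integral\<^sup>L \<pi> f + L (\<lambda>_. 1) / real n) \<longlonglongrightarrow> integral\<^sup>L \<pi> f + 0"
      by (intro tendsto_add tendsto_const lim_const_over_n)
    have "L f \<le> integral\<^sup>L \<pi> f + 0"
      by (rule LIMSEQ_le_const[OF lim]) (use step in \<open>auto intro!: exI[of _ 1]\<close>)
    then show ?thesis by simp
  qed
  have le: "L f \<le> integral\<^sup>L \<pi> f" if f: "continuous_map T euclideanreal f" for f
  proof -
    obtain B0 where "\<forall>x\<in>topspace T. norm (f x) \<le> B0" using bdd[OF f] by (auto simp: bounded_iff)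
    then obtain B where B: "0 < B" "\<And>x. x \<in> topspace T \<Longrightarrow> \<bar>f x\<bar> \<le> B"
      using that[of "max B0 1"] by (metis less_max_iff_disj max.coboundedI1 real_norm_def zero_less_one)
    \<comment> \<open>The shift by \<open>B\<close> contributes \<open>B\<close> times the total
      mass on both sides, and the two total masses agree.\<close>
    define g where "g x = (1 / (2 * B)) * (f x + B)" for x
    have g: "continuous_map T euclideanreal g" unfolding g_def
      by (intro continuous_map_real_mult continuous_map_add f) auto
    have "L g \<le> integral\<^sup>L \<pi> g"
    proof (rule le01[OF g])
      fix x assume "x \<in> topspace T"
      then have "\<bar>f x\<bar> \<le> B" by (rule B(2))
      then show "0 \<le> g x \<and> g x \<le> 1" unfolding g_def using B(1) by (auto simp: field_simps)
    qed
    moreover have "L g = (1 / (2 * B)) * (L f + B * L (\<lambda>_. 1))"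
      unfolding g_def using bdd[OF f] L_const[of B]
      by (subst L_scale) (auto simp: L_add intro: bounded_plus_comp)
    moreover have "integral\<^sup>L \<pi> g = (1 / (2 * B)) * (integral\<^sup>L \<pi> f + B * L (\<lambda>_. 1))"
      unfolding g_def using int[OF f] one pi(1) by simp
    ultimately show ?thesis using B(1) by (simp add: divide_le_cancel)
  qed
  have eq: "integral\<^sup>L \<pi> f = L f" if f: "continuous_map T euclideanreal f" for f
  proof -
    have "L (\<lambda>x. - f x) \<le> integral\<^sup>L \<pi> (\<lambda>x. - f x)" by (rule le) (use f in auto)
    then show ?thesis using le[OF f] L_uminus[OF bdd[OF f]] by simp
  qed
  show ?thesis by (rule that[OF pi(1-3) one reg eq])
qed

section \<open>Integration against a scalar measure\<close>

locale bounded_signed_measure =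
  fixes T :: "'b topology" and \<nu> :: "'b set \<Rightarrow> real" and B :: real
  assumes sums: "\<And>A. range A \<subseteq> borel_sets T \<Longrightarrow> disjoint_family A \<Longrightarrow> (\<lambda>n::nat. \<nu> (A n)) sums \<nu> (\<Union>n. A n)"
    and bounded: "\<And>A. A \<in> borel_sets T \<Longrightarrow> \<bar>\<nu> A\<bar> \<le> B"
begin

sublocale sigma_algebra "topspace T" "borel_sets T" by (rule borel_sets_sigma_algebra)

lemma nu_empty: "\<nu> {} = 0"
proof -
  have "(\<lambda>n::nat. \<nu> {}) sums \<nu> (\<Union>n::nat. {})"
    by (rule sums) (auto simp: disjoint_family_on_def)
  then show ?thesis using sums_summable summable_const_iff by blast
qed

lemma nu_Un:
  assumes "C \<in> borel_sets T" "D \<in> borel_sets T" "C \<inter> D = {}"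
  shows "\<nu> (C \<union> D) = \<nu> C + \<nu> D"
proof -
  have "(\<lambda>n. \<nu> (binaryset C D n)) sums \<nu> (\<Union>n. binaryset C D n)"
    by (rule sums) (use assms in \<open>auto simp: range_binaryset_eq disjoint_family_on_def binaryset_def\<close>)
  moreover have "(\<lambda>n. \<nu> (binaryset C D n)) sums (\<Sum>n<2. \<nu> (binaryset C D n))"
    by (rule sums_finite) (auto simp: binaryset_def nu_empty)
  ultimately have "\<nu> (\<Union>n. binaryset C D n) = (\<Sum>n<2. \<nu> (binaryset C D n))" by (rule sums_unique2)
  then show ?thesis by (simp add: UN_binaryset_eq binaryset_def numeral_2_eq_2)
qed

definition pos :: "'b set \<Rightarrow> real" where
  "pos A = enn2real (SUP C\<in>{C \<in> borel_sets T. C \<subseteq> A}. ennreal (\<nu> C))"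

lemma SUP_eq_pos: "(SUP C\<in>{C \<in> borel_sets T. C \<subseteq> A}. ennreal (\<nu> C)) = ennreal (pos A)"
proof -
  have "(SUP C\<in>{C \<in> borel_sets T. C \<subseteq> A}. ennreal (\<nu> C)) \<le> ennreal B"
    by (rule SUP_least) (use bounded in \<open>force intro: ennreal_leI\<close>)
  then have "(SUP C\<in>{C \<in> borel_sets T. C \<subseteq> A}. ennreal (\<nu> C)) < \<infinity>"
    using ennreal_less_top order_le_less_trans unfolding infinity_ennreal_def by blast
  then show ?thesis unfolding pos_def by simp
qed

lemma pos_nonneg: "0 \<le> pos A" by (simp add: pos_def)

lemma pos_ge:
  assumes "C \<in> borel_sets T" "C \<subseteq> A"
  shows "\<nu> C \<le> pos A"
proof -
  have "ennreal (\<nu> C) \<le> ennreal (pos A)"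
    unfolding SUP_eq_pos[symmetric] using assms by (intro SUP_upper) auto
  then show ?thesis using pos_nonneg by simp
qed

lemma pos_least:
  assumes "0 \<le> z" "\<And>C. C \<in> borel_sets T \<Longrightarrow> C \<subseteq> A \<Longrightarrow> \<nu> C \<le> z"
  shows "pos A \<le> z"
proof -
  have "ennreal (pos A) \<le> ennreal z"
    unfolding SUP_eq_pos[symmetric] by (rule SUP_least) (use assms in \<open>auto intro: ennreal_leI\<close>)
  then show ?thesis using assms(1) by simp
qed

lemma pos_mono: "A \<subseteq> C \<Longrightarrow> pos A \<le> pos C"
  by (rule pos_least[OF pos_nonneg]) (auto intro: pos_ge)

lemma pos_superadditive:
  assumes "A \<inter> C = {}"
  shows "pos A + pos C \<le> pos (A \<union> C)"
proof -
  have *: "pos A \<le> pos (A \<union> C) - \<nu> D" if D: "D \<in> borel_sets T" "D \<subseteq> C" for D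
  proof (rule pos_least)
    show "0 \<le> pos (A \<union> C) - \<nu> D" using pos_ge[of D "A \<union> C"] D by auto
    fix E assume E: "E \<in> borel_sets T" "E \<subseteq> A"
    have "\<nu> E + \<nu> D = \<nu> (E \<union> D)" using E D assms by (intro nu_Un[symmetric]) auto
    also have "\<dots> \<le> pos (A \<union> C)" using E D by (intro pos_ge) auto
    finally show "\<nu> E \<le> pos (A \<union> C) - \<nu> D" by simp
  qed
  have "pos C \<le> pos (A \<union> C) - pos A"
    by (rule pos_least) (use pos_mono[of A "A \<union> C"] * in \<open>auto simp: algebra_simps\<close>)
  then show ?thesis by simp
qed

text \<open>\<open>measure_of\<close> has the intended values only once the supremum is known to be
  a measure. One inequality follows from finite superadditivity. For the other, cut a Borel subset
  \<open>C\<close> of the union into the pieces \<open>C \<inter> A n\<close> and use countable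
  additivity of \<open>\<nu>\<close>.\<close>

lemma positive_part_measure_space:
  "measure_space (topspace T) (borel_sets T) (\<lambda>A. SUP C\<in>{C \<in> borel_sets T. C \<subseteq> A}. ennreal (\<nu> C))"
  unfolding measure_space_def
proof (intro conjI)
  show "positive (borel_sets T) (\<lambda>A. SUP C\<in>{C \<in> borel_sets T. C \<subseteq> A}. ennreal (\<nu> C))"
  proof -
    have "pos {} = 0" by (rule antisym[OF pos_least pos_nonneg]) (auto simp: nu_empty)
    then show ?thesis unfolding SUP_eq_pos positive_def by simp
  qed
  show "countably_additive (borel_sets T) (\<lambda>A. SUP C\<in>{C \<in> borel_sets T. C \<subseteq> A}. ennreal (\<nu> C))"
    unfolding SUP_eq_pos countably_additive_def
  proof (intro allI impI)
    fix A :: "nat \<Rightarrow> 'b set"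
    assume A: "range A \<subseteq> borel_sets T" and dis: "disjoint_family A"
    show "(\<Sum>i. ennreal (pos (A i))) = ennreal (pos (\<Union>i. A i))"
    proof (rule antisym)
      have *: "(\<Sum>i<n. pos (A i)) \<le> pos (\<Union>i<n. A i)" for n
      proof (induction n)
        case (Suc n)
        have "A i \<inter> A n = {}" if "i < n" for i
          by (rule disjoint_family_onD[OF dis]) (use that in auto)
        then have "(\<Union>i<n. A i) \<inter> A n = {}" by blast
        from pos_superadditive[OF this] Suc show ?case by (simp add: lessThan_Suc Un_commute)
      qed (simp add: pos_nonneg)
      have "(\<Sum>i<n. ennreal (pos (A i))) \<le> ennreal (pos (\<Union>i. A i))" for n
      proof -
        have "(\<Sum>i<n. ennreal (pos (A i))) = ennreal (\<Sum>i<n. pos (A i))"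
          by (simp add: sum_ennreal pos_nonneg)
        also have "\<dots> \<le> ennreal (pos (\<Union>i. A i))"
          by (intro ennreal_leI order_trans[OF * pos_mono]) auto
        finally show ?thesis .
      qed
      then show "(\<Sum>i. ennreal (pos (A i))) \<le> ennreal (pos (\<Union>i. A i))"
        by (simp add: suminf_eq_SUP SUP_least)
    next
      show "ennreal (pos (\<Union>i. A i)) \<le> (\<Sum>i. ennreal (pos (A i)))"
        unfolding SUP_eq_pos[symmetric, of "\<Union>i. A i"]
      proof (rule SUP_least)
        fix C assume "C \<in> {C \<in> borel_sets T. C \<subseteq> (\<Union>i. A i)}"
        then have C: "C \<in> borel_sets T" "C \<subseteq> (\<Union>i. A i)" by auto
        have "(\<lambda>n. \<nu> (C \<inter> A n)) sums \<nu> (\<Union>n. C \<inter> A n)"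
          by (rule sums) (use C A in \<open>auto intro!: disjoint_family_on_bisimulation[OF dis]\<close>)
        moreover have "(\<Union>n. C \<inter> A n) = C" using C by auto
        ultimately have "(\<lambda>n. \<Sum>i<n. \<nu> (C \<inter> A i)) \<longlonglongrightarrow> \<nu> C" by (simp add: sums_def)
        then have lim: "(\<lambda>n. ennreal (\<Sum>i<n. \<nu> (C \<inter> A i))) \<longlonglongrightarrow> ennreal (\<nu> C)" by (rule tendsto_ennrealI)
        show "ennreal (\<nu> C) \<le> (\<Sum>i. ennreal (pos (A i)))"
        proof (rule LIMSEQ_le_const2[OF lim], intro exI allI impI)
          fix n
          have "ennreal (\<Sum>i<n. \<nu> (C \<inter> A i)) \<le> ennreal (\<Sum>i<n. pos (A i))"
            by (intro ennreal_leI sum_mono pos_ge Int C(1) range_subsetD[OF A]) auto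
          also have "\<dots> = (\<Sum>i<n. ennreal (pos (A i)))" by (simp add: sum_ennreal pos_nonneg)
          also have "\<dots> \<le> (\<Sum>i. ennreal (pos (A i)))" by (rule sum_le_suminf) auto
          finally show "ennreal (\<Sum>i<n. \<nu> (C \<inter> A i)) \<le> (\<Sum>i. ennreal (pos (A i)))" .
        qed
      qed
    qed
  qed
qed (rule borel_sets_sigma_algebra)

lemma positive_part_basics:
  shows space_positive_part: "space (positive_part T \<nu>) = topspace T"
    and sets_positive_part: "sets (positive_part T \<nu>) = borel_sets T"
    and measure_positive_part: "A \<in> borel_sets T \<Longrightarrow> measure (positive_part T \<nu>) A = pos A"
    and finite_positive_part: "finite_measure (positive_part T \<nu>)"
proof -
  show sp: "space (positive_part T \<nu>) = topspace T"
    unfolding positive_part_def using borel_sets_subset[of _ T] by (auto simp: space_measure_of_conv)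
  show "sets (positive_part T \<nu>) = borel_sets T"
    unfolding positive_part_def using borel_sets_subset[of _ T]
    by (auto simp: sigma_algebra.sets_measure_of_eq[OF borel_sets_sigma_algebra])
  have em: "emeasure (positive_part T \<nu>) A = ennreal (pos A)" if "A \<in> borel_sets T" for A
    unfolding positive_part_def using positive_part_measure_space that
    by (subst emeasure_measure_of_sigma) (auto simp: measure_space_def SUP_eq_pos)
  show "measure (positive_part T \<nu>) A = pos A" if "A \<in> borel_sets T"
    using em[OF that] by (simp add: measure_def pos_nonneg)
  show "finite_measure (positive_part T \<nu>)"
    by (rule finite_measureI) (simp add: sp em[OF top])
qed

end

lemma bounded_signed_measure_uminus:
  "bounded_signed_measure T \<nu> B \<Longrightarrow> bounded_signed_measure T (\<lambda>A. - \<nu> A) B"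
  unfolding bounded_signed_measure_def by (auto intro: sums_minus)

text \<open>For \<open>C \<subseteq> A\<close> one has
  \<open>\<nu> C = \<nu> A - \<nu> (A - C)\<close>, which is at most \<open>\<nu> A\<close> plus the
  negative part of \<open>A\<close>. The supremum over \<open>C\<close> gives one inequality, and
  the same for \<open>- \<nu>\<close> gives the other.\<close>

lemma jordan_decomposition:
  assumes "bounded_signed_measure T \<nu> B" "A \<in> borel_sets T"
  shows "measure (positive_part T \<nu>) A - measure (positive_part T (\<lambda>A. - \<nu> A)) A = \<nu> A"
proof -
  have le: "bounded_signed_measure.pos T \<nu> A \<le> \<nu> A + bounded_signed_measure.pos T (\<lambda>A. - \<nu> A) A"
    if nu: "bounded_signed_measure T \<nu> B" for \<nu>
  proof -
    interpret p: bounded_signed_measure T \<nu> B by (rule nu)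
    interpret n: bounded_signed_measure T "\<lambda>A. - \<nu> A" B by (rule bounded_signed_measure_uminus[OF nu])
    show ?thesis
    proof (rule p.pos_least)
      show "0 \<le> \<nu> A + n.pos A" using n.pos_ge[OF assms(2), of A] by simp
      fix C assume C: "C \<in> borel_sets T" "C \<subseteq> A"
      have AC: "A - C \<in> borel_sets T" using C assms(2) by auto
      have "\<nu> (C \<union> (A - C)) = \<nu> C + \<nu> (A - C)" using C AC by (intro p.nu_Un) auto
      moreover have "C \<union> (A - C) = A" using C by auto
      moreover have "- \<nu> (A - C) \<le> n.pos A" using AC by (intro n.pos_ge) auto
      ultimately show "\<nu> C \<le> \<nu> A + n.pos A" by simp
    qed
  qed
  have "bounded_signed_measure.pos T (\<lambda>A. - \<nu> A) A \<le> - \<nu> A + bounded_signed_measure.pos T \<nu> A"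
    using le[OF bounded_signed_measure_uminus[OF assms(1)]] by simp
  then show ?thesis
    using le[OF assms(1)] bounded_signed_measure.measure_positive_part[OF assms]
      bounded_signed_measure.measure_positive_part[OF bounded_signed_measure_uminus[OF assms(1)] assms(2)]
    by simp
qed

section \<open>Sharp bounds for linear functionals through finite partitions\<close>

lemma complex_grid_approximation:
  fixes f :: "'b \<Rightarrow> complex"
  assumes f: "f \<in> borel_measurable M" and bd: "\<And>x. x \<in> space M \<Longrightarrow> cmod (f x) \<le> B" and e: "0 < e"
  obtains g where "g \<in> borel_measurable M" "finite (g ` space M)"
    "\<And>x. x \<in> space M \<Longrightarrow> cmod (f x - g x) \<le> e"
proof -
  \<comment> \<open>Rounding the real and the imaginary part each costs up to one mesh
    width.\<close>
  define d where "d = e / 2"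
  have d: "0 < d" using e by (simp add: d_def)
  define h where "h = (\<lambda>(a, b). complex_of_real (d * real_of_int a) + \<i> * complex_of_real (d * real_of_int b))"
  define g where "g x = h (\<lfloor>Re (f x) / d\<rfloor>, \<lfloor>Im (f x) / d\<rfloor>)" for x
  define k where "k = \<lceil>B / d\<rceil> + 1"
  have meas: "g \<in> borel_measurable M" unfolding g_def h_def prod.case using f by measurable
  have rng: "\<lfloor>t / d\<rfloor> \<in> {-k..k}" if "\<bar>t\<bar> \<le> B" for t
  proof -
    have "t / d \<le> B / d" "- (B / d) \<le> t / d" using that d by (auto simp: field_simps)
    then show ?thesis unfolding k_def by (simp, linarith)
  qed
  have "g ` space M \<subseteq> h ` ({-k..k} \<times> {-k..k})"
  proof
    fix z assume "z \<in> g ` space M"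
    then obtain x where x: "x \<in> space M" "z = g x" by auto
    have "\<bar>Re (f x)\<bar> \<le> B" "\<bar>Im (f x)\<bar> \<le> B"
      using bd[OF x(1)] abs_Re_le_cmod[of "f x"] abs_Im_le_cmod[of "f x"] by linarith+
    then have "(\<lfloor>Re (f x) / d\<rfloor>, \<lfloor>Im (f x) / d\<rfloor>) \<in> {-k..k} \<times> {-k..k}" using rng by blast
    then show "z \<in> h ` ({-k..k} \<times> {-k..k})" unfolding x(2) g_def by (rule imageI)
  qed
  then have fin: "finite (g ` space M)" by (rule finite_subset) simp
  have app: "cmod (f x - g x) \<le> e" for x
  proof -
    have fl: "\<bar>t - d * real_of_int \<lfloor>t / d\<rfloor>\<bar> \<le> d" for t
    proof -
      have "d * real_of_int \<lfloor>t / d\<rfloor> \<le> d * (t / d)"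
        by (rule mult_left_mono) (use d in linarith)+
      moreover have "d * (t / d) \<le> d * (real_of_int \<lfloor>t / d\<rfloor> + 1)"
        by (rule mult_left_mono) (use d in linarith)+
      ultimately have "d * real_of_int \<lfloor>t / d\<rfloor> \<le> t" "t \<le> d * real_of_int \<lfloor>t / d\<rfloor> + d"
        using d by (simp_all add: distrib_left)
      then show ?thesis by simp
    qed
    have "cmod (f x - g x) \<le> \<bar>Re (f x - g x)\<bar> + \<bar>Im (f x - g x)\<bar>" by (rule cmod_le)
    also have "\<dots> \<le> d + d"
      using fl[of "Re (f x)"] fl[of "Im (f x)"] by (intro add_mono) (simp_all add: g_def h_def)
    finally show ?thesis by (simp add: d_def)
  qed
  show ?thesis by (rule that[OF meas fin app])
qed

text \<open>With \<open>V = 0\<close> this is a uniqueness statement, and with \<open>V\<close> the total variation of a measure it is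
  the sharp bound of its integral.\<close>

lemma linear_functional_bound:
  fixes D :: "('b \<Rightarrow> complex) \<Rightarrow> complex"
  assumes add: "\<And>f g A B. f \<in> borel_measurable M \<Longrightarrow> g \<in> borel_measurable M \<Longrightarrow>
      (\<And>x. x \<in> space M \<Longrightarrow> cmod (f x) \<le> A) \<Longrightarrow> (\<And>x. x \<in> space M \<Longrightarrow> cmod (g x) \<le> B) \<Longrightarrow>
      D (\<lambda>x. f x + g x) = D f + D g"
    and scale: "\<And>f c A. f \<in> borel_measurable M \<Longrightarrow> (\<And>x. x \<in> space M \<Longrightarrow> cmod (f x) \<le> A) \<Longrightarrow>
      D (\<lambda>x. c * f x) = c * D f"
    and crude: "\<And>f A. f \<in> borel_measurable M \<Longrightarrow> (\<And>x. x \<in> space M \<Longrightarrow> cmod (f x) \<le> A) \<Longrightarrow>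
      0 \<le> A \<Longrightarrow> cmod (D f) \<le> C * A"
    and part: "\<And>P. finite P \<Longrightarrow> P \<subseteq> sets M \<Longrightarrow> disjoint P \<Longrightarrow> \<Union>P = space M \<Longrightarrow>
      (\<Sum>A\<in>P. cmod (D (indicator A))) \<le> V"
    and f: "f \<in> borel_measurable M" and bd: "\<And>x. x \<in> space M \<Longrightarrow> cmod (f x) \<le> B" and B: "0 \<le> B"
  shows "cmod (D f) \<le> V * B"
proof -
  have "(\<Sum>A\<in>{space M}. cmod (D (indicator A))) \<le> V" by (rule part) (auto simp: disjoint_def)
  then have V0: "0 \<le> V" by (simp add: order_trans[OF norm_ge_zero])
  have sum: "D (\<lambda>x. \<Sum>i\<in>I. c i * indicator (A i) x) = (\<Sum>i\<in>I. c i * D (indicator (A i)))"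
    if "finite I" "\<And>i. i \<in> I \<Longrightarrow> A i \<in> sets M" for I :: "complex set" and c A
    using that
  proof (induction I rule: finite_induct)
    case empty
    show ?case using scale[of "\<lambda>x. 0" 0 0] by simp
  next
    case (insert i I)
    have "D (\<lambda>x. c i * indicator (A i) x + (\<Sum>i\<in>I. c i * indicator (A i) x))
        = D (\<lambda>x. c i * indicator (A i) x) + D (\<lambda>x. \<Sum>i\<in>I. c i * indicator (A i) x)"
    proof (rule add[where A="cmod (c i)" and B="\<Sum>i\<in>I. cmod (c i)"])
      show "(\<lambda>x. c i * indicator (A i) x) \<in> borel_measurable M"
        "(\<lambda>x. \<Sum>i\<in>I. c i * indicator (A i) x) \<in> borel_measurable M"
        using insert.prems by auto
      show "cmod (c i * indicator (A i) x) \<le> cmod (c i)" for x by (simp add: indicator_def)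
      show "cmod (\<Sum>i\<in>I. c i * indicator (A i) x) \<le> (\<Sum>i\<in>I. cmod (c i))" for x
        by (rule sum_norm_le) (simp add: indicator_def)
    qed
    also have "D (\<lambda>x. c i * indicator (A i) x) = c i * D (indicator (A i))"
      by (rule scale[where A=1]) (use insert.prems in \<open>auto simp: indicator_def\<close>)
    also have "D (\<lambda>x. \<Sum>i\<in>I. c i * indicator (A i) x) = (\<Sum>i\<in>I. c i * D (indicator (A i)))"
      by (rule insert.IH) (use insert.prems in auto)
    finally show ?case by (simp only: sum.insert[OF insert.hyps(1,2)])
  qed
  \<comment> \<open>The constant \<open>C\<close> touches only the small error \<open>f - s\<close>.
    The main term has the sharp constant \<open>V\<close>, because the level sets of
    \<open>g\<close> partition the space and \<open>part\<close> applies to them.\<close>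
  have eps: "cmod (D f) \<le> V * B + (C + V) * e" if e: "0 < e" for e
  proof -
    obtain g where g: "g \<in> borel_measurable M" "finite (g ` space M)"
      "\<And>x. x \<in> space M \<Longrightarrow> cmod (f x - g x) \<le> e"
      by (rule complex_grid_approximation[OF f bd e]) auto
    define A where "A v = g -` {v} \<inter> space M" for v
    have A: "A v \<in> sets M" for v unfolding A_def using g(1) by (simp add: measurable_sets)
    define s where "s = (\<lambda>x. \<Sum>v\<in>g ` space M. v * indicator (A v) x)"
    have s: "s x = g x" if x: "x \<in> space M" for x
    proof -
      have "s x = (\<Sum>v\<in>g ` space M. if v = g x then v else 0)"
        unfolding s_def A_def using x by (intro sum.cong refl) (auto simp: indicator_def)
      then show ?thesis using x g(2) by (simp add: sum.delta)
    qed
    have sm: "s \<in> borel_measurable M" unfolding s_def using A by auto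
    have sb: "cmod (s x) \<le> B + e" if "x \<in> space M" for x
      using s[OF that] g(3)[OF that] bd[OF that] norm_triangle_ineq4[of "f x" "f x - g x"] by simp
    have "D (\<lambda>x. (f x - s x) + s x) = D (\<lambda>x. f x - s x) + D s"
      by (rule add[where A=e and B="B + e"]) (use f sm g(3) s sb in auto)
    then have Df: "D f = D (\<lambda>x. f x - s x) + D s" by simp
    have "cmod (D (\<lambda>x. f x - s x)) \<le> C * e"
      by (rule crude) (use f sm g(3) s e in auto)
    moreover have "cmod (D s) \<le> V * (B + e)"
    proof -
      have "cmod (D s) = cmod (\<Sum>v\<in>g ` space M. v * D (indicator (A v)))"
        unfolding s_def by (subst sum[OF g(2) A]) auto
      also have "\<dots> \<le> (\<Sum>v\<in>g ` space M. (B + e) * cmod (D (indicator (A v))))"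
        by (rule sum_norm_le) (use sb s in \<open>force simp: norm_mult intro: mult_right_mono\<close>)
      also have "\<dots> = (B + e) * (\<Sum>v\<in>g ` space M. cmod (D (indicator (A v))))"
        by (simp add: sum_distrib_left)
      also have "(\<Sum>v\<in>g ` space M. cmod (D (indicator (A v)))) = (\<Sum>S\<in>A ` (g ` space M). cmod (D (indicator S)))"
        by (subst sum.reindex) (auto simp: inj_on_def A_def)
      also have "(B + e) * \<dots> \<le> (B + e) * V"
        using g(2) A B e
        by (intro mult_left_mono part) (auto simp: disjoint_def A_def)
      finally show ?thesis by (simp add: mult.commute)
    qed
    ultimately show ?thesis
      unfolding Df using norm_triangle_ineq[of "D (\<lambda>x. f x - s x)" "D s"]
      by (simp add: algebra_simps)
  qed
  show ?thesis
  proof (rule field_le_epsilon)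
    fix e :: real assume e: "0 < e"
    have "cmod (D (\<lambda>x. 0)) \<le> C * 1" by (rule crude) auto
    then have C0: "0 \<le> C" by (simp add: order_trans[OF norm_ge_zero])
    \<comment> \<open>The summand 1 in the denominator covers the case
      \<open>C + V = 0\<close>.\<close>
    have "cmod (D f) \<le> V * B + (C + V) * (e / (C + V + 1))"
      by (rule eps) (use e C0 V0 in auto)
    also have "(C + V) * (e / (C + V + 1)) \<le> e"
      using e C0 V0 by (simp add: field_simps)
    finally show "cmod (D f) \<le> V * B + e" by simp
  qed
qed

section \<open>Integrals against a scalar measure of finite variation\<close>

locale scalar_measure =
  fixes T :: "'b topology" and \<mu> :: "'b set \<Rightarrow> complex"
  assumes mu_sums: "\<And>A. range A \<subseteq> borel_sets T \<Longrightarrow> disjoint_family A \<Longrightarrow>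
      (\<lambda>n::nat. \<mu> (A n)) sums \<mu> (\<Union>n. A n)"
    and variation_finite: "variation T \<mu> (topspace T) < \<infinity>"
begin

lemma partition_le_total_variation:
  assumes "finite P" "P \<subseteq> borel_sets T" "disjoint P" "\<Union>P = topspace T"
  shows "(\<Sum>A\<in>P. cmod (\<mu> A)) \<le> total_variation T \<mu>"
proof -
  have "ennreal (\<Sum>A\<in>P. cmod (\<mu> A)) = (\<Sum>A\<in>P. ennreal (cmod (\<mu> A)))" by (simp add: sum_ennreal)
  also have "\<dots> \<le> variation T \<mu> (topspace T)"
    unfolding variation_def by (rule SUP_upper) (use assms in auto)
  also have "\<dots> = ennreal (total_variation T \<mu>)"
    using variation_finite by (simp add: total_variation_def)
  finally show ?thesis by (simp add: total_variation_def)
qed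

lemma cmod_le_total_variation:
  assumes "A \<in> borel_sets T"
  shows "cmod (\<mu> A) \<le> total_variation T \<mu>"
proof -
  interpret sigma_algebra "topspace T" "borel_sets T" by (rule borel_sets_sigma_algebra)
  have "(\<Sum>A\<in>{A, topspace T - A}. cmod (\<mu> A)) \<le> total_variation T \<mu>"
    by (rule partition_le_total_variation)
      (use assms borel_sets_subset[OF assms] in \<open>auto simp: disjoint_def\<close>)
  moreover have "cmod (\<mu> A) \<le> (\<Sum>A\<in>{A, topspace T - A}. cmod (\<mu> A))"
    by (rule member_le_sum) auto
  ultimately show ?thesis by linarith
qed

lemma signed_measure_parts:
  shows Re_signed: "bounded_signed_measure T (\<lambda>A. Re (\<mu> A)) (total_variation T \<mu>)"
    and Im_signed: "bounded_signed_measure T (\<lambda>A. Im (\<mu> A)) (total_variation T \<mu>)"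
  using mu_sums cmod_le_total_variation
  by (auto simp: bounded_signed_measure_def sums_complex_iff
      intro: order_trans[OF abs_Re_le_cmod] order_trans[OF abs_Im_le_cmod])

definition parts :: "'b measure set" where
  "parts = {positive_part T (\<lambda>A. Re (\<mu> A)), positive_part T (\<lambda>A. - Re (\<mu> A)),
    positive_part T (\<lambda>A. Im (\<mu> A)), positive_part T (\<lambda>A. - Im (\<mu> A))}"

lemma parts_basics:
  assumes "M \<in> parts"
  shows "space M = topspace T" "sets M = borel_sets T" "finite_measure M"
  using assms bounded_signed_measure.positive_part_basics[OF Re_signed]
    bounded_signed_measure.positive_part_basics[OF Im_signed]
    bounded_signed_measure.positive_part_basics[OF bounded_signed_measure_uminus[OF Re_signed]]
    bounded_signed_measure.positive_part_basics[OF bounded_signed_measure_uminus[OF Im_signed]]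
  unfolding parts_def by auto

text \<open>A finite but not sharp constant. \<open>parts\<close> is a set, so coinciding parts are
  counted once; the sum still bounds the mass of each of them.\<close>

definition crude_mass :: real where
  "crude_mass = (\<Sum>M\<in>parts. measure M (topspace T))"

text \<open>\<open>N\<close> stands for the Borel sigma-algebra, so that measurability is stated
  once for all four parts.\<close>

lemma parts_integral:
  fixes f :: "'b \<Rightarrow> complex"
  assumes M: "M \<in> parts" and N: "sets N = borel_sets T" and f: "f \<in> borel_measurable N"
    and bd: "\<And>x. x \<in> topspace T \<Longrightarrow> cmod (f x) \<le> B" and B: "0 \<le> B"
  shows "integrable M f" and "cmod (integral\<^sup>L M f) \<le> crude_mass * B"
proof -
  interpret finite_measure M by (rule parts_basics(3)[OF M])
  have "sets M = sets N" using N parts_basics(2)[OF M] by simp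
  then have "f \<in> borel_measurable M" using f measurable_cong_sets by blast
  then show int: "integrable M f"
    by (intro integrable_const_bound[of f B] AE_I2) (use bd parts_basics(1)[OF M] in auto)
  have "cmod (integral\<^sup>L M f) \<le> (\<integral>x. cmod (f x) \<partial>M)" by (rule integral_norm_bound)
  also have "\<dots> \<le> (\<integral>x. B \<partial>M)"
    by (rule integral_mono) (use int bd parts_basics(1)[OF M] in auto)
  also have "\<dots> = B * measure M (topspace T)" using parts_basics(1)[OF M] by simp
  also have "\<dots> \<le> B * crude_mass"
    unfolding crude_mass_def using M B
    by (intro mult_left_mono member_le_sum) (auto simp: parts_def)
  finally show "cmod (integral\<^sup>L M f) \<le> crude_mass * B" by (simp add: mult.commute)
qed

lemma measure_integral_unfold:
  "measure_integral T \<mu> f =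
     (integral\<^sup>L (positive_part T (\<lambda>A. Re (\<mu> A))) f - integral\<^sup>L (positive_part T (\<lambda>A. - Re (\<mu> A))) f)
     + \<i> * (integral\<^sup>L (positive_part T (\<lambda>A. Im (\<mu> A))) f - integral\<^sup>L (positive_part T (\<lambda>A. - Im (\<mu> A))) f)"
  by (simp add: measure_integral_def real_measure_integral_def)

lemma measure_integral_add:
  assumes N: "sets N = borel_sets T" and f: "f \<in> borel_measurable N" and g: "g \<in> borel_measurable N"
    and bf: "\<And>x. x \<in> topspace T \<Longrightarrow> cmod (f x) \<le> A" and bg: "\<And>x. x \<in> topspace T \<Longrightarrow> cmod (g x) \<le> B"
  shows "measure_integral T \<mu> (\<lambda>x. f x + g x) = measure_integral T \<mu> f + measure_integral T \<mu> g"
proof -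
  have "integrable M f \<and> integrable M g" if "M \<in> parts" for M
    using parts_integral(1)[OF that N f, of "max A 0"] parts_integral(1)[OF that N g, of "max B 0"] bf bg
    by (auto simp: le_max_iff_disj)
  then have "integral\<^sup>L M (\<lambda>x. f x + g x) = integral\<^sup>L M f + integral\<^sup>L M g" if "M \<in> parts" for M
    using that by simp
  then show ?thesis unfolding measure_integral_unfold parts_def by (simp add: algebra_simps)
qed

lemma measure_integral_scale:
  "measure_integral T \<mu> (\<lambda>x. c * f x) = c * measure_integral T \<mu> f"
  unfolding measure_integral_unfold by (simp add: algebra_simps)

lemma measure_integral_crude:
  assumes N: "sets N = borel_sets T" and f: "f \<in> borel_measurable N"
    and bf: "\<And>x. x \<in> topspace T \<Longrightarrow> cmod (f x) \<le> A" and A: "0 \<le> A"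
  shows "cmod (measure_integral T \<mu> f) \<le> (4 * crude_mass) * A"
proof -
  have b: "cmod (integral\<^sup>L M f) \<le> crude_mass * A" if "M \<in> parts" for M
    using that by (rule parts_integral(2)[OF _ N f bf A])
  have "cmod (measure_integral T \<mu> f)
      \<le> (cmod (integral\<^sup>L (positive_part T (\<lambda>A. Re (\<mu> A))) f) + cmod (integral\<^sup>L (positive_part T (\<lambda>A. - Re (\<mu> A))) f))
      + (cmod (integral\<^sup>L (positive_part T (\<lambda>A. Im (\<mu> A))) f) + cmod (integral\<^sup>L (positive_part T (\<lambda>A. - Im (\<mu> A))) f))"
    unfolding measure_integral_unfold
    by (intro order_trans[OF norm_triangle_ineq] add_mono norm_triangle_ineq4)
      (simp add: norm_mult norm_triangle_ineq4)
  also have "\<dots> \<le> (crude_mass * A + crude_mass * A) + (crude_mass * A + crude_mass * A)"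
    by (intro add_mono b) (auto simp: parts_def)
  finally show ?thesis by (simp add: algebra_simps)
qed

lemma measure_integral_indicator:
  assumes A: "A \<in> borel_sets T"
  shows "measure_integral T \<mu> (indicator A) = \<mu> A"
proof -
  have i: "integral\<^sup>L M (indicator A :: _ \<Rightarrow> complex) = complex_of_real (measure M A)" if "M \<in> parts" for M
  proof -
    interpret finite_measure M by (rule parts_basics(3)[OF that])
    have AM: "A \<in> sets M" using A parts_basics(2)[OF that] by simp
    have "integral\<^sup>L M (\<lambda>x. complex_of_real (indicator A x)) = complex_of_real (integral\<^sup>L M (indicator A))"
      by (rule integral_complex_of_real)
    moreover have "(\<lambda>x. complex_of_real (indicator A x)) = indicator A"
      by (auto simp: fun_eq_iff indicator_def)
    ultimately show ?thesis using sets.sets_into_space[OF AM] by (simp add: Int_absorb2)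
  qed
  have "measure_integral T \<mu> (indicator A) = complex_of_real (Re (\<mu> A)) + \<i> * complex_of_real (Im (\<mu> A))"
    unfolding measure_integral_unfold
    using jordan_decomposition[OF Re_signed A] jordan_decomposition[OF Im_signed A]
    by (simp add: i parts_def of_real_diff[symmetric] del: of_real_diff)
  then show ?thesis by (simp add: complex_eq_iff)
qed

text \<open>Estimating the four Jordan parts separately would lose a constant factor. The exact
  total variation comes from bounding partition sums of the values on indicators, which are the
  values of \<open>\<mu>\<close>.\<close>

lemma cmod_measure_integral_le:
  assumes f: "continuous_map T euclidean f" and bf: "\<And>x. x \<in> topspace T \<Longrightarrow> cmod (f x) \<le> B"
    and B: "0 \<le> B"
  shows "cmod (measure_integral T \<mu> f) \<le> total_variation T \<mu> * B"
proof -
  define N where "N = positive_part T (\<lambda>A. Re (\<mu> A))"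
  have N: "sets N = borel_sets T" "space N = topspace T"
    unfolding N_def using bounded_signed_measure.positive_part_basics[OF Re_signed] by auto
  show ?thesis
  proof (rule linear_functional_bound[where M=N and C="4 * crude_mass"
        and D="measure_integral T \<mu>" and f=f])
    show "(\<Sum>A\<in>P. cmod (measure_integral T \<mu> (indicator A))) \<le> total_variation T \<mu>"
      if "finite P" "P \<subseteq> sets N" "disjoint P" "\<Union>P = space N" for P
      using partition_le_total_variation[of P] that measure_integral_indicator N
      by (simp add: subset_iff)
    show "f \<in> borel_measurable N" by (rule continuous_map_borel_measurable[OF f N(2,1)])
    show "measure_integral T \<mu> (\<lambda>x. h x + g x) = measure_integral T \<mu> h + measure_integral T \<mu> g"
      if "h \<in> borel_measurable N" "g \<in> borel_measurable N" "\<And>x. x \<in> space N \<Longrightarrow> cmod (h x) \<le> A"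
        "\<And>x. x \<in> space N \<Longrightarrow> cmod (g x) \<le> B" for h g A B
      by (rule measure_integral_add[OF N(1) that[unfolded N(2)]])
    show "cmod (measure_integral T \<mu> h) \<le> 4 * crude_mass * A"
      if "h \<in> borel_measurable N" "\<And>x. x \<in> space N \<Longrightarrow> cmod (h x) \<le> A" "0 \<le> A" for h A
      by (rule measure_integral_crude[OF N(1) that[unfolded N(2)]])
    show "measure_integral T \<mu> (\<lambda>x. c * h x) = c * measure_integral T \<mu> h" for c h
      by (rule measure_integral_scale)
    show "cmod (f x) \<le> B" if "x \<in> space N" for x using bf that N(2) by simp
  qed (rule B)
qed

text \<open>The difference of the two functionals vanishes on indicators, so
  \<open>linear_functional_bound\<close> applies to it with partition bound 0.\<close>

lemma measure_integral_eqI: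
  fixes D :: "('b \<Rightarrow> complex) \<Rightarrow> complex"
  assumes N: "sets N = borel_sets T" "space N = topspace T"
    and add: "\<And>f g A B. f \<in> borel_measurable N \<Longrightarrow> g \<in> borel_measurable N \<Longrightarrow>
      (\<And>x. x \<in> topspace T \<Longrightarrow> cmod (f x) \<le> A) \<Longrightarrow> (\<And>x. x \<in> topspace T \<Longrightarrow> cmod (g x) \<le> B) \<Longrightarrow>
      D (\<lambda>x. f x + g x) = D f + D g"
    and scale: "\<And>f c A. f \<in> borel_measurable N \<Longrightarrow> (\<And>x. x \<in> topspace T \<Longrightarrow> cmod (f x) \<le> A) \<Longrightarrow>
      D (\<lambda>x. c * f x) = c * D f"
    and crude: "\<And>f A. f \<in> borel_measurable N \<Longrightarrow> (\<And>x. x \<in> topspace T \<Longrightarrow> cmod (f x) \<le> A) \<Longrightarrow>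
      0 \<le> A \<Longrightarrow> cmod (D f) \<le> C * A"
    and ind: "\<And>A. A \<in> borel_sets T \<Longrightarrow> D (indicator A) = \<mu> A"
    and f: "f \<in> borel_measurable N" and bf: "\<And>x. x \<in> topspace T \<Longrightarrow> cmod (f x) \<le> B" and B: "0 \<le> B"
  shows "measure_integral T \<mu> f = D f"
proof -
  have "cmod (measure_integral T \<mu> f - D f) \<le> 0 * B"
  proof (rule linear_functional_bound[where M=N and C="4 * crude_mass + C" and
        D="\<lambda>f. measure_integral T \<mu> f - D f", OF _ _ _ _ f])
    show "(\<Sum>A\<in>P. cmod (measure_integral T \<mu> (indicator A) - D (indicator A))) \<le> 0"
      if "P \<subseteq> sets N" for P
      using that measure_integral_indicator ind N by (simp add: subset_iff)
    show "cmod (measure_integral T \<mu> h - D h) \<le> (4 * crude_mass + C) * A"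
      if h: "h \<in> borel_measurable N" "\<And>x. x \<in> space N \<Longrightarrow> cmod (h x) \<le> A" "0 \<le> A" for h A
    proof -
      have "cmod (measure_integral T \<mu> h) \<le> 4 * crude_mass * A"
        by (rule measure_integral_crude[OF N(1) h[unfolded N(2)]])
      moreover have "cmod (D h) \<le> C * A" by (rule crude[OF h[unfolded N(2)]])
      ultimately show ?thesis using norm_triangle_ineq4[of "measure_integral T \<mu> h" "D h"]
        by (simp only: distrib_right)
    qed
    show "measure_integral T \<mu> (\<lambda>x. h x + g x) - D (\<lambda>x. h x + g x)
        = (measure_integral T \<mu> h - D h) + (measure_integral T \<mu> g - D g)"
      if "h \<in> borel_measurable N" "g \<in> borel_measurable N" "\<And>x. x \<in> space N \<Longrightarrow> cmod (h x) \<le> A"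
        "\<And>x. x \<in> space N \<Longrightarrow> cmod (g x) \<le> B" for h g A B
      by (simp only: measure_integral_add[OF N(1) that[unfolded N(2)]] add[OF that[unfolded N(2)]] add_diff_add)
    show "measure_integral T \<mu> (\<lambda>x. c * h x) - D (\<lambda>x. c * h x) = c * (measure_integral T \<mu> h - D h)"
      if "h \<in> borel_measurable N" "\<And>x. x \<in> space N \<Longrightarrow> cmod (h x) \<le> A" for h c A
      by (simp only: measure_integral_scale scale[OF that[unfolded N(2)]] right_diff_distrib)
    show "cmod (f x) \<le> B" if "x \<in> space N" for x using bf that N(2) by simp
  qed (rule B)
  then show ?thesis by simp
qed

end

lemma radon_measure_scalar_measure: "radon_measure K T \<mu> \<Longrightarrow> scalar_measure T \<mu>"
  unfolding radon_measure_def scalar_measure_def by auto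

section \<open>Scalar Radon measures from positive functionals\<close>

lemma compact_unit_scalars:
  assumes "K = \<real> \<or> K = UNIV"
  shows "compact (unit_scalars K)"
proof -
  have "unit_scalars K = K \<inter> sphere 0 1" unfolding unit_scalars_def by auto
  moreover have "closed K" using assms closed_complex_Reals by auto
  ultimately show ?thesis by (simp add: closed_Int_compact)
qed

lemma continuous_map_mult_field:
  fixes f g :: "'b \<Rightarrow> 'c::real_normed_field"
  shows "continuous_map T euclidean f \<Longrightarrow> continuous_map T euclidean g \<Longrightarrow>
    continuous_map T euclidean (\<lambda>x. f x * g x)"
  by (simp add: continuous_map_atin tendsto_mult)

lemma continuous_map_prod_field:
  fixes f :: "'i \<Rightarrow> 'b \<Rightarrow> 'c::real_normed_field"
  shows "(\<And>i. i \<in> I \<Longrightarrow> continuous_map T euclidean (f i)) \<Longrightarrow>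
    continuous_map T euclidean (\<lambda>x. \<Prod>i\<in>I. f i x)"
  by (simp add: continuous_map_atin tendsto_prod)

text \<open>The density is separated off by working on the product with the compact set of unit scalars:
  the measure of \<open>A\<close> is the integral of the first coordinate \<open>u\<close> over \<open>unit_scalars K \<times> A\<close>.\<close>

lemma radon_measure_of_positive_functional:
  assumes K: "K = \<real> \<or> K = UNIV" and P: "compact_space P" "Hausdorff_space P"
    and L: "positive_functional (unit_scalars K \<times> topspace P) L"
  obtains \<mu> where "radon_measure K P \<mu>" "total_variation P \<mu> \<le> L (\<lambda>_. 1)"
    "\<And>f. continuous_map P euclidean f \<Longrightarrow>
      measure_integral P \<mu> f = positive_functional.clift L (\<lambda>(u, p). u * f p)"
proof -
  let ?S = "unit_scalars K"
  define T where "T = prod_topology (top_of_set ?S) P"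
  have topT: "topspace T = ?S \<times> topspace P" by (simp add: T_def)
  have T: "compact_space T" "Hausdorff_space T"
    using P compact_unit_scalars[OF K]
    by (auto simp: T_def compact_space_prod_topology Hausdorff_space_prod_topology
        compact_space_subtopology Hausdorff_space_subtopology)
  interpret positive_functional "topspace T" L unfolding topT by (rule L)
  obtain \<pi> where pi: "space \<pi> = topspace T" "sets \<pi> = borel_sets T" "finite_measure \<pi>"
    "measure \<pi> (topspace T) = L (\<lambda>_. 1)"
    and reg: "\<And>A e. A \<in> borel_sets T \<Longrightarrow> 0 < e \<Longrightarrow>
       \<exists>C U. closedin T C \<and> openin T U \<and> C \<subseteq> A \<and> A \<subseteq> U \<and> measure \<pi> (U - C) < e"
    and int: "\<And>f. continuous_map T euclideanreal f \<Longrightarrow> integral\<^sup>L \<pi> f = L f"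
    by (rule riesz_representation[OF T positive_functional_axioms]) (rule that, assumption+)
  interpret finite_measure \<pi> by (rule pi)
  define N where "N = sigma (topspace P) {U. openin P U}"
  have N: "space N = topspace P" "sets N = borel_sets P"
    unfolding N_def borel_sets_def using openin_subset[of P]
    by (simp_all add: space_measure_of_conv sets_measure_of subset_iff)
  have fstc: "continuous_map T euclidean fst"
    unfolding T_def using continuous_map_fst continuous_map_into_fulltopology by blast
  have sndc: "continuous_map T P snd" unfolding T_def by (rule continuous_map_snd)
  have fstm: "fst \<in> borel_measurable \<pi>" by (rule continuous_map_borel_measurable[OF fstc pi(1,2)])
  have sndm: "snd \<in> \<pi> \<rightarrow>\<^sub>M N"
    unfolding N_def
  proof (rule measurable_measure_of)
    show "{U. openin P U} \<subseteq> Pow (topspace P)" using openin_subset by auto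
    show "snd \<in> space \<pi> \<rightarrow> topspace P" by (auto simp: pi(1) topT)
    fix U assume "U \<in> {U. openin P U}"
    then have "openin T {x \<in> topspace T. snd x \<in> U}" using sndc unfolding continuous_map_def by auto
    moreover have "snd -` U \<inter> space \<pi> = {x \<in> topspace T. snd x \<in> U}" by (auto simp: pi(1))
    ultimately show "snd -` U \<inter> space \<pi> \<in> sets \<pi>" using borel_sets_open pi(2) by metis
  qed
  \<comment> \<open>The image of \<open>\<pi>\<close> on \<open>P\<close>. It will dominate the
    variation of \<open>\<mu>\<close>, since the coordinate \<open>u\<close> has modulus 1.\<close>
  define \<rho> where "\<rho> = distr \<pi> N snd"
  have rho: "space \<rho> = topspace P" "sets \<rho> = borel_sets P" unfolding \<rho>_def using N by auto
  interpret \<rho>: finite_measure \<rho> unfolding \<rho>_def by (rule finite_measure_distr[OF sndm])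
  have rho_eq: "measure \<rho> A = measure \<pi> (?S \<times> A)" if "A \<in> borel_sets P" for A
  proof -
    have "snd -` A \<inter> space \<pi> = ?S \<times> A" using borel_sets_subset[OF that] by (auto simp: pi(1) topT)
    then show ?thesis unfolding \<rho>_def using measure_distr[OF sndm] that N by simp
  qed
  have slab: "?S \<times> A \<in> borel_sets T" if "A \<in> borel_sets P" for A
  proof -
    have "snd -` A \<inter> space \<pi> = ?S \<times> A" using borel_sets_subset[OF that] by (auto simp: pi(1) topT)
    then show ?thesis using measurable_sets[OF sndm] that N pi(2) by metis
  qed
  define D where "D f = (\<integral>q. fst q * f (snd q) \<partial>\<pi>)" for f :: "_ \<Rightarrow> complex"
  have Dint: "integrable \<pi> (\<lambda>q. fst q * f (snd q))"
    if f: "f \<in> borel_measurable N" and bd: "\<And>x. x \<in> topspace P \<Longrightarrow> cmod (f x) \<le> A" for f :: "_ \<Rightarrow> complex" and A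
  proof (rule integrable_const_bound[of _ A])
    show "AE q in \<pi>. cmod (fst q * f (snd q)) \<le> A"
      by (rule AE_I2) (auto simp: pi(1) topT norm_mult unit_scalars_def intro: bd)
    show "(\<lambda>q. fst q * f (snd q)) \<in> borel_measurable \<pi>"
      by (intro borel_measurable_times fstm measurable_compose[OF sndm f])
  qed
  have Dle: "cmod (D f) \<le> (\<integral>p. h p \<partial>\<rho>)"
    if f: "f \<in> borel_measurable N" and h: "integrable \<rho> h" and bd: "\<And>x. x \<in> topspace P \<Longrightarrow> cmod (f x) \<le> A"
      and fh: "\<And>x. x \<in> topspace P \<Longrightarrow> cmod (f x) \<le> h x" for f :: "_ \<Rightarrow> complex" and h A
  proof -
    have hm: "h \<in> borel_measurable N" using h unfolding \<rho>_def by auto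
    have "cmod (D f) \<le> (\<integral>q. cmod (fst q * f (snd q)) \<partial>\<pi>)" unfolding D_def by (rule integral_norm_bound)
    also have "\<dots> \<le> (\<integral>q. h (snd q) \<partial>\<pi>)"
    proof (rule integral_mono)
      show "integrable \<pi> (\<lambda>q. h (snd q))" using h unfolding \<rho>_def
        by (simp add: integrable_distr_eq[OF sndm hm])
      show "cmod (fst q * f (snd q)) \<le> h (snd q)" if "q \<in> space \<pi>" for q
        using that fh[of "snd q"] by (auto simp: pi(1) topT norm_mult unit_scalars_def)
    qed (use Dint[OF f bd] in auto)
    also have "\<dots> = (\<integral>p. h p \<partial>\<rho>)" unfolding \<rho>_def by (rule integral_distr[OF sndm hm, symmetric])
    finally show ?thesis .
  qed
  define \<mu> where "\<mu> A = D (indicator A)" for A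
  have indm: "(indicator A :: _ \<Rightarrow> complex) \<in> borel_measurable N" if "A \<in> borel_sets P" for A
    by (intro borel_measurable_indicator) (simp add: N that)
  have ind_le: "cmod (indicator A x) \<le> 1" for A :: "'a set" and x by (simp add: indicator_def)
  have mu_le: "cmod (\<mu> A) \<le> measure \<rho> A" if A: "A \<in> borel_sets P" for A
  proof -
    have "integrable \<rho> (indicator A :: _ \<Rightarrow> real)"
      using A rho by (intro integrable_real_indicator) (auto simp: \<rho>.emeasure_eq_measure)
    then have "cmod (\<mu> A) \<le> (\<integral>p. indicator A p \<partial>\<rho>)"
      unfolding \<mu>_def by (rule Dle[OF indm[OF A] _ ind_le]) (simp add: indicator_def)
    also have "\<dots> = measure \<rho> A" using borel_sets_subset[OF A] rho by (simp add: Int_absorb2)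
    finally show ?thesis .
  qed
  interpret PB: sigma_algebra "topspace P" "borel_sets P" by (rule borel_sets_sigma_algebra)
  have Dadd: "D (\<lambda>x. f x + g x) = D f + D g"
    if "f \<in> borel_measurable N" "g \<in> borel_measurable N"
      "\<And>x. x \<in> topspace P \<Longrightarrow> cmod (f x) \<le> A" "\<And>x. x \<in> topspace P \<Longrightarrow> cmod (g x) \<le> B" for f g A B
    unfolding D_def using Dint[OF that(1,3)] Dint[OF that(2,4)]
    by (simp add: distrib_left)
  have mu_Un: "\<mu> (A \<union> B) = \<mu> A + \<mu> B"
    if "A \<in> borel_sets P" "B \<in> borel_sets P" "A \<inter> B = {}" for A B
  proof -
    have "indicator (A \<union> B) = (\<lambda>x. indicator A x + indicator B x :: complex)"
      using that(3) by (auto simp: fun_eq_iff indicator_def)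
    then show ?thesis unfolding \<mu>_def
      using Dadd[OF indm[OF that(1)] indm[OF that(2)] ind_le ind_le] by simp
  qed
  have mu_empty: "\<mu> {} = 0" using mu_le[of "{}"] by simp
  have mu_sums: "(\<lambda>n. \<mu> (A n)) sums \<mu> (\<Union>n. A n)"
    if A: "range A \<subseteq> borel_sets P" "disjoint_family A" for A :: "nat \<Rightarrow> _"
  proof -
    define R where "R n = (\<Union>i. A i) - (\<Union>i<n. A i)" for n
    have An: "A n \<in> borel_sets P" for n using A(1) by auto
    have R: "R n \<in> borel_sets P" and U: "(\<Union>i<n. A i) \<in> borel_sets P" for n
      unfolding R_def using An by auto
    have split: "\<mu> (\<Union>i<n. A i) = (\<Sum>i<n. \<mu> (A i)) \<and> measure \<rho> (\<Union>i<n. A i) = (\<Sum>i<n. measure \<rho> (A i))" for n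
    proof (induction n)
      case (Suc n)
      have "A i \<inter> A n = {}" if "i < n" for i
        by (rule disjoint_family_onD[OF A(2)]) (use that in auto)
      then have dis: "(\<Union>i<n. A i) \<inter> A n = {}" by blast
      have eq: "(\<Union>i<Suc n. A i) = (\<Union>i<n. A i) \<union> A n" by (auto simp: lessThan_Suc)
      show ?case unfolding eq using mu_Un[OF U An dis] Suc \<rho>.finite_measure_Union[OF _ _ dis] U An rho
        by simp
    qed (simp add: mu_empty)
    have whole: "(\<Union>i. A i) = (\<Union>i<n. A i) \<union> R n" "(\<Union>i<n. A i) \<inter> R n = {}" for n
      unfolding R_def by auto
    \<comment> \<open>The remainder after \<open>n\<close> sets is \<open>\<mu> (R n)\<close>,
      bounded by \<open>\<rho>\<close> of the same set; countable additivity is thereby inherited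
      from \<open>\<rho>\<close>.\<close>
    have diff: "cmod ((\<Sum>i<n. \<mu> (A i)) - \<mu> (\<Union>i. A i)) \<le> measure \<rho> (\<Union>i. A i) - (\<Sum>i<n. measure \<rho> (A i))" for n
    proof -
      have "\<mu> (\<Union>i. A i) = (\<Sum>i<n. \<mu> (A i)) + \<mu> (R n)"
        using mu_Un[OF U R whole(2), of n] whole(1)[of n] split by simp
      moreover have "measure \<rho> (\<Union>i. A i) = (\<Sum>i<n. measure \<rho> (A i)) + measure \<rho> (R n)"
        using \<rho>.finite_measure_Union[OF _ _ whole(2), of n] U R rho whole(1)[of n] split by simp
      ultimately show ?thesis using mu_le[OF R, of n] by (simp add: norm_minus_commute)
    qed
    have "(\<lambda>i. measure \<rho> (A i)) sums measure \<rho> (\<Union>i. A i)"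
      by (rule \<rho>.finite_measure_UNION) (use A rho in auto)
    then have "(\<lambda>n. measure \<rho> (\<Union>i. A i) - (\<Sum>i<n. measure \<rho> (A i))) \<longlonglongrightarrow> measure \<rho> (\<Union>i. A i) - measure \<rho> (\<Union>i. A i)"
      unfolding sums_def by (intro tendsto_diff tendsto_const)
    then have lim: "(\<lambda>n. measure \<rho> (\<Union>i. A i) - (\<Sum>i<n. measure \<rho> (A i))) \<longlonglongrightarrow> 0" by simp
    have "(\<lambda>n. (\<Sum>i<n. \<mu> (A i)) - \<mu> (\<Union>i. A i)) \<longlonglongrightarrow> 0"
      by (rule Lim_null_comparison[OF always_eventually[OF allI[OF diff]] lim])
    then show ?thesis unfolding sums_def by (rule LIM_zero_cancel)
  qed
  \<comment> \<open>Valid for every set: one that is not Borel has no finite Borel partition, and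
    its variation is an empty supremum.\<close>
  have var: "variation P \<mu> A \<le> ennreal (measure \<rho> A)" for A
    unfolding variation_def
  proof (rule SUP_least)
    fix Q assume "Q \<in> {Q. finite Q \<and> Q \<subseteq> borel_sets P \<and> disjoint Q \<and> \<Union>Q = A}"
    then have Q: "finite Q" "Q \<subseteq> borel_sets P" "disjoint Q" "\<Union>Q = A" by auto
    have "(\<Sum>B\<in>Q. ennreal (cmod (\<mu> B))) = ennreal (\<Sum>B\<in>Q. cmod (\<mu> B))" by (simp add: sum_ennreal)
    also have "\<dots> \<le> ennreal (\<Sum>B\<in>Q. measure \<rho> B)"
      by (intro ennreal_leI sum_mono mu_le) (use Q in auto)
    also have "(\<Sum>B\<in>Q. measure \<rho> B) = measure \<rho> (\<Union>B\<in>Q. B)"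
      by (rule \<rho>.finite_measure_finite_Union[symmetric])
        (use Q rho in \<open>auto simp: disjoint_family_on_def disjoint_def\<close>)
    finally show "(\<Sum>B\<in>Q. ennreal (cmod (\<mu> B))) \<le> ennreal (measure \<rho> A)" using Q(4) by simp
  qed
  have top: "topspace P \<in> borel_sets P" by (rule borel_sets_open) simp
  have mass: "measure \<rho> (topspace P) = L (\<lambda>_. 1)"
    using rho_eq[OF top] pi(4) by (simp add: topT)
  have muK: "\<mu> A \<in> K" for A
  proof (cases "K = UNIV")
    case False
    then have K: "K = \<real>" using K by simp
    have "\<mu> A = (\<integral>q. complex_of_real (Re (fst q * indicator A (snd q))) \<partial>\<pi>)"
      unfolding \<mu>_def D_def
    proof (rule Bochner_Integration.integral_cong[OF refl])
      fix q assume "q \<in> space \<pi>"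
      then have "fst q \<in> \<real>" by (auto simp: pi(1) topT unit_scalars_def K)
      then have "fst q * indicator A (snd q) \<in> \<real>" by (auto simp: indicator_def)
      then show "fst q * indicator A (snd q) = complex_of_real (Re (fst q * indicator A (snd q)))"
        by (simp only: of_real_Re)
    qed
    then show ?thesis unfolding K by (simp only: integral_complex_of_real Reals_of_real)
  qed simp
  have regular: "\<exists>C U. compactin P C \<and> openin P U \<and> C \<subseteq> A \<and> A \<subseteq> U \<and> variation P \<mu> (U - C) < e"
    if A: "A \<in> borel_sets P" and e: "0 < e" for A and e :: ennreal
  proof -
    \<comment> \<open>\<open>e\<close> may be infinite, so a positive real number below it is used
      instead.\<close>
    obtain d where d: "0 < d" "d < e" using dense[OF e] by auto
    then obtain r where r: "d = ennreal r" "0 < r"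
      by (cases d) (auto simp: ennreal_zero_less_divide)
    have A': "topspace P - A \<in> borel_sets P" using A by auto
    \<comment> \<open>Regularity of \<open>\<pi>\<close> on the product descends to \<open>P\<close>
      by projecting the inner closed set: the projection is compact, and the slab over the part of
      \<open>B\<close> outside it misses \<open>C\<close>. Outer approximation below is this
      statement for the complement of \<open>A\<close>.\<close>
    have approx: "\<exists>C. compactin P C \<and> C \<subseteq> B \<and> measure \<pi> (?S \<times> (B - C)) < r / 2"
      if B: "B \<in> borel_sets P" for B
    proof -
      obtain C U where CU: "closedin T C" "openin T U" "C \<subseteq> ?S \<times> B" "?S \<times> B \<subseteq> U" "measure \<pi> (U - C) < r / 2"
        using reg[OF slab[OF B], of "r / 2"] r(2) by auto
      have "compactin P (snd ` C)"
        using T(1) CU(1) sndc closedin_compact_space image_compactin by blast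
      moreover have "snd ` C \<subseteq> B" using CU(3) by auto
      moreover have "measure \<pi> (?S \<times> (B - snd ` C)) \<le> measure \<pi> (U - C)"
      proof (rule finite_measure_mono)
        show "?S \<times> (B - snd ` C) \<subseteq> U - C" using CU(4) by force
        show "U - C \<in> sets \<pi>"
          unfolding pi(2) using sets.Diff[of U \<pi> C] borel_sets_open[OF CU(2)] borel_sets_closed[OF CU(1)] pi(2)
          by simp
      qed
      ultimately show ?thesis using CU(5) by force
    qed
    obtain C where C: "compactin P C" "C \<subseteq> A" "measure \<pi> (?S \<times> (A - C)) < r / 2"
      using approx[OF A] by auto
    obtain C' where C': "compactin P C'" "C' \<subseteq> topspace P - A" "measure \<pi> (?S \<times> (topspace P - A - C')) < r / 2"
      using approx[OF A'] by auto
    define U where "U = topspace P - C'"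
    have Cc: "closedin P C" "closedin P C'"
      using C(1) C'(1) compactin_imp_closedin[OF P(2)] by auto
    have U: "openin P U" unfolding U_def using Cc by auto
    have sets: "A - C \<in> borel_sets P" "topspace P - A - C' \<in> borel_sets P" "U - C \<in> borel_sets P"
      using A Cc[THEN borel_sets_closed] borel_sets_open[OF U] by auto
    have "measure \<rho> (U - C) \<le> measure \<rho> ((A - C) \<union> (topspace P - A - C'))"
      by (rule \<rho>.finite_measure_mono) (use sets rho in \<open>auto simp: U_def\<close>)
    also have "\<dots> \<le> measure \<rho> (A - C) + measure \<rho> (topspace P - A - C')"
      by (rule measure_Un_le) (use sets rho in auto)
    also have "\<dots> < r" using C(3) C'(3) rho_eq sets by simp
    finally have "ennreal (measure \<rho> (U - C)) < e"
      using d(2) r by (metis ennreal_lessI order_less_trans)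
    then have "variation P \<mu> (U - C) < e" using var[of "U - C"] by (rule order_le_less_trans[rotated])
    then show ?thesis using C U C'(2) borel_sets_subset[OF A]
      by (intro exI[of _ C] exI[of _ U]) (auto simp: U_def)
  qed
  have rm: "radon_measure K P \<mu>"
    unfolding radon_measure_def
  proof (intro conjI)
    show "variation P \<mu> (topspace P) < \<infinity>"
      using var[of "topspace P"] ennreal_less_top order_le_less_trans
      unfolding infinity_ennreal_def by blast
  qed (use muK mu_sums regular in auto)
  interpret scalar_measure P \<mu> by (rule radon_measure_scalar_measure[OF rm])
  have tv: "total_variation P \<mu> \<le> L (\<lambda>_. 1)"
  proof -
    have "ennreal (total_variation P \<mu>) \<le> ennreal (L (\<lambda>_. 1))"
      using var[of "topspace P"] variation_finite mass by (simp add: total_variation_def)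
    moreover have "0 \<le> L (\<lambda>_. 1)" using mass measure_nonneg[of \<rho>] by metis
    ultimately show ?thesis by simp
  qed
  have eq: "measure_integral P \<mu> f = clift (\<lambda>(u, p). u * f p)" if f: "continuous_map P euclidean f" for f
  proof -
    obtain B0 where B0: "\<forall>x\<in>topspace P. cmod (f x) \<le> B0"
      using continuous_map_bounded_image[OF P(1) f] by (auto simp: bounded_iff)
    define B where "B = max B0 0"
    have B: "0 \<le> B" "\<And>x. x \<in> topspace P \<Longrightarrow> cmod (f x) \<le> B" using B0 by (auto simp: B_def le_max_iff_disj)
    have fm: "f \<in> borel_measurable N" by (rule continuous_map_borel_measurable[OF f N])
    have "measure_integral P \<mu> f = D f"
    proof (rule measure_integral_eqI[OF N(2,1) _ _ _ _ fm B(2,1)])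
      show "cmod (D h) \<le> measure \<rho> (topspace P) * A"
        if h: "h \<in> borel_measurable N" "\<And>x. x \<in> topspace P \<Longrightarrow> cmod (h x) \<le> A" "0 \<le> A" for h A
      proof -
        have "cmod (D h) \<le> (\<integral>p. A \<partial>\<rho>)" by (rule Dle[OF h(1) _ h(2) h(2)]) simp
        then show ?thesis using rho by (simp add: mult.commute)
      qed
      show "D (\<lambda>x. c * h x) = c * D h" for c h
        unfolding D_def by (simp add: mult.left_commute[of _ c])
      show "D (\<lambda>x. h x + g x) = D h + D g"
        if "h \<in> borel_measurable N" "g \<in> borel_measurable N"
          "\<And>x. x \<in> topspace P \<Longrightarrow> cmod (h x) \<le> A" "\<And>x. x \<in> topspace P \<Longrightarrow> cmod (g x) \<le> B" for h g A B
        by (rule Dadd[OF that])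
    qed (simp add: \<mu>_def)
    also have "D f = clift (\<lambda>(u, p). u * f p)"
    proof -
      \<comment> \<open>Only for continuous \<open>f\<close> is the integrand continuous on the
        product, which is where integration against \<open>\<pi>\<close> coincides with
        \<open>L\<close>.\<close>
      have cont: "continuous_map T euclidean (\<lambda>q. fst q * f (snd q))"
        using continuous_map_mult_field[OF fstc continuous_map_compose[OF sndc f]] by (simp add: comp_def)
      have re: "continuous_map T euclideanreal (\<lambda>q. Re (fst q * f (snd q)))"
        and im: "continuous_map T euclideanreal (\<lambda>q. Im (fst q * f (snd q)))"
        using continuous_map_compose[OF cont, of euclideanreal Re] continuous_map_compose[OF cont, of euclideanreal Im]
        by (simp_all only: comp_def continuous_map_iff_continuous2 continuous_on_Re continuous_on_Im continuous_on_id)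
      have "D f = Complex (\<integral>q. Re (fst q * f (snd q)) \<partial>\<pi>) (\<integral>q. Im (fst q * f (snd q)) \<partial>\<pi>)"
        unfolding D_def using Dint[OF fm B(2)] by (simp only: integral_Re integral_Im complex_surj)
      then show ?thesis unfolding clift_def int[OF re] int[OF im] by (simp add: case_prod_unfold)
    qed
    finally show ?thesis .
  qed
  show ?thesis by (rule that[OF rm tv eq])
qed

section \<open>Dual balls\<close>

context normed_space_over
begin

lemma carrier_scalar_ring [simp]: "carrier (scalar_ring K) = K"
  by (simp add: scalar_ring_def)

lemma dual_zero:
  assumes "f \<in> dual K X"
  shows "f \<zero> = 0"
proof -
  have "f (\<zero> \<oplus> \<zero>) = f \<zero> + f \<zero>" using assms M.zero_closed unfolding dual_def by blast
  then show ?thesis by simp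
qed

lemma nrm_zero: "nrm X \<zero> = 0"
  using nrm_eq_0_iff M.zero_closed by blast

lemma dual_bdd_above:
  assumes "f \<in> dual K X"
  shows "bdd_above ((\<lambda>x. cmod (f x)) ` {x \<in> carrier X. nrm X x \<le> 1})"
proof -
  obtain C where C: "\<forall>x\<in>carrier X. cmod (f x) \<le> C * nrm X x" using assms unfolding dual_def by blast
  have "cmod (f x) \<le> \<bar>C\<bar>" if "x \<in> carrier X" "nrm X x \<le> 1" for x
  proof -
    have "cmod (f x) \<le> C * nrm X x" using C that by blast
    also have "\<dots> \<le> \<bar>C\<bar> * 1"
      by (intro mult_mono) (use that nrm_nonneg in auto)
    finally show ?thesis by simp
  qed
  then show ?thesis by (intro bdd_aboveI[of _ "\<bar>C\<bar>"]) auto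
qed

lemma dual_norm_nonneg:
  assumes "f \<in> dual K X"
  shows "0 \<le> dual_norm X f"
proof -
  have "cmod (f \<zero>) \<le> dual_norm X f"
    unfolding dual_norm_def by (rule cSUP_upper[OF _ dual_bdd_above[OF assms]]) (simp add: nrm_zero)
  then show ?thesis using norm_ge_zero order_trans by blast
qed

lemma dual_norm_least:
  assumes "0 \<le> B" "\<And>x. x \<in> carrier X \<Longrightarrow> cmod (f x) \<le> B * nrm X x"
  shows "dual_norm X f \<le> B"
  unfolding dual_norm_def
proof (rule cSUP_least)
  show "{x \<in> carrier X. nrm X x \<le> 1} \<noteq> {}" using M.zero_closed nrm_zero by force
  fix x assume x: "x \<in> {x \<in> carrier X. nrm X x \<le> 1}"
  have "cmod (f x) \<le> B * nrm X x" using assms(2) x by simp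
  also have "\<dots> \<le> B" using x assms(1) by (simp add: mult_left_le)
  finally show "cmod (f x) \<le> B" .
qed

lemma cmod_le_dual_norm:
  assumes K: "K = \<real> \<or> K = UNIV" and f: "f \<in> dual K X" and x: "x \<in> carrier X"
  shows "cmod (f x) \<le> dual_norm X f * nrm X x"
proof (cases "x = \<zero>")
  case True
  then show ?thesis using dual_zero[OF f] nrm_zero by simp
next
  case False
  then have n: "0 < nrm X x" using nrm_eq_0_iff[OF x] nrm_nonneg[OF x] by simp
  define c where "c = complex_of_real (1 / nrm X x)"
  have c: "c \<in> K" using K by (auto simp: c_def)
  have cx: "c \<odot>\<^bsub>X\<^esub> x \<in> carrier X" using smult_closed[of c x] c x by simp
  have "cmod c = 1 / nrm X x" using n by (simp add: c_def norm_divide)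
  moreover have "nrm X (c \<odot>\<^bsub>X\<^esub> x) = 1"
    unfolding nrm_smult[OF c x] using n by (simp add: c_def norm_divide)
  moreover have "f (c \<odot>\<^bsub>X\<^esub> x) = c * f x" using f c x unfolding dual_def by blast
  moreover have "cmod (f (c \<odot>\<^bsub>X\<^esub> x)) \<le> dual_norm X f"
    unfolding dual_norm_def
    by (rule cSUP_upper[OF _ dual_bdd_above[OF f]]) (use cx \<open>nrm X (c \<odot>\<^bsub>X\<^esub> x) = 1\<close> in simp)
  ultimately have "cmod (f x) / nrm X x \<le> dual_norm X f" by (simp add: norm_mult)
  then show ?thesis using n by (simp add: pos_divide_le_eq)
qed

text \<open>Each condition on the right involves finitely many coordinates of \<open>f\<close>,
  hence is closed for pointwise convergence; compactness of the ball rests on this form.\<close>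

lemma dual_ball_iff:
  assumes K: "K = \<real> \<or> K = UNIV"
  shows "f \<in> dual_ball K X \<longleftrightarrow>
    (\<forall>x\<in>carrier X. f x \<in> K) \<and> (\<forall>x\<in>- carrier X. f x = 0) \<and>
    (\<forall>x\<in>carrier X. \<forall>y\<in>carrier X. f (x \<oplus> y) = f x + f y) \<and>
    (\<forall>c\<in>K. \<forall>x\<in>carrier X. f (c \<odot>\<^bsub>X\<^esub> x) = c * f x) \<and>
    (\<forall>x\<in>carrier X. cmod (f x) \<le> nrm X x)" (is "_ \<longleftrightarrow> ?R")
proof
  assume f: "f \<in> dual_ball K X"
  then have fd: "f \<in> dual K X" "dual_norm X f \<le> 1" unfolding dual_ball_def by auto
  have "cmod (f x) \<le> nrm X x" if x: "x \<in> carrier X" for x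
    using cmod_le_dual_norm[OF K fd(1) x] mult_right_mono[OF fd(2) nrm_nonneg[OF x]] by simp
  then show ?R using fd(1) unfolding dual_def by simp
next
  assume R: ?R
  then have "f \<in> dual K X" unfolding dual_def by (auto intro: exI[of _ 1])
  moreover have "dual_norm X f \<le> 1" by (rule dual_norm_least) (use R in auto)
  ultimately show "f \<in> dual_ball K X" unfolding dual_ball_def by simp
qed

lemma zero_in_dual_ball: "K = \<real> \<or> K = UNIV \<Longrightarrow> (\<lambda>x. 0) \<in> dual_ball K X"
  by (auto simp: dual_ball_iff nrm_nonneg)

text \<open>Bounds known on the unit ball pass to functionals of norm at most \<open>r\<close> with
  the factor \<open>r\<close>. This is used for the cluster points and for the functionals of a
  nuclear representation. For \<open>r = 0\<close> the functional vanishes and \<open>g = 0\<close>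
  serves.\<close>

lemma dual_scaled_ball:
  assumes K: "K = \<real> \<or> K = UNIV" and f: "f \<in> dual K X" and r: "dual_norm X f \<le> r"
  obtains g where "g \<in> dual_ball K X" "f = (\<lambda>x. complex_of_real r * g x)"
proof -
  have le: "cmod (f x) \<le> r * nrm X x" if "x \<in> carrier X" for x
    using cmod_le_dual_norm[OF K f that] mult_right_mono[OF r nrm_nonneg[OF that]] by linarith
  show ?thesis
  proof (cases "r = 0")
    case True
    have "f x = 0" for x using le[of x] True f unfolding dual_def by (cases "x \<in> carrier X") auto
    then show ?thesis using that[OF zero_in_dual_ball[OF K]] True by (simp add: fun_eq_iff)
  next
    case False
    then have r: "0 < r" using dual_norm_nonneg[OF f] r by simp
    have cK: "complex_of_real a * z \<in> K" if "z \<in> K" for a z using that K by auto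
    have "(\<lambda>x. complex_of_real (1 / r) * f x) \<in> dual_ball K X"
      unfolding dual_ball_iff[OF K]
    proof (intro conjI ballI)
      show "cmod (complex_of_real (1 / r) * f x) \<le> nrm X x" if "x \<in> carrier X" for x
        using le[OF that] r by (simp add: norm_mult norm_divide field_simps)
    qed (use f cK in \<open>auto simp: dual_def algebra_simps simp del: of_real_divide\<close>)
    then show ?thesis using that r by (simp add: fun_eq_iff)
  qed
qed

text \<open>Banach-Alaoglu: a closed subset of a product of discs of radius \<open>nrm X x\<close>,
  with radius 0 off the carrier.\<close>

lemma compact_dual_ball:
  assumes K: "K = \<real> \<or> K = UNIV"
  shows "compact (dual_ball K X)"
proof -
  define Z where "Z = (\<Pi>\<^sub>E x\<in>UNIV. cball (0::complex) (if x \<in> carrier X then nrm X x else 0))"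
  have "compactin (product_topology (\<lambda>i. euclidean) UNIV) Z"
    unfolding Z_def by (simp add: compactin_PiE)
  then have Z: "compact Z" by (simp add: euclidean_product_topology)
  have cont: "continuous_on UNIV (\<lambda>f::'a \<Rightarrow> complex. f x)" for x by simp
  have c1: "closed {f::'a \<Rightarrow> complex. f x \<in> K}" for x
  proof (cases "K = UNIV")
    case False
    then have "{f::'a \<Rightarrow> complex. f x \<in> K} = {f. Im (f x) = 0}" using K by (auto simp: complex_is_Real_iff)
    then show ?thesis by (simp only:) (intro closed_Collect_eq cont continuous_intros)
  qed simp
  have c2: "closed {f::'a \<Rightarrow> complex. f x = 0}" for x by (intro closed_Collect_eq cont continuous_intros)
  have c3: "closed {f::'a \<Rightarrow> complex. f (x \<oplus> y) = f x + f y}" for x y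
    by (intro closed_Collect_eq cont continuous_intros)
  have c4: "closed {f::'a \<Rightarrow> complex. f (c \<odot>\<^bsub>X\<^esub> x) = c * f x}" for c x
    by (intro closed_Collect_eq cont continuous_intros)
  have "dual_ball K X = Z \<inter> ((\<Inter>x\<in>carrier X. {f. f x \<in> K}) \<inter> (\<Inter>x\<in>- carrier X. {f. f x = 0}) \<inter>
    (\<Inter>x\<in>carrier X. \<Inter>y\<in>carrier X. {f. f (x \<oplus> y) = f x + f y}) \<inter>
    (\<Inter>c\<in>K. \<Inter>x\<in>carrier X. {f. f (c \<odot>\<^bsub>X\<^esub> x) = c * f x}))"
    unfolding Z_def by (auto simp: dual_ball_iff[OF K] PiE_iff split: if_splits)
  moreover have "closed ((\<Inter>x\<in>carrier X. {f. f x \<in> K}) \<inter> (\<Inter>x\<in>- carrier X. {f::'a \<Rightarrow> complex. f x = 0}) \<inter>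
    (\<Inter>x\<in>carrier X. \<Inter>y\<in>carrier X. {f. f (x \<oplus> y) = f x + f y}) \<inter>
    (\<Inter>c\<in>K. \<Inter>x\<in>carrier X. {f. f (c \<odot>\<^bsub>X\<^esub> x) = c * f x}))"
    by (intro closed_Int closed_INT ballI c1 c2 c3 c4)
  ultimately show ?thesis using compact_Int_closed[OF Z] by simp
qed

end

lemma dual_ball_topology: "subtopology (weak_star K X) (dual_ball K X) = top_of_set (dual_ball K X)"
proof -
  have "dual K X \<inter> dual_ball K X = dual_ball K X" by (auto simp: dual_ball_def)
  then show ?thesis
    by (simp add: weak_star_def euclidean_product_topology subtopology_subtopology)
qed

lemma Hausdorff_euclidean_functions: "Hausdorff_space (euclidean :: ('a \<Rightarrow> complex) topology)"
  by (simp add: euclidean_product_topology[symmetric] Hausdorff_space_product_topology)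

section \<open>Integral forms as functionals dominated by the injective norm\<close>

text \<open>The elementary tensor of the vectors \<open>x i\<close>, viewed as a function of tuples
  of functionals.\<close>

definition prod_eval :: "nat set \<Rightarrow> (nat \<Rightarrow> 'a \<Rightarrow> complex) \<Rightarrow> (nat \<Rightarrow> 'a) \<Rightarrow> complex" where
  "prod_eval I \<phi> x = (\<Prod>i\<in>I. \<phi> i (x i))"

locale nspace_family =
  fixes K :: "complex set" and E :: "nat \<Rightarrow> 'a nspace" and I :: "nat set"
  assumes K: "K = \<real> \<or> K = UNIV" and I: "finite I"
    and spaces: "\<And>i. i \<in> I \<Longrightarrow> normed_space_over K (E i)"
begin

abbreviation "balls \<equiv> \<Pi>\<^sub>E i\<in>I. dual_ball K (E i)"
abbreviation "points \<equiv> \<Pi>\<^sub>E i\<in>I. carrier (E i)"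
abbreviation "tensor_dominated \<equiv> dominated K balls (prod_eval I) points"

lemma ball_product_eq: "ball_product K E I = product_topology (\<lambda>i. top_of_set (dual_ball K (E i))) I"
  by (simp add: ball_product_def dual_ball_topology)

lemma topspace_ball_product: "topspace (ball_product K E I) = balls"
  by (simp add: ball_product_eq)

lemma compact_ball_product: "compact_space (ball_product K E I)"
  unfolding ball_product_eq compact_space_product_topology
  using normed_space_over.compact_dual_ball[OF spaces K] by (simp add: compact_space_subtopology)

lemma Hausdorff_ball_product: "Hausdorff_space (ball_product K E I)"
  unfolding ball_product_eq Hausdorff_space_product_topology
  using Hausdorff_space_subtopology[OF Hausdorff_euclidean_functions] by blast

lemma balls_nonempty: "balls \<noteq> {}"
  using normed_space_over.zero_in_dual_ball[OF spaces K] by (auto simp: PiE_eq_empty_iff)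

lemma continuous_prod_eval: "continuous_map (ball_product K E I) euclidean (\<lambda>\<phi>. prod_eval I \<phi> x)"
  unfolding prod_eval_def
proof (rule continuous_map_prod_field)
  fix i assume i: "i \<in> I"
  have "continuous_map (ball_product K E I) (top_of_set (dual_ball K (E i))) (\<lambda>\<phi>. \<phi> i)"
    unfolding ball_product_eq by (rule continuous_map_product_projection[OF i])
  moreover have "continuous_map (top_of_set (dual_ball K (E i))) euclidean (\<lambda>f. f (x i))"
    by (simp add: continuous_on_subset[OF continuous_on_product_coordinates])
  ultimately have "continuous_map (ball_product K E I) euclidean ((\<lambda>f. f (x i)) \<circ> (\<lambda>\<phi>. \<phi> i))"
    by (rule continuous_map_compose)
  then show "continuous_map (ball_product K E I) euclidean (\<lambda>\<phi>. \<phi> i (x i))"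
    by (simp add: comp_def)
qed

lemma prod_eval_in_K:
  assumes "\<phi> \<in> balls" "x \<in> points"
  shows "prod_eval I \<phi> x \<in> K"
proof -
  have "\<phi> i (x i) \<in> K" if i: "i \<in> I" for i
    using normed_space_over.dual_ball_iff[OF spaces[OF i] K, of "\<phi> i"] assms i by (auto simp: PiE_iff)
  then show ?thesis unfolding prod_eval_def using K by (auto intro: prod_in_Reals)
qed

lemma cmod_prod_eval_le:
  assumes "\<phi> \<in> balls" "x \<in> points"
  shows "cmod (prod_eval I \<phi> x) \<le> (\<Prod>i\<in>I. nrm (E i) (x i))"
proof -
  have "cmod (\<phi> i (x i)) \<le> nrm (E i) (x i)" if i: "i \<in> I" for i
    using normed_space_over.dual_ball_iff[OF spaces[OF i] K, of "\<phi> i"] assms i by (auto simp: PiE_iff)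
  then show ?thesis unfolding prod_eval_def prod_norm[symmetric] by (intro prod_mono) auto
qed

lemma bounded_prod_eval: "x \<in> points \<Longrightarrow> bounded ((\<lambda>\<phi>. prod_eval I \<phi> x) ` balls)"
  using cmod_prod_eval_le by (force simp: bounded_iff)

text \<open>A formal combination of tensors is a continuous function on the ball product. Its
  integral is the corresponding combination of values of \<open>T\<close>, bounded by the total
  variation times the supremum norm.\<close>

lemma represents_integral_dominated:
  assumes "represents_integral K E I T \<mu>"
  shows "tensor_dominated T (total_variation (ball_product K E I) \<mu>)"
  unfolding dominated_def
proof (intro allI impI)
  let ?P = "ball_product K E I"
  have rm: "radon_measure K ?P \<mu>"
    and T: "\<And>x. x \<in> points \<Longrightarrow> T x = measure_integral ?P \<mu> (\<lambda>\<phi>. prod_eval I \<phi> x)"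
    using assms unfolding represents_integral_def prod_eval_def by auto
  interpret scalar_measure ?P \<mu> by (rule radon_measure_scalar_measure[OF rm])
  define N where "N = positive_part ?P (\<lambda>A. Re (\<mu> A))"
  have N: "sets N = borel_sets ?P" "space N = topspace ?P"
    unfolding N_def using bounded_signed_measure.positive_part_basics[OF Re_signed] by auto
  fix l B assume l: "set l \<subseteq> K \<times> points" and B: "\<forall>\<phi>\<in>balls. cmod (\<Sum>(c, x)\<leftarrow>l. c * prod_eval I \<phi> x) \<le> B"
  have "continuous_map ?P euclidean (\<lambda>\<phi>. \<Sum>(c, x)\<leftarrow>l. c * prod_eval I \<phi> x) \<and>
    measure_integral ?P \<mu> (\<lambda>\<phi>. \<Sum>(c, x)\<leftarrow>l. c * prod_eval I \<phi> x) = (\<Sum>(c, x)\<leftarrow>l. c * T x)"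
    using l
  proof (induction l)
    case Nil
    show ?case using measure_integral_scale[of 0 "\<lambda>x. 0"] by simp
  next
    case (Cons a l)
    obtain c x where a: "a = (c, x)" "x \<in> points" using Cons.prems by auto
    let ?f = "\<lambda>\<phi>. c * prod_eval I \<phi> x" and ?g = "\<lambda>\<phi>. \<Sum>(c, x)\<leftarrow>l. c * prod_eval I \<phi> x"
    have f: "continuous_map ?P euclidean ?f"
      by (intro continuous_map_mult_field continuous_prod_eval) simp
    have g: "continuous_map ?P euclidean ?g" "measure_integral ?P \<mu> ?g = (\<Sum>(c, x)\<leftarrow>l. c * T x)"
      using Cons by auto
    obtain A1 A2 where A: "\<forall>\<phi>\<in>topspace ?P. cmod (?f \<phi>) \<le> A1" "\<forall>\<phi>\<in>topspace ?P. cmod (?g \<phi>) \<le> A2"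
      using continuous_map_bounded_image[OF compact_ball_product f]
        continuous_map_bounded_image[OF compact_ball_product g(1)] unfolding bounded_iff by fast
    have "measure_integral ?P \<mu> (\<lambda>\<phi>. ?f \<phi> + ?g \<phi>) = measure_integral ?P \<mu> ?f + measure_integral ?P \<mu> ?g"
      by (rule measure_integral_add[OF N(1) continuous_map_borel_measurable[OF f N(2,1)]
            continuous_map_borel_measurable[OF g(1) N(2,1)] bspec[OF A(1)] bspec[OF A(2)]])
    then show ?case using continuous_map_add[OF f g(1)] g(2) T[OF a(2)] a(1) measure_integral_scale
      by simp
  qed
  moreover have "0 \<le> B" using B balls_nonempty norm_ge_zero order_trans by blast
  ultimately show "cmod (\<Sum>(c, x)\<leftarrow>l. c * T x) \<le> total_variation ?P \<mu> * B"
    using cmod_measure_integral_le[of "\<lambda>\<phi>. \<Sum>(c, x)\<leftarrow>l. c * prod_eval I \<phi> x" B] B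
      topspace_ball_product by auto
qed

text \<open>Here the parameter set is the whole product of dual balls, so that the functional
  restricts to continuous functions on a compact space and becomes a Radon measure of no larger
  variation.\<close>

lemma dominated_represents_integral:
  assumes C: "0 \<le> C" and dom: "tensor_dominated T C" and TK: "\<And>x. x \<in> points \<Longrightarrow> T x \<in> K"
  obtains \<mu> where "represents_integral K E I T \<mu>" "total_variation (ball_product K E I) \<mu> \<le> C"
proof -
  let ?P = "ball_product K E I"
  obtain L where L: "positive_functional (unit_scalars K \<times> balls) L" "L (\<lambda>_. 1) \<le> C"
    "\<And>x. x \<in> points \<Longrightarrow> T x = positive_functional.clift L (\<lambda>(u, \<phi>). u * prod_eval I \<phi> x)"
    by (rule positive_functional_representation[OF K balls_nonempty C prod_eval_in_K TK
          bounded_prod_eval dom]) auto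
  obtain \<mu> where mu: "radon_measure K ?P \<mu>" "total_variation ?P \<mu> \<le> L (\<lambda>_. 1)"
    "\<And>f. continuous_map ?P euclidean f \<Longrightarrow>
      measure_integral ?P \<mu> f = positive_functional.clift L (\<lambda>(u, p). u * f p)"
    by (rule radon_measure_of_positive_functional[OF K compact_ball_product Hausdorff_ball_product
          L(1)[folded topspace_ball_product]]) auto
  have "represents_integral K E I T \<mu>"
    unfolding represents_integral_def
  proof (intro conjI ballI mu(1))
    fix x assume x: "x \<in> points"
    show "T x = measure_integral ?P \<mu> (\<lambda>\<phi>. \<Prod>i\<in>I. \<phi> i (x i))"
      using mu(3)[OF continuous_prod_eval, of x] L(3)[OF x] unfolding prod_eval_def by simp
  qed
  then show ?thesis using mu(2) L(2) that by force
qed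

lemma total_variation_nonneg: "0 \<le> total_variation P \<mu>"
  by (simp add: total_variation_def)

text \<open>The infimum defining the norm is not assumed to be attained; the estimate for each
  representing measure is divided by \<open>B\<close> and passes to the infimum.\<close>

lemma integral_form_dominated:
  assumes "T \<in> integral_forms K E I"
  shows "tensor_dominated T (integral_norm K E I T)" and "0 \<le> integral_norm K E I T"
proof -
  let ?R = "{\<mu>. represents_integral K E I T \<mu>}"
  have ne: "?R \<noteq> {}" using assms unfolding integral_forms_def by auto
  show "0 \<le> integral_norm K E I T"
    unfolding integral_norm_def by (rule cINF_greatest[OF ne]) (simp add: total_variation_nonneg)
  show "tensor_dominated T (integral_norm K E I T)"
    unfolding dominated_def
  proof (intro allI impI)
    fix l B assume l: "set l \<subseteq> K \<times> points"
      and B: "\<forall>\<phi>\<in>balls. cmod (\<Sum>(c, x)\<leftarrow>l. c * prod_eval I \<phi> x) \<le> B"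
    define s where "s = cmod (\<Sum>(c, x)\<leftarrow>l. c * T x)"
    have B0: "0 \<le> B" using B balls_nonempty norm_ge_zero order_trans by blast
    have le: "s \<le> total_variation (ball_product K E I) \<mu> * B" if "\<mu> \<in> ?R" for \<mu>
      using represents_integral_dominated[of T \<mu>] that l B unfolding dominated_def s_def by blast
    show "s \<le> integral_norm K E I T * B"
    \<comment> \<open>For \<open>B = 0\<close> no division is possible, but a single representing
      measure already gives \<open>s = 0\<close>.\<close>
    proof (cases "B = 0")
      case True
      then show ?thesis using le ne by auto
    next
      case False
      then have "0 < B" using B0 by simp
      then have "s / B \<le> integral_norm K E I T"
        unfolding integral_norm_def by (intro cINF_greatest[OF ne]) (use le in \<open>simp add: field_simps\<close>)
      then show ?thesis using \<open>0 < B\<close> by (simp add: field_simps)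
    qed
  qed
qed

lemma dominated_integral_form:
  assumes "T \<in> multilinear_forms K E I" "0 \<le> C" "tensor_dominated T C"
  shows "T \<in> integral_forms K E I" and "integral_norm K E I T \<le> C"
proof -
  obtain \<mu> where mu: "represents_integral K E I T \<mu>" "total_variation (ball_product K E I) \<mu> \<le> C"
    by (rule dominated_represents_integral[OF assms(2,3)]) (use assms(1) in \<open>auto simp: multilinear_forms_def\<close>)
  then show "T \<in> integral_forms K E I" using assms(1) unfolding integral_forms_def by auto
  have "integral_norm K E I T \<le> total_variation (ball_product K E I) \<mu>"
    unfolding integral_norm_def
    by (rule cINF_lower) (use mu(1) in \<open>auto intro!: bdd_belowI[of _ 0] simp: total_variation_nonneg\<close>)
  then show "integral_norm K E I T \<le> C" using mu(2) by simp
qed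

text \<open>After normalization each term of the series is the product of the dual norms times
  evaluation at a tuple from the dual balls, so on the combination it is at most that product times
  \<open>B\<close>. Summing gives the constant.\<close>

lemma represents_nuclear_dominated:
  assumes "represents_nuclear K E I T \<xi>"
  shows "tensor_dominated T (representation_sum E I \<xi>)"
  unfolding dominated_def
proof (intro allI impI)
  fix l B assume l: "set l \<subseteq> K \<times> points" and B: "\<forall>\<phi>\<in>balls. cmod (\<Sum>(c, x)\<leftarrow>l. c * prod_eval I \<phi> x) \<le> B"
  have xi: "\<And>i j. i \<in> I \<Longrightarrow> \<xi> i j \<in> dual K (E i)"
    and summ: "summable (\<lambda>j. \<Prod>i\<in>I. dual_norm (E i) (\<xi> i j))"
    and T: "\<And>x. x \<in> points \<Longrightarrow> (\<lambda>j. prod_eval I (\<lambda>i. \<xi> i j) x) sums T x"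
    using assms unfolding represents_nuclear_def prod_eval_def by auto
  define F where "F j = (\<Sum>(c, x)\<leftarrow>l. c * prod_eval I (\<lambda>i. \<xi> i j) x)" for j
  have Fs: "F sums (\<Sum>(c, x)\<leftarrow>l. c * T x)"
    unfolding F_def using l
  proof (induction l)
    case (Cons a l)
    obtain c x where a: "a = (c, x)" "x \<in> points" using Cons.prems by auto
    show ?case using sums_add[OF sums_mult[OF T[OF a(2)], of c]] Cons a(1) by simp
  qed simp
  have Fle: "cmod (F j) \<le> (\<Prod>i\<in>I. dual_norm (E i) (\<xi> i j)) * B" for j
  proof -
    have "\<exists>g. g \<in> dual_ball K (E i) \<and> \<xi> i j = (\<lambda>x. complex_of_real (dual_norm (E i) (\<xi> i j)) * g x)"
      if i: "i \<in> I" for i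
      using normed_space_over.dual_scaled_ball[OF spaces[OF i] K xi[OF i, of j] order_refl] by metis
    then obtain g where g: "\<And>i. i \<in> I \<Longrightarrow> g i \<in> dual_ball K (E i)"
      "\<And>i. i \<in> I \<Longrightarrow> \<xi> i j = (\<lambda>x. complex_of_real (dual_norm (E i) (\<xi> i j)) * g i x)" by metis
    define \<phi> where "\<phi> = restrict g I"
    have phi: "\<phi> \<in> balls" unfolding \<phi>_def using g(1) by auto
    let ?d = "\<Prod>i\<in>I. dual_norm (E i) (\<xi> i j)"
    have pe: "prod_eval I (\<lambda>i. \<xi> i j) x = complex_of_real ?d * prod_eval I \<phi> x" for x
    proof -
      have "prod_eval I (\<lambda>i. \<xi> i j) x = (\<Prod>i\<in>I. complex_of_real (dual_norm (E i) (\<xi> i j)) * \<phi> i (x i))"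
        unfolding prod_eval_def \<phi>_def
        by (intro prod.cong refl) (use g(2) in \<open>metis restrict_apply'\<close>)
      then show ?thesis by (simp add: prod.distrib prod_eval_def)
    qed
    have "F j = complex_of_real ?d * (\<Sum>(c, x)\<leftarrow>l. c * prod_eval I \<phi> x)"
      unfolding F_def pe by (induction l) (auto simp: algebra_simps)
    moreover have "0 \<le> ?d"
      by (intro prod_nonneg) (use normed_space_over.dual_norm_nonneg[OF spaces xi] in auto)
    ultimately show ?thesis using B phi by (simp add: norm_mult mult_left_mono del: of_real_prod)
  qed
  have "cmod (suminf F) \<le> (\<Sum>j. (\<Prod>i\<in>I. dual_norm (E i) (\<xi> i j)) * B)"
    by (rule norm_suminf_le[OF Fle]) (rule summable_mult2[OF summ])
  also have "\<dots> = representation_sum E I \<xi> * B"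
    unfolding representation_sum_def by (rule suminf_mult2[OF summ, symmetric])
  finally show "cmod (\<Sum>(c, x)\<leftarrow>l. c * T x) \<le> representation_sum E I \<xi> * B"
    using sums_unique[OF Fs] by simp
qed

lemma representation_sum_nonneg:
  assumes "represents_nuclear K E I T \<xi>"
  shows "0 \<le> representation_sum E I \<xi>"
  unfolding representation_sum_def
  using assms normed_space_over.dual_norm_nonneg[OF spaces]
  by (intro suminf_nonneg prod_nonneg) (auto simp: represents_nuclear_def)

lemma nuclear_form_integral:
  assumes "T \<in> nuclear_forms K E I"
  shows "T \<in> integral_forms K E I" and "integral_norm K E I T \<le> nuclear_norm K E I T"
proof -
  let ?R = "{\<xi>. represents_nuclear K E I T \<xi>}"
  have T: "T \<in> multilinear_forms K E I" and ne: "?R \<noteq> {}" using assms unfolding nuclear_forms_def by auto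
  have *: "T \<in> integral_forms K E I \<and> integral_norm K E I T \<le> representation_sum E I \<xi>" if "\<xi> \<in> ?R" for \<xi>
    using dominated_integral_form[OF T representation_sum_nonneg represents_nuclear_dominated] that by blast
  then show "T \<in> integral_forms K E I" using ne by blast
  show "integral_norm K E I T \<le> nuclear_norm K E I T"
    unfolding nuclear_norm_def by (rule cINF_greatest[OF ne]) (use * in blast)
qed

lemma nuclear_norm_le:
  assumes "represents_nuclear K E I T \<xi>"
  shows "nuclear_norm K E I T \<le> representation_sum E I \<xi>"
  unfolding nuclear_norm_def
  by (rule cINF_lower) (use assms in \<open>auto intro!: bdd_belowI[of _ 0] representation_sum_nonneg\<close>)

end

section \<open>Extreme points\<close>

text \<open>The nonempty closed extreme subsets of the Krein-Milman argument; \<open>F\<close> need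
  not be convex.\<close>

definition face_of_set :: "('a \<Rightarrow> complex) set \<Rightarrow> ('a \<Rightarrow> complex) set \<Rightarrow> bool" where
  "face_of_set F B \<longleftrightarrow> F \<subseteq> B \<and> F \<noteq> {} \<and> closed F \<and>
     (\<forall>g\<in>B. \<forall>h\<in>B. \<forall>t. 0 < t \<and> t < 1 \<and> (\<lambda>x. of_real (1 - t) * g x + of_real t * h x) \<in> F \<longrightarrow> g \<in> F \<and> h \<in> F)"

lemma face_of_set_segment:
  assumes "face_of_set F B" "g \<in> B" "h \<in> B" "0 < t" "t < 1"
    "(\<lambda>x. of_real (1 - t) * g x + of_real t * h x) \<in> F"
  shows "g \<in> F \<and> h \<in> F"
  using assms unfolding face_of_set_def by blast

text \<open>A proper convex combination can only reach the maximum over \<open>F\<close> if both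
  endpoints, which lie in \<open>F\<close> because \<open>F\<close> is a face, reach it as
  well.\<close>

lemma face_of_set_maximizers:
  assumes B: "compact B" and F: "face_of_set F B"
  shows "face_of_set {f\<in>F. \<forall>g\<in>F. Re (c * g x) \<le> Re (c * f x)} B"
proof -
  let ?l = "\<lambda>f::'a \<Rightarrow> complex. Re (c * f x)"
  have FB: "F \<subseteq> B" "F \<noteq> {}" "closed F"
    using F unfolding face_of_set_def by simp_all
  have cont: "continuous_on UNIV ?l"
    by (intro continuous_intros continuous_on_product_coordinates)
  have "compact F" using compact_Int_closed[OF B FB(3)] FB(1) by (simp add: Int_absorb1)
  then obtain m where m: "m \<in> F" "\<And>g. g \<in> F \<Longrightarrow> ?l g \<le> ?l m"
    using continuous_attains_sup[of F ?l] FB(2) continuous_on_subset[OF cont] by auto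
  have eq: "{f\<in>F. \<forall>g\<in>F. ?l g \<le> ?l f} = F \<inter> {f. ?l m \<le> ?l f}"
    using m by (auto intro: order_trans)
  have "closed {f. ?l m \<le> ?l f}" by (intro closed_Collect_le cont continuous_on_const)
  then have cl: "closed (F \<inter> {f. ?l m \<le> ?l f})" using FB(3) by blast
  show ?thesis
    unfolding eq face_of_set_def
  proof (intro conjI ballI allI impI cl)
    show "F \<inter> {f. ?l m \<le> ?l f} \<subseteq> B" using FB by auto
    show "F \<inter> {f. ?l m \<le> ?l f} \<noteq> {}" using m by auto
    fix g h t
    assume gh: "g \<in> B" "h \<in> B"
      and t: "0 < t \<and> t < 1 \<and> (\<lambda>x. of_real (1 - t) * g x + of_real t * h x) \<in> F \<inter> {f. ?l m \<le> ?l f}"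
    have ghF: "g \<in> F" "h \<in> F" using face_of_set_segment[OF F gh] t by auto
    have "?l m \<le> Re (c * (of_real (1 - t) * g x + of_real t * h x))" using t by simp
    also have "\<dots> = (1 - t) * ?l g + t * ?l h" by (simp add: algebra_simps)
    finally have le: "?l m \<le> (1 - t) * ?l g + t * ?l h" .
    have "(1 - t) * ?l g \<le> (1 - t) * ?l m" "t * ?l h \<le> t * ?l m"
      using t m(2)[OF ghF(1)] m(2)[OF ghF(2)] by (auto intro: mult_left_mono)
    moreover have "(1 - t) * ?l m + t * ?l m = ?l m" by (simp only: left_diff_distrib)
    ultimately have "(1 - t) * ?l m \<le> (1 - t) * ?l g" "t * ?l m \<le> t * ?l h" using le by linarith+
    then have "?l m \<le> ?l g" "?l m \<le> ?l h" using t by (simp_all only: mult_le_cancel_left_pos diff_gt_0_iff_gt)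
    then show "g \<in> F \<inter> {f. ?l m \<le> ?l f}" "h \<in> F \<inter> {f. ?l m \<le> ?l f}" using ghF by auto
  qed
qed

text \<open>A minimal face is a single point, because the functionals \<open>Re (d * f x)\<close>
  separate points and each has a face of maximizers. Running Zorn's lemma below the face
  \<open>F0\<close> makes that point a maximizer of the given functional too.\<close>

lemma extreme_point_maximizer:
  assumes B: "compact B" "closed B" "B \<noteq> {}"
  obtains e where "e \<in> ext_points B" "\<And>f. f \<in> B \<Longrightarrow> Re (c * f y) \<le> Re (c * e y)"
proof -
  define F0 where "F0 = {f\<in>B. \<forall>g\<in>B. Re (c * g y) \<le> Re (c * f y)}"
  have "face_of_set B B" using B unfolding face_of_set_def by auto
  then have F0: "face_of_set F0 B" unfolding F0_def by (rule face_of_set_maximizers[OF B(1)])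
  define A where "A = {F. face_of_set F B \<and> F \<subseteq> F0}"
  have "\<exists>m\<in>A. \<forall>a\<in>A. a \<subseteq> m \<longrightarrow> a = m"
  proof (rule predicate_Zorn[where P="\<lambda>x y. y \<subseteq> x"])
    show "partial_order_on A (relation_of (\<lambda>x y. y \<subseteq> x) A)"
      by (auto simp: partial_order_on_def preorder_on_def refl_on_def trans_def antisym_def relation_of_def)
  next
    fix C assume C: "C \<in> Chains (relation_of (\<lambda>x y. y \<subseteq> x) A)"
    then have CA: "C \<subseteq> A" and ch: "\<And>a b. a \<in> C \<Longrightarrow> b \<in> C \<Longrightarrow> a \<subseteq> b \<or> b \<subseteq> a"
      unfolding Chains_def relation_of_def by auto
    show "\<exists>u\<in>A. \<forall>a\<in>C. u \<subseteq> a"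
    proof (cases "C = {}")
      case True
      then show ?thesis using F0 unfolding A_def by auto
    next
      case False
      have face: "face_of_set F B" "F \<subseteq> F0" if "F \<in> C" for F using that CA A_def by auto
      \<comment> \<open>A finite subchain contains its own intersection, which is nonempty;
        compactness passes this on to the whole chain.\<close>
      have "B \<inter> \<Inter>C \<noteq> {}"
      proof (rule compact_imp_fip[OF B(1)])
        show "closed F" if "F \<in> C" for F using face(1)[OF that] unfolding face_of_set_def by auto
        fix C' assume C': "finite C'" "C' \<subseteq> C"
        show "B \<inter> \<Inter>C' \<noteq> {}"
        proof (cases "C' = {}")
          case False
          have "subset.chain C C'" using C' ch by (auto simp: subset_chain_def)
          then have "\<Inter>C' \<in> C'" by (rule Inter_in_chain[OF C'(1) False])
          then have "face_of_set (\<Inter>C') B" using face(1) C'(2) by blast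
          then have "\<Inter>C' \<subseteq> B" "\<Inter>C' \<noteq> {}" unfolding face_of_set_def by simp_all
          then show ?thesis by (simp add: Int_absorb1)
        qed (use B in auto)
      qed
      then have ne: "\<Inter>C \<noteq> {}" by auto
      have "face_of_set (\<Inter>C) B"
        unfolding face_of_set_def
      proof (intro conjI ballI allI impI ne)
        obtain F where "F \<in> C" using False by blast
        moreover have "F \<subseteq> B" using face(1)[OF \<open>F \<in> C\<close>] unfolding face_of_set_def by simp
        ultimately show "\<Inter>C \<subseteq> B" by blast
        show "closed (\<Inter>C)" using face(1) unfolding face_of_set_def by (intro closed_Inter) auto
        fix g h t
        assume gh: "g \<in> B" "h \<in> B"
          and t: "0 < t \<and> t < 1 \<and> (\<lambda>x. of_real (1 - t) * g x + of_real t * h x) \<in> \<Inter>C"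
        have "g \<in> F \<and> h \<in> F" if "F \<in> C" for F
          by (rule face_of_set_segment[OF face(1)[OF that] gh]) (use t that in auto)
        then show "g \<in> \<Inter>C" "h \<in> \<Inter>C" by auto
      qed
      moreover have "\<Inter>C \<subseteq> F0" using False face(2) by blast
      ultimately show ?thesis unfolding A_def by (intro bexI[of _ "\<Inter>C"]) auto
    qed
  qed
  then obtain F where F: "face_of_set F B" "F \<subseteq> F0"
    and min: "\<And>G. face_of_set G B \<Longrightarrow> G \<subseteq> F \<Longrightarrow> G = F" unfolding A_def by auto
  then obtain e where e: "e \<in> F" unfolding face_of_set_def by auto
  \<comment> \<open>By minimality \<open>F\<close> equals its own set of maximizers in every
    coordinate direction, so each such functional is constant on \<open>F\<close>.\<close>
  have Re_eq: "Re (d * f x) = Re (d * e x)" if f: "f \<in> F" for f d x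
  proof -
    have "{f\<in>F. \<forall>g\<in>F. Re (d * g x) \<le> Re (d * f x)} = F"
      by (rule min[OF face_of_set_maximizers[OF B(1) F(1)]]) auto
    then have "f \<in> {f\<in>F. \<forall>g\<in>F. Re (d * g x) \<le> Re (d * f x)}"
      "e \<in> {f\<in>F. \<forall>g\<in>F. Re (d * g x) \<le> Re (d * f x)}" using f e by auto
    then show ?thesis using f e by (intro antisym) auto
  qed
  have single: "f = e" if f: "f \<in> F" for f
  proof
    fix x
    show "f x = e x" using Re_eq[OF f, of 1 x] Re_eq[OF f, of "-\<i>" x] by (simp add: complex_eq_iff)
  qed
  have "e \<in> ext_points B"
    unfolding ext_points_def
  proof (intro CollectI conjI notI)
    show "e \<in> B" using e F unfolding face_of_set_def by auto
    assume "\<exists>g\<in>B. \<exists>h\<in>B. g \<noteq> h \<and> (\<exists>t::real. 0 < t \<and> t < 1 \<and>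
      e = (\<lambda>x. of_real (1 - t) * g x + of_real t * h x))"
    then obtain g h t where gh: "g \<in> B" "h \<in> B" "g \<noteq> h" "0 < t" "t < 1"
      "e = (\<lambda>x. of_real (1 - t) * g x + of_real t * h x)" by blast
    then have "g \<in> F \<and> h \<in> F" using e by (intro face_of_set_segment[OF F(1)]) auto
    then show False using single gh(3) by metis
  qed
  moreover have "Re (c * f y) \<le> Re (c * e y)" if "f \<in> B" for f
    using e F(2) that unfolding F0_def by auto
  ultimately show ?thesis by (rule that)
qed

context normed_space_over
begin

lemma closed_dual_ball: "K = \<real> \<or> K = UNIV \<Longrightarrow> closed (dual_ball K X)"
  using compactin_imp_closedin[OF Hausdorff_euclidean_functions, of "dual_ball K X"] compact_dual_ball
  by simp

text \<open>With the phase \<open>u\<close> that makes \<open>u * f y\<close> real and nonnegative,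
  an extreme point maximizing the real part of \<open>u * e y\<close> over the ball does at least as
  well.\<close>

lemma ext_point_norming:
  assumes K: "K = \<real> \<or> K = UNIV" and f: "f \<in> dual_ball K X"
  obtains e where "e \<in> ext_points (dual_ball K X)" "cmod (f y) \<le> cmod (e y)"
proof -
  obtain u where u: "cmod u = 1" "u * f y = complex_of_real (cmod (f y))"
    by (rule unimodular_multiplier[of "f y"]) auto
  obtain e where e: "e \<in> ext_points (dual_ball K X)" "\<And>f. f \<in> dual_ball K X \<Longrightarrow> Re (u * f y) \<le> Re (u * e y)"
    using extreme_point_maximizer[OF compact_dual_ball[OF K] closed_dual_ball[OF K], of u y] f by blast
  have "cmod (f y) = Re (u * f y)" unfolding u(2) by simp
  also have "\<dots> \<le> Re (u * e y)" by (rule e(2)[OF f])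
  also have "\<dots> \<le> cmod (u * e y)" by (rule complex_Re_le_cmod)
  also have "\<dots> = cmod (e y)" using u(1) by (simp add: norm_mult)
  finally show ?thesis using that e(1) by blast
qed

text \<open>A combination of evaluations is evaluation at the vector with the same coefficients. A
  whole formal combination can thus be normed by one extreme point.\<close>

lemma dual_combination_eval:
  assumes "set l \<subseteq> K \<times> carrier X"
  obtains y where "y \<in> carrier X" "\<And>f. f \<in> dual K X \<Longrightarrow> f y = (\<Sum>(c, x)\<leftarrow>l. c * f x)"
  using assms
proof (induction l arbitrary: thesis)
  case Nil
  then show ?case using dual_zero M.zero_closed by force
next
  case (Cons a l)
  obtain c x where a: "a = (c, x)" "c \<in> K" "x \<in> carrier X" using Cons.prems(2) by auto
  obtain y where y: "y \<in> carrier X" "\<And>f. f \<in> dual K X \<Longrightarrow> f y = (\<Sum>(c, x)\<leftarrow>l. c * f x)"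
    using Cons by auto
  have cx: "c \<odot>\<^bsub>X\<^esub> x \<in> carrier X" using smult_closed[of c x] a by simp
  show ?case
  proof (rule Cons.prems(1))
    show "(c \<odot>\<^bsub>X\<^esub> x) \<oplus> y \<in> carrier X" using cx y(1) by simp
    fix f assume f: "f \<in> dual K X"
    have "f ((c \<odot>\<^bsub>X\<^esub> x) \<oplus> y) = f (c \<odot>\<^bsub>X\<^esub> x) + f y" "f (c \<odot>\<^bsub>X\<^esub> x) = c * f x"
      using f cx y(1) a unfolding dual_def by blast+
    then show "f ((c \<odot>\<^bsub>X\<^esub> x) \<oplus> y) = (\<Sum>(c, x)\<leftarrow>a # l. c * f x)" using y(2)[OF f] a(1) by simp
  qed
qed

end

section \<open>Splitting off the II-polyhedral factor\<close>

lemma bounded_of_bool [simp]: "bounded ((\<lambda>q. of_bool (R q) :: 'c::real_normed_algebra_1) ` A)"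
  unfolding bounded_iff by (auto intro!: exI[of _ 1])

lemma prod_eval_cong:
  "(\<And>i. i \<in> I \<Longrightarrow> \<phi> i = \<psi> i) \<Longrightarrow> (\<And>i. i \<in> I \<Longrightarrow> x i = y i) \<Longrightarrow> prod_eval I \<phi> x = prod_eval I \<psi> y"
  unfolding prod_eval_def by (intro prod.cong) auto

lemma prod_eval_split: "prod_eval {0..N} \<phi> x = \<phi> 0 (x 0) * prod_eval {1..N} \<phi> x"
  unfolding prod_eval_def by (subst prod.atLeast_Suc_atMost) auto

lemma prod_eval_fun_upd:
  assumes "finite I" "i \<in> I"
  shows "prod_eval I \<phi> (x(i := u)) = \<phi> i u * prod_eval (I - {i}) \<phi> x"
proof -
  have "(\<Prod>j\<in>I - {i}. \<phi> j ((x(i := u)) j)) = (\<Prod>j\<in>I - {i}. \<phi> j (x j))" by (intro prod.cong) auto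
  then show ?thesis unfolding prod_eval_def using assms by (simp add: prod.remove)
qed

locale product_with_factor =
  fixes K :: "complex set" and N :: nat and X :: "nat \<Rightarrow> 'a nspace"
  assumes K: "K = \<real> \<or> K = UNIV" and spaces: "\<And>i. i \<le> N \<Longrightarrow> normed_space_over K (X i)"
begin

sublocale X0: normed_space_over K "X 0" by (rule spaces) simp
sublocale F0: nspace_family K X "{0..N}"
proof (rule nspace_family.intro)
  show "K = \<real> \<or> K = UNIV" by (rule K)
  show "normed_space_over K (X i)" if "i \<in> {0..N}" for i by (rule spaces) (use that in simp)
qed simp
sublocale F1: nspace_family K X "{1..N}"
proof (rule nspace_family.intro)
  show "K = \<real> \<or> K = UNIV" by (rule K)
  show "normed_space_over K (X i)" if "i \<in> {1..N}" for i by (rule spaces) (use that in simp)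
qed simp

abbreviation "Ext \<equiv> ext_points (dual_ball K (X 0))"

lemma Ext_subset: "e \<in> Ext \<Longrightarrow> e \<in> dual_ball K (X 0)"
  by (simp add: ext_points_def)

lemma dual_ball_subset_dual: "f \<in> dual_ball K (X 0) \<Longrightarrow> f \<in> dual K (X 0)"
  by (simp add: dual_ball_def)

lemma balls_join:
  assumes "f \<in> dual_ball K (X 0)" "p \<in> F1.balls"
  shows "p(0 := f) \<in> F0.balls" and "prod_eval {0..N} (p(0 := f)) x = f (x 0) * prod_eval {1..N} p x"
proof -
  show "p(0 := f) \<in> F0.balls" using assms by (auto simp: PiE_iff extensional_def)
  have "prod_eval {1..N} (p(0 := f)) x = prod_eval {1..N} p x" by (rule prod_eval_cong) auto
  then show "prod_eval {0..N} (p(0 := f)) x = f (x 0) * prod_eval {1..N} p x"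
    unfolding prod_eval_split by simp
qed

lemma points_restrict:
  assumes "x \<in> F0.points"
  shows "x 0 \<in> carrier (X 0)" and "restrict x {1..N} \<in> F1.points"
    and "prod_eval {1..N} p (restrict x {1..N}) = prod_eval {1..N} p x"
proof -
  show "x 0 \<in> carrier (X 0)" "restrict x {1..N} \<in> F1.points" using assms by (auto simp: PiE_iff)
  show "prod_eval {1..N} p (restrict x {1..N}) = prod_eval {1..N} p x" by (rule prod_eval_cong) auto
qed

text \<open>With the functionals of the factors 1 to \<open>N\<close> held fixed, the combination of
  tensors is the evaluation of \<open>\<phi> 0\<close> at one vector of \<open>X 0\<close>.
  Replacing \<open>\<phi> 0\<close> by an extreme point that norms this vector does not decrease the
  modulus.\<close>

lemma dominated_on_extreme_points:
  assumes dom: "F0.tensor_dominated T C"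
  shows "dominated K (Ext \<times> F1.balls) (\<lambda>y x. fst y (x 0) * prod_eval {1..N} (snd y) x) F0.points T C"
  unfolding dominated_def
proof (intro allI impI)
  fix l M assume l: "set l \<subseteq> K \<times> F0.points"
    and M: "\<forall>y\<in>Ext \<times> F1.balls. cmod (\<Sum>(c, x)\<leftarrow>l. c * (fst y (x 0) * prod_eval {1..N} (snd y) x)) \<le> M"
  show "cmod (\<Sum>(c, x)\<leftarrow>l. c * T x) \<le> C * M"
  proof (rule dominatedD[OF dom l])
    fix \<phi> assume phi: "\<phi> \<in> F0.balls"
    define p where "p = restrict \<phi> {1..N}"
    have p: "p \<in> F1.balls" using phi unfolding p_def by (auto simp: PiE_iff)
    have pe: "prod_eval {1..N} \<phi> x = prod_eval {1..N} p x" for x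
      unfolding p_def by (rule prod_eval_cong) auto
    have f: "\<phi> 0 \<in> dual_ball K (X 0)" using phi by (auto simp: PiE_iff)
    define l' where "l' = map (\<lambda>(c, x). (c * prod_eval {1..N} p x, x 0)) l"
    have l': "set l' \<subseteq> K \<times> carrier (X 0)"
    proof -
      have "c * prod_eval {1..N} p x \<in> K \<and> x 0 \<in> carrier (X 0)" if "(c, x) \<in> set l" for c x
        using F1.prod_eval_in_K[OF p points_restrict(2), of x] points_restrict(1,3)[of x] that l K by auto
      then show ?thesis unfolding l'_def by auto
    qed
    obtain y where y: "\<And>f. f \<in> dual K (X 0) \<Longrightarrow> f y = (\<Sum>(c, x)\<leftarrow>l'. c * f x)"
      using X0.dual_combination_eval[OF l'] by blast
    have sum: "g y = (\<Sum>(c, x)\<leftarrow>l. c * (g (x 0) * prod_eval {1..N} p x))" if "g \<in> dual_ball K (X 0)" for g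
    proof -
      have "(\<Sum>(c, x)\<leftarrow>l'. c * g x) = (\<Sum>(c, x)\<leftarrow>l. c * (g (x 0) * prod_eval {1..N} p x))"
        unfolding l'_def by (induction l) (auto simp: algebra_simps)
      then show ?thesis using y dual_ball_subset_dual[OF that] by simp
    qed
    obtain e where e: "e \<in> Ext" "cmod (\<phi> 0 y) \<le> cmod (e y)"
      using X0.ext_point_norming[OF K f] by blast
    have "(\<Sum>(c, x)\<leftarrow>l. c * prod_eval {0..N} \<phi> x) = \<phi> 0 y"
      unfolding sum[OF f] prod_eval_split pe ..
    moreover have "cmod (e y) \<le> M"
      unfolding sum[OF Ext_subset[OF e(1)]] using M e(1) p by force
    ultimately show "cmod (\<Sum>(c, x)\<leftarrow>l. c * prod_eval {0..N} \<phi> x) \<le> M" using e(2) by simp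
  qed
qed

text \<open>If infinitely many extreme points violated the bound, weak-star compactness would give
  them a cluster point \<open>f\<close>, of norm at most \<open>r\<close>. The value at
  \<open>f\<close> is at most \<open>r * M\<close> for every \<open>p\<close>. Weak-star closeness
  to \<open>f\<close> on the finitely many vectors of \<open>l\<close> keeps the values of a nearby
  extreme point within \<open>d\<close>, uniformly in \<open>p\<close>, although \<open>p\<close> is
  chosen only after that point.\<close>

lemma extreme_points_eventually_small:
  assumes poly: "weak_star K (X 0) derived_set_of Ext \<subseteq> {f \<in> dual K (X 0). dual_norm (X 0) f \<le> r}"
    and r: "0 \<le> r" and l: "set l \<subseteq> K \<times> F0.points"
    and M: "\<And>\<phi>. \<phi> \<in> F0.balls \<Longrightarrow> cmod (\<Sum>(c, x)\<leftarrow>l. c * prod_eval {0..N} \<phi> x) \<le> M"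
    and d: "0 < d"
  obtains A where "finite A" "A \<subseteq> Ext" "\<And>e p. e \<in> Ext - A \<Longrightarrow> p \<in> F1.balls \<Longrightarrow>
    cmod (\<Sum>(c, x)\<leftarrow>l. c * (e (x 0) * prod_eval {1..N} p x)) \<le> r * M + d"
proof -
  define h where "h e p = (\<Sum>(c, x)\<leftarrow>l. c * (e (x 0) * prod_eval {1..N} p x))" for e :: "'a \<Rightarrow> complex" and p
  define A where "A = {e \<in> Ext. \<exists>p\<in>F1.balls. r * M + d < cmod (h e p)}"
  have hM: "cmod (h f p) \<le> M" if "f \<in> dual_ball K (X 0)" "p \<in> F1.balls" for f p
    using M[OF balls_join(1)[OF that]] unfolding h_def balls_join(2)[OF that] .
  have "finite A"
  proof (rule ccontr)
    assume inf: "infinite A"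
    have "compactin (weak_star K (X 0)) (dual_ball K (X 0))"
      unfolding weak_star_def euclidean_product_topology compactin_subtopology
      using X0.compact_dual_ball[OF K] dual_ball_subset_dual by auto
    moreover have "A \<subseteq> dual_ball K (X 0)" unfolding A_def using Ext_subset by auto
    ultimately have "dual_ball K (X 0) \<inter> weak_star K (X 0) derived_set_of A \<noteq> {}"
      using inf compactin_imp_Bolzano_Weierstrass by blast
    then obtain f where f: "f \<in> weak_star K (X 0) derived_set_of A" by blast
    have "A \<subseteq> Ext" unfolding A_def by auto
    then have "f \<in> weak_star K (X 0) derived_set_of Ext" using f derived_set_of_mono by blast
    then have fd: "f \<in> dual K (X 0)" "dual_norm (X 0) f \<le> r" using poly by auto
    obtain g where g: "g \<in> dual_ball K (X 0)" "f = (\<lambda>x. complex_of_real r * g x)"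
      by (rule X0.dual_scaled_ball[OF K fd])
    have hf: "cmod (h f p) \<le> r * M" if p: "p \<in> F1.balls" for p
    proof -
      have "h f p = complex_of_real r * h g p"
        unfolding h_def g(2) by (induction l) (auto simp: algebra_simps)
      then show ?thesis using hM[OF g(1) p] r by (simp add: norm_mult mult_left_mono)
    qed
    \<comment> \<open>\<open>G\<close> bounds the sensitivity to changes of the first functional,
      uniformly in \<open>p\<close>. The radius \<open>s = d / (G + 1)\<close> then makes the
      deviation \<open>s * G\<close> at most \<open>d\<close>, also when
      \<open>G = 0\<close>.\<close>
    define G where "G = (\<Sum>(c, x)\<leftarrow>l. cmod c * (\<Prod>i\<in>{1..N}. nrm (X i) (x i)))"
    have Gn: "0 \<le> cmod c * (\<Prod>i\<in>{1..N}. nrm (X i) (x i))" if "(c, x) \<in> set l" for c x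
      using that l by (intro mult_nonneg_nonneg prod_nonneg)
        (auto intro!: normed_space_over.nrm_nonneg[OF spaces] simp: PiE_iff subset_iff)
    have G0: "0 \<le> G" unfolding G_def using Gn by (intro sum_list_nonneg) auto
    define s where "s = d / (G + 1)"
    have s: "0 < s" using d G0 by (simp add: s_def)
    \<comment> \<open>Only the vectors occurring in \<open>l\<close> are tested, finitely many, so
      \<open>U\<close> is open for pointwise convergence.\<close>
    define U where "U = {e::'a \<Rightarrow> complex. \<forall>x\<in>snd ` set l. cmod (e (x 0) - f (x 0)) < s}"
    have "open {e::'a \<Rightarrow> complex. cmod (e y - f y) < s}" for y
      by (intro open_Collect_less continuous_intros continuous_on_product_coordinates)
    then have "open (\<Inter>x\<in>snd ` set l. {e::'a \<Rightarrow> complex. cmod (e (x 0) - f (x 0)) < s})"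
      by (intro open_INT) auto
    moreover have "(\<Inter>x\<in>snd ` set l. {e::'a \<Rightarrow> complex. cmod (e (x 0) - f (x 0)) < s}) = U"
      unfolding U_def by auto
    ultimately have "open U" by simp
    then have "openin (weak_star K (X 0)) (dual K (X 0) \<inter> U)"
      unfolding weak_star_def euclidean_product_topology by (auto simp: openin_open)
    moreover have "f \<in> dual K (X 0) \<inter> U" using fd(1) s unfolding U_def by auto
    ultimately obtain e where e: "e \<in> A" "e \<in> U"
      using f unfolding in_derived_set_of by blast
    then obtain p where p: "p \<in> F1.balls" "r * M + d < cmod (h e p)" unfolding A_def by auto
    have "cmod (h e p - h f p) \<le> s * G"
      using l e(2) Gn unfolding h_def G_def U_def
    proof (induction l)
      case (Cons a l)
      obtain c x where a: "a = (c, x)" "x \<in> F0.points" using Cons.prems(1) by auto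
      let ?S = "\<lambda>e. \<Sum>(c, x)\<leftarrow>l. c * (e (x 0) * prod_eval {1..N} p x)"
      let ?n = "\<Prod>i\<in>{1..N}. nrm (X i) (x i)"
      have IH: "cmod (?S e - ?S f) \<le> s * (\<Sum>(c, x)\<leftarrow>l. cmod c * (\<Prod>i\<in>{1..N}. nrm (X i) (x i)))"
        by (rule Cons.IH) (use Cons.prems in auto)
      have pn: "cmod (prod_eval {1..N} p x) \<le> ?n"
        using F1.cmod_prod_eval_le[OF p(1) points_restrict(2)[OF a(2)]] points_restrict(3)[OF a(2), of p] by simp
      have "cmod (e (x 0) - f (x 0)) \<le> s" using Cons.prems(2) a(1) by auto
      then have h1: "cmod (c * ((e (x 0) - f (x 0)) * prod_eval {1..N} p x)) \<le> cmod c * (s * ?n)"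
        unfolding norm_mult using pn s by (intro mult_left_mono mult_mono) auto
      have eq: "c * (e (x 0) * prod_eval {1..N} p x) + ?S e - (c * (f (x 0) * prod_eval {1..N} p x) + ?S f)
        = c * ((e (x 0) - f (x 0)) * prod_eval {1..N} p x) + (?S e - ?S f)" by (simp add: algebra_simps)
      have "cmod (c * (e (x 0) * prod_eval {1..N} p x) + ?S e - (c * (f (x 0) * prod_eval {1..N} p x) + ?S f))
        \<le> cmod c * (s * ?n) + s * (\<Sum>(c, x)\<leftarrow>l. cmod c * (\<Prod>i\<in>{1..N}. nrm (X i) (x i)))"
        unfolding eq by (rule norm_triangle_le[OF add_mono[OF h1 IH]])
      then show ?case using a(1) by (simp add: algebra_simps)
    qed simp
    also have "s * G \<le> d" using d G0 by (simp add: s_def field_simps)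
    finally have "cmod (h e p) \<le> r * M + d"
      using hf[OF p(1)] norm_triangle_sub[of "h e p" "h f p"] by linarith
    then show False using p(2) by simp
  qed
  then show ?thesis
  proof (rule that)
    show "A \<subseteq> Ext" unfolding A_def by auto
    show "cmod (\<Sum>(c, x)\<leftarrow>l. c * (e (x 0) * prod_eval {1..N} p x)) \<le> r * M + d"
      if "e \<in> Ext - A" "p \<in> F1.balls" for e p
      using that unfolding A_def h_def by (auto simp: not_less)
  qed
qed

end

text \<open>The setting is that of \<open>positive_functional_representation\<close> with pairs of
  an extreme point and a tuple of functionals as parameters; \<open>L\<close> is now split along its
  extreme-point coordinate.\<close>

locale disintegrated_form = product_with_factor K N X
  for K :: "complex set" and N :: nat and X :: "nat \<Rightarrow> 'a nspace" +
  fixes T :: "(nat \<Rightarrow> 'a) \<Rightarrow> complex"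
    and L :: "(complex \<times> ('a \<Rightarrow> complex) \<times> (nat \<Rightarrow> 'a \<Rightarrow> complex) \<Rightarrow> real) \<Rightarrow> real"
  assumes L: "positive_functional (unit_scalars K \<times> ext_points (dual_ball K (X 0)) \<times> (\<Pi>\<^sub>E i\<in>{1..N}. dual_ball K (X i))) L"
    and rep: "\<And>x. x \<in> (\<Pi>\<^sub>E i\<in>{0..N}. carrier (X i)) \<Longrightarrow>
      T x = positive_functional.clift L (\<lambda>q. fst q * (fst (snd q) (x 0) * prod_eval {1..N} (snd (snd q)) x))"
begin

abbreviation "Q \<equiv> unit_scalars K \<times> Ext \<times> F1.balls"

sublocale positive_functional Q L by (rule L)

text \<open>The mass and the form obtained by restricting \<open>L\<close> to the fibre over the extreme point \<open>e\<close>.\<close>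

definition weight :: "('a \<Rightarrow> complex) \<Rightarrow> real" where
  "weight e = L (\<lambda>q. of_bool (fst (snd q) = e))"

definition slice :: "('a \<Rightarrow> complex) \<Rightarrow> (nat \<Rightarrow> 'a) \<Rightarrow> complex" where
  "slice e x = (if x \<in> F1.points
     then clift (\<lambda>q. of_bool (fst (snd q) = e) * (fst q * prod_eval {1..N} (snd (snd q)) x)) else 0)"

lemma unit_scalar_Q: "q \<in> Q \<Longrightarrow> cmod (fst q) = 1"
  by (auto simp: unit_scalars_def)

lemma bounded_tensor:
  assumes "x \<in> F1.points"
  shows "bounded ((\<lambda>q. fst q * prod_eval {1..N} (snd (snd q)) x) ` Q)"
  unfolding bounded_iff
proof (intro exI ballI)
  fix z assume "z \<in> (\<lambda>q. fst q * prod_eval {1..N} (snd (snd q)) x) ` Q"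
  then obtain q where q: "q \<in> Q" "z = fst q * prod_eval {1..N} (snd (snd q)) x" by blast
  then have "snd (snd q) \<in> F1.balls" by auto
  then show "norm z \<le> (\<Prod>i\<in>{1..N}. nrm (X i) (x i))"
    using F1.cmod_prod_eval_le[OF _ assms] unit_scalar_Q[OF q(1)] q(2) by (simp add: norm_mult)
qed

lemma cmod_ext_le: "q \<in> Q \<Longrightarrow> y \<in> carrier (X 0) \<Longrightarrow> cmod (fst (snd q) y) \<le> nrm (X 0) y"
  using X0.dual_ball_iff[OF K, of "fst (snd q)"] Ext_subset by auto

lemma bounded_full_tensor:
  assumes x: "x \<in> F0.points"
  shows "bounded ((\<lambda>q. fst q * (fst (snd q) (x 0) * prod_eval {1..N} (snd (snd q)) x)) ` Q)"
proof -
  have "bounded ((\<lambda>q. fst (snd q) (x 0)) ` Q)"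
  proof (rule boundedI)
    fix z assume "z \<in> (\<lambda>q. fst (snd q) (x 0)) ` Q"
    then obtain q where "q \<in> Q" "z = fst (snd q) (x 0)" by blast
    then show "norm z \<le> nrm (X 0) (x 0)" using cmod_ext_le[of q "x 0"] points_restrict(1)[OF x] by simp
  qed
  from bounded_mult_image[OF this bounded_tensor[OF points_restrict(2)[OF x]]]
  show ?thesis unfolding points_restrict(3)[OF x] by (simp add: mult.left_commute)
qed

lemma weight_nonneg: "0 \<le> weight e"
  unfolding weight_def by (rule L_nonneg) auto

lemma sum_weight:
  assumes "finite A"
  shows "(\<Sum>e\<in>A. weight e) = L (\<lambda>q. of_bool (fst (snd q) \<in> A))"
proof -
  have "(\<Sum>e\<in>A. weight e) = L (\<lambda>q. \<Sum>e\<in>A. of_bool (fst (snd q) = e))"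
    unfolding weight_def by (rule L_sum[symmetric]) simp
  also have "(\<lambda>q. \<Sum>e\<in>A. of_bool (fst (snd q) = e)) = (\<lambda>q. of_bool (fst (snd q) \<in> A) :: real)"
    by (rule ext) (simp add: assms of_bool_def)
  finally show ?thesis .
qed

lemma weight_complement:
  assumes "finite A"
  shows "L (\<lambda>q. of_bool (fst (snd q) \<notin> A)) = L (\<lambda>_. 1) - (\<Sum>e\<in>A. weight e)"
proof -
  have "L (\<lambda>q. of_bool (fst (snd q) \<notin> A)) = L (\<lambda>q. 1 - of_bool (fst (snd q) \<in> A))"
    by (simp add: of_bool_not_iff)
  also have "\<dots> = L (\<lambda>_. 1) - L (\<lambda>q. of_bool (fst (snd q) \<in> A))" by (rule L_diff) auto
  finally show ?thesis unfolding sum_weight[OF assms] .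
qed

lemma sum_weight_le:
  assumes "finite A"
  shows "(\<Sum>e\<in>A. weight e) \<le> L (\<lambda>_. 1)"
proof -
  have "0 \<le> L (\<lambda>q. of_bool (fst (snd q) \<notin> A))" by (rule L_nonneg) auto
  then show ?thesis using weight_complement[OF assms] by simp
qed

lemma bounded_sliced_tensor:
  assumes "x \<in> F1.points"
  shows "bounded ((\<lambda>q. of_bool (R q) * (fst q * prod_eval {1..N} (snd (snd q)) x)) ` Q)"
  by (rule bounded_mult_image[OF bounded_of_bool bounded_tensor[OF assms]])

text \<open>The integrand of the combined slices has modulus at most \<open>M\<close> on the fibre
  over \<open>e\<close> and vanishes off it, and that fibre has mass
  \<open>weight e\<close>.\<close>

lemma slice_dominated: "F1.tensor_dominated (slice e) (weight e)"
  unfolding dominated_def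
proof (intro allI impI)
  fix l M assume l: "set l \<subseteq> K \<times> F1.points"
    and M: "\<forall>p\<in>F1.balls. cmod (\<Sum>(c, x)\<leftarrow>l. c * prod_eval {1..N} p x) \<le> M"
  let ?f = "\<lambda>a q. fst a * (of_bool (fst (snd q) = e) * (fst q * prod_eval {1..N} (snd (snd q)) (snd a)))"
  have bf: "bounded (?f a ` Q)" if "a \<in> set l" for a
    using subsetD[OF l that]
    by (intro bounded_mult_image[OF bounded_const_image] bounded_sliced_tensor) (simp only: mem_Times_iff)
  have "(\<Sum>(c, x)\<leftarrow>l. c * slice e x) = (\<Sum>a\<leftarrow>l. clift (?f a))"
  proof (rule arg_cong[of _ _ sum_list], rule map_cong[OF refl])
    fix a assume a: "a \<in> set l"
    have x: "snd a \<in> F1.points" using subsetD[OF l a] by (simp only: mem_Times_iff)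
    show "(case a of (c, x) \<Rightarrow> c * slice e x) = clift (?f a)"
      using clift_scale[OF bounded_sliced_tensor[OF x], of "fst a" "\<lambda>q. fst (snd q) = e"] x
      by (simp add: slice_def case_prod_unfold)
  qed
  also have "\<dots> = clift (\<lambda>q. \<Sum>a\<leftarrow>l. ?f a q)"
    by (rule conjunct1[OF clift_sum_list[of l ?f, OF bf], symmetric])
  finally have eq: "(\<Sum>(c, x)\<leftarrow>l. c * slice e x) = clift (\<lambda>q. \<Sum>a\<leftarrow>l. ?f a q)" .
  have "cmod (clift (\<lambda>q. \<Sum>a\<leftarrow>l. ?f a q)) \<le> L (\<lambda>q. M * of_bool (fst (snd q) = e))"
  proof (rule cmod_clift_le)
    show "bounded ((\<lambda>q. M * of_bool (fst (snd q) = e)) ` Q)"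
      by (intro bounded_mult_image bounded_const_image bounded_of_bool)
    fix q assume q: "q \<in> Q"
    have "(\<Sum>a\<leftarrow>l. ?f a q) = of_bool (fst (snd q) = e) * (fst q * (\<Sum>(c, x)\<leftarrow>l. c * prod_eval {1..N} (snd (snd q)) x))"
      by (induction l) (auto simp: algebra_simps)
    moreover have "snd (snd q) \<in> F1.balls" using q by auto
    ultimately show "cmod (\<Sum>a\<leftarrow>l. ?f a q) \<le> M * of_bool (fst (snd q) = e)"
      using M unit_scalar_Q[OF q] by (auto simp: norm_mult)
  qed
  also have "\<dots> = weight e * M" unfolding weight_def by (subst L_scale) auto
  finally show "cmod (\<Sum>(c, x)\<leftarrow>l. c * slice e x) \<le> weight e * M" unfolding eq .
qed

text \<open>Additivity and homogeneity hold pointwise under \<open>clift\<close>, because one factor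
  of the product is a linear functional of the changed argument.\<close>

lemma slice_multilinear: "slice e \<in> multilinear_forms K X {1..N}"
  unfolding multilinear_forms_def
proof (intro CollectI conjI ballI allI impI)
  have ball: "p i \<in> dual K (X i)" if "p \<in> F1.balls" "i \<in> {1..N}" for p i
    using that by (auto simp: PiE_iff dual_ball_def)
  have upd: "x(i := u) \<in> F1.points" if "x \<in> F1.points" "i \<in> {1..N}" "u \<in> carrier (X i)" for x i u
    using that by (auto simp: PiE_iff extensional_def)
  fix x
  show "slice e x = 0" if "x \<notin> F1.points" using that by (simp add: slice_def)
  assume x: "x \<in> F1.points"
  show "slice e x \<in> K"
  proof (cases "K = UNIV")
    case False
    then have K: "K = \<real>" using K by simp
    have "L (\<lambda>q. 0) = L (\<lambda>q. Im (of_bool (fst (snd q) = e) * (fst q * prod_eval {1..N} (snd (snd q)) x)))"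
    proof (rule L_cong)
      fix q assume q: "q \<in> Q"
      then have "fst q \<in> \<real>" "prod_eval {1..N} (snd (snd q)) x \<in> \<real>"
        using F1.prod_eval_in_K[OF _ x, of "snd (snd q)"] K by (auto simp: unit_scalars_def)
      then show "0 = Im (of_bool (fst (snd q) = e) * (fst q * prod_eval {1..N} (snd (snd q)) x))"
        by (simp add: complex_is_Real_iff)
    qed simp
    then show ?thesis using x L_zero unfolding K by (simp add: slice_def clift_def complex_is_Real_iff)
  qed simp
  fix i assume i: "i \<in> {1..N}"
  interpret Xi: normed_space_over K "X i" by (rule F1.spaces[OF i])
  fix u assume u: "u \<in> carrier (X i)"
  show "slice e (x(i := u \<oplus>\<^bsub>X i\<^esub> v)) = slice e (x(i := u)) + slice e (x(i := v))"
    if v: "v \<in> carrier (X i)" for v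
  proof -
    have uv: "u \<oplus>\<^bsub>X i\<^esub> v \<in> carrier (X i)" using u v by simp
    let ?g = "\<lambda>w q. of_bool (fst (snd q) = e) * (fst q * prod_eval {1..N} (snd (snd q)) (x(i := w)))"
    have "clift (?g (u \<oplus>\<^bsub>X i\<^esub> v)) = clift (\<lambda>q. ?g u q + ?g v q)"
    proof (rule clift_cong[OF bounded_sliced_tensor[OF upd[OF x i uv]]])
      fix q assume "q \<in> Q"
      then have "snd (snd q) i \<in> dual K (X i)" using ball i by auto
      then have "snd (snd q) i (u \<oplus>\<^bsub>X i\<^esub> v) = snd (snd q) i u + snd (snd q) i v"
        using u v unfolding dual_def by blast
      then show "?g (u \<oplus>\<^bsub>X i\<^esub> v) q = ?g u q + ?g v q"
        using i by (simp add: prod_eval_fun_upd algebra_simps)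
    qed
    also have "\<dots> = clift (?g u) + clift (?g v)"
      by (rule clift_add) (rule bounded_sliced_tensor[OF upd[OF x i u]] bounded_sliced_tensor[OF upd[OF x i v]])+
    finally show ?thesis using upd[OF x i] u v uv by (simp add: slice_def)
  qed
next
  have ball: "p i \<in> dual K (X i)" if "p \<in> F1.balls" "i \<in> {1..N}" for p i
    using that by (auto simp: PiE_iff dual_ball_def)
  have upd: "x(i := u) \<in> F1.points" if "x \<in> F1.points" "i \<in> {1..N}" "u \<in> carrier (X i)" for x i u
    using that by (auto simp: PiE_iff extensional_def)
  fix x i c u assume x: "x \<in> F1.points" and i: "i \<in> {1..N}" and c: "c \<in> K" and u: "u \<in> carrier (X i)"
  interpret Xi: normed_space_over K "X i" by (rule F1.spaces[OF i])
  have cu: "c \<odot>\<^bsub>X i\<^esub> u \<in> carrier (X i)" using Xi.smult_closed[of c u] c u by simp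
  let ?g = "\<lambda>w q. of_bool (fst (snd q) = e) * (fst q * prod_eval {1..N} (snd (snd q)) (x(i := w)))"
  have "clift (?g (c \<odot>\<^bsub>X i\<^esub> u)) = clift (\<lambda>q. c * ?g u q)"
  proof (rule clift_cong[OF bounded_sliced_tensor[OF upd[OF x i cu]]])
    fix q assume "q \<in> Q"
    then have "snd (snd q) i \<in> dual K (X i)" using ball i by auto
    then have "snd (snd q) i (c \<odot>\<^bsub>X i\<^esub> u) = c * snd (snd q) i u"
      using c u unfolding dual_def by blast
    then show "?g (c \<odot>\<^bsub>X i\<^esub> u) q = c * ?g u q"
      using i by (simp add: prod_eval_fun_upd algebra_simps)
  qed
  also have "\<dots> = c * clift (?g u)" by (rule clift_scale[OF bounded_sliced_tensor[OF upd[OF x i u]]])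
  finally show "slice e (x(i := c \<odot>\<^bsub>X i\<^esub> u)) = c * slice e (x(i := u))"
    using upd[OF x i] u cu by (simp add: slice_def)
next
  \<comment> \<open>Boundedness is domination applied to a combination with a single term.\<close>
  have "cmod (slice e x) \<le> weight e * (\<Prod>i\<in>{1..N}. nrm (X i) (x i))" if x: "x \<in> F1.points" for x
    using dominatedD[OF slice_dominated, of "[(1, x)]" "\<Prod>i\<in>{1..N}. nrm (X i) (x i)" e] x K
      F1.cmod_prod_eval_le[OF _ x] by auto
  then show "\<exists>C. \<forall>x\<in>F1.points. cmod (slice e x) \<le> C * (\<Prod>i\<in>{1..N}. nrm (X i) (x i))" by blast
qed

text \<open>On the fibre over \<open>e\<close> the number \<open>e (x 0)\<close> is the value of the
  extreme-point coordinate. The finite sum is therefore the part of \<open>T x\<close> carried by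
  the fibres over \<open>A\<close>, and what remains is integrated over a set of mass
  \<open>L 1\<close> minus the weights.\<close>

lemma remainder_bound:
  assumes x: "x \<in> F0.points" and A: "finite A" "A \<subseteq> Ext"
  shows "cmod (T x - (\<Sum>e\<in>A. e (x 0) * slice e (restrict x {1..N})))
    \<le> (\<Prod>i\<in>{0..N}. nrm (X i) (x i)) * (L (\<lambda>_. 1) - (\<Sum>e\<in>A. weight e))"
proof -
  let ?W = "\<lambda>q. fst q * (fst (snd q) (x 0) * prod_eval {1..N} (snd (snd q)) x)"
  let ?V = "\<lambda>q. fst q * prod_eval {1..N} (snd (snd q)) (restrict x {1..N})"
  let ?g = "\<lambda>e q. e (x 0) * (of_bool (fst (snd q) = e) * ?V q)"
  let ?n = "\<Prod>i\<in>{0..N}. nrm (X i) (x i)"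
  note y = points_restrict[OF x]
  have bg: "bounded (?g e ` Q)" for e
    by (intro bounded_mult_image bounded_const_image bounded_sliced_tensor y)
  have "(\<Sum>e\<in>A. e (x 0) * slice e (restrict x {1..N})) = (\<Sum>e\<in>A. clift (?g e))"
    using clift_scale[OF bounded_sliced_tensor[OF y(2)]] y(2) by (simp add: slice_def)
  also have "\<dots> = clift (\<lambda>q. \<Sum>e\<in>A. ?g e q)" by (rule clift_sum[symmetric, OF bg])
  finally have sum: "(\<Sum>e\<in>A. e (x 0) * slice e (restrict x {1..N})) = clift (\<lambda>q. \<Sum>e\<in>A. ?g e q)" .
  have bs: "bounded ((\<lambda>q. (-1) * (\<Sum>e\<in>A. ?g e q)) ` Q)"
    by (intro bounded_mult_image bounded_const_image bounded_sum_image bg)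
  have "T x - (\<Sum>e\<in>A. e (x 0) * slice e (restrict x {1..N})) = clift ?W + (-1) * clift (\<lambda>q. \<Sum>e\<in>A. ?g e q)"
    unfolding sum rep[OF x] by simp
  also have "\<dots> = clift ?W + clift (\<lambda>q. (-1) * (\<Sum>e\<in>A. ?g e q))"
    by (rule arg_cong[OF clift_scale[symmetric]]) (rule bounded_sum_image[OF bg])
  also have "\<dots> = clift (\<lambda>q. ?W q + (-1) * (\<Sum>e\<in>A. ?g e q))"
    by (rule clift_add[symmetric, OF bounded_full_tensor[OF x] bs])
  finally have eq: "T x - (\<Sum>e\<in>A. e (x 0) * slice e (restrict x {1..N}))
      = clift (\<lambda>q. ?W q + (-1) * (\<Sum>e\<in>A. ?g e q))" .
  have "cmod (clift (\<lambda>q. ?W q + (-1) * (\<Sum>e\<in>A. ?g e q))) \<le> L (\<lambda>q. ?n * of_bool (fst (snd q) \<notin> A))"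
  proof (rule cmod_clift_le)
    show "bounded ((\<lambda>q. ?n * of_bool (fst (snd q) \<notin> A)) ` Q)"
      by (intro bounded_mult_image bounded_const_image bounded_of_bool)
    fix q assume q: "q \<in> Q"
    then have qe: "fst (snd q) \<in> Ext" "snd (snd q) \<in> F1.balls" by auto
    have "(\<Sum>e\<in>A. ?g e q) = (\<Sum>e\<in>A. if fst (snd q) = e then fst (snd q) (x 0) * ?V q else 0)"
      by (intro sum.cong) auto
    also have "\<dots> = of_bool (fst (snd q) \<in> A) * ?W q"
      using A(1) unfolding y(3) by (simp add: sum.delta)
    finally have "?W q + (-1) * (\<Sum>e\<in>A. ?g e q) = of_bool (fst (snd q) \<notin> A) * ?W q" by simp
    moreover have "cmod (?W q) \<le> ?n"
    proof -
      have "fst (snd q) (x 0) * prod_eval {1..N} (snd (snd q)) x = prod_eval {0..N} ((snd (snd q))(0 := fst (snd q))) x"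
        by (rule balls_join(2)[symmetric, OF Ext_subset[OF qe(1)] qe(2)])
      moreover have "cmod (prod_eval {0..N} ((snd (snd q))(0 := fst (snd q))) x) \<le> ?n"
        by (rule F0.cmod_prod_eval_le[OF balls_join(1)[OF Ext_subset[OF qe(1)] qe(2)] x])
      ultimately show ?thesis using unit_scalar_Q[OF q] by (simp add: norm_mult)
    qed
    ultimately show "cmod (?W q + (-1) * (\<Sum>e\<in>A. ?g e q)) \<le> ?n * of_bool (fst (snd q) \<notin> A)"
      by (auto simp: norm_mult)
  qed
  also have "\<dots> = ?n * (L (\<lambda>_. 1) - (\<Sum>e\<in>A. weight e))"
    using weight_complement[OF A(1)] by (subst L_scale) auto
  finally show ?thesis unfolding eq .
qed

text \<open>The atomic mass called \<open>w\<close> in the overview. Finite additivity of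
  \<open>L\<close> only gives that it is at most \<open>L 1\<close>.\<close>

definition total_weight :: real where
  "total_weight = (SUP A\<in>{A. finite A \<and> A \<subseteq> Ext}. \<Sum>e\<in>A. weight e)"

lemma total_weight_bdd: "bdd_above ((\<lambda>A. \<Sum>e\<in>A. weight e) ` {A. finite A \<and> A \<subseteq> Ext})"
  by (rule bdd_aboveI[of _ "L (\<lambda>_. 1)"]) (auto intro: sum_weight_le)

lemma sum_weight_le_total: "finite A \<Longrightarrow> A \<subseteq> Ext \<Longrightarrow> (\<Sum>e\<in>A. weight e) \<le> total_weight"
  unfolding total_weight_def by (rule cSUP_upper[OF _ total_weight_bdd]) auto

text \<open>The part of \<open>L\<close> that is not carried by finitely many extreme points sits near the cluster points,
  so it only contributes with the factor \<open>r\<close>.\<close>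

lemma dominated_total_weight:
  assumes poly: "weak_star K (X 0) derived_set_of Ext \<subseteq> {f \<in> dual K (X 0). dual_norm (X 0) f \<le> r}"
    and r: "0 \<le> r" "r \<le> 1"
  shows "F0.tensor_dominated T ((1 - r) * total_weight + r * L (\<lambda>_. 1))"
  unfolding dominated_def
proof (intro allI impI)
  let ?L1 = "L (\<lambda>_. 1)"
  have L1: "0 \<le> ?L1" by (rule L_nonneg) auto
  fix l M assume l: "set l \<subseteq> K \<times> F0.points"
    and M: "\<forall>\<phi>\<in>F0.balls. cmod (\<Sum>(c, x)\<leftarrow>l. c * prod_eval {0..N} \<phi> x) \<le> M"
  have M0: "0 \<le> M" using M F0.balls_nonempty norm_ge_zero order_trans by blast
  let ?f = "\<lambda>a q. fst a * (fst q * (fst (snd q) (snd a 0) * prod_eval {1..N} (snd (snd q)) (snd a)))"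
  have bf: "bounded (?f a ` Q)" if "a \<in> set l" for a
    using subsetD[OF l that]
    by (intro bounded_mult_image[OF bounded_const_image] bounded_full_tensor) (simp only: mem_Times_iff)
  have "(\<Sum>(c, x)\<leftarrow>l. c * T x) = (\<Sum>a\<leftarrow>l. clift (?f a))"
  proof (rule arg_cong[of _ _ sum_list], rule map_cong[OF refl])
    fix a assume a: "a \<in> set l"
    have x: "snd a \<in> F0.points" using subsetD[OF l a] by (simp only: mem_Times_iff)
    show "(case a of (c, x) \<Rightarrow> c * T x) = clift (?f a)"
      using clift_scale[OF bounded_full_tensor[OF x], of "fst a"] rep[OF x] by (simp add: case_prod_unfold)
  qed
  also have "\<dots> = clift (\<lambda>q. \<Sum>a\<leftarrow>l. ?f a q)"
    by (rule conjunct1[OF clift_sum_list[of l ?f, OF bf], symmetric])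
  finally have eq: "(\<Sum>(c, x)\<leftarrow>l. c * T x) = clift (\<lambda>q. \<Sum>a\<leftarrow>l. ?f a q)" .
  have fq: "(\<Sum>a\<leftarrow>l. ?f a q) = fst q * (\<Sum>(c, x)\<leftarrow>l. c * (fst (snd q) (x 0) * prod_eval {1..N} (snd (snd q)) x))" for q
    by (induction l) (auto simp: algebra_simps)
  have step: "cmod (\<Sum>(c, x)\<leftarrow>l. c * T x) \<le> ((1 - r) * total_weight + r * ?L1) * M + d * ?L1"
    if d: "0 < d" for d
  proof -
    obtain A where A: "finite A" "A \<subseteq> Ext" and small: "\<And>e p. e \<in> Ext - A \<Longrightarrow> p \<in> F1.balls \<Longrightarrow>
      cmod (\<Sum>(c, x)\<leftarrow>l. c * (e (x 0) * prod_eval {1..N} p x)) \<le> r * M + d"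
      by (rule extreme_points_eventually_small[OF poly r(1) l bspec[OF M] d]) auto
    \<comment> \<open>The trivial bound \<open>M\<close> is kept over the exceptional set
      \<open>A\<close>; elsewhere the improved bound applies.\<close>
    let ?k = "\<lambda>q. M * of_bool (fst (snd q) \<in> A) + (r * M + d) * of_bool (fst (snd q) \<notin> A)"
    have "cmod (clift (\<lambda>q. \<Sum>a\<leftarrow>l. ?f a q)) \<le> L ?k"
    proof (rule cmod_clift_le)
      show "bounded (?k ` Q)"
        by (intro bounded_plus_comp bounded_mult_image bounded_const_image bounded_of_bool)
      fix q assume q: "q \<in> Q"
      then have qe: "fst (snd q) \<in> Ext" "snd (snd q) \<in> F1.balls" by auto
      let ?s = "\<Sum>(c, x)\<leftarrow>l. c * (fst (snd q) (x 0) * prod_eval {1..N} (snd (snd q)) x)"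
      have "cmod ?s \<le> M"
        using bspec[OF M balls_join(1)[OF Ext_subset[OF qe(1)] qe(2)]]
        unfolding balls_join(2)[OF Ext_subset[OF qe(1)] qe(2)] .
      moreover have "cmod ?s \<le> r * M + d" if "fst (snd q) \<notin> A" using small[OF _ qe(2)] qe(1) that by simp
      ultimately have "cmod ?s \<le> ?k q" by simp
      then show "cmod (\<Sum>a\<leftarrow>l. ?f a q) \<le> ?k q" unfolding fq using unit_scalar_Q[OF q] by (simp add: norm_mult)
    qed
    also have "L ?k = L (\<lambda>q. M * of_bool (fst (snd q) \<in> A)) + L (\<lambda>q. (r * M + d) * of_bool (fst (snd q) \<notin> A))"
      by (rule L_add) (intro bounded_mult_image bounded_const_image bounded_of_bool)+
    also have "\<dots> = M * (\<Sum>e\<in>A. weight e) + (r * M + d) * (?L1 - (\<Sum>e\<in>A. weight e))"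
      using sum_weight[OF A(1)] weight_complement[OF A(1)] L_scale[OF bounded_of_bool] by simp
    \<comment> \<open>Regrouped so that the finite weight sum has the nonnegative coefficient
      \<open>(1 - r) * M\<close> and may be replaced by \<open>total_weight\<close>, which does not
      depend on \<open>A\<close> or \<open>d\<close>.\<close>
    also have "\<dots> = ((1 - r) * (\<Sum>e\<in>A. weight e) + r * ?L1) * M + d * (?L1 - (\<Sum>e\<in>A. weight e))"
      by (simp add: algebra_simps)
    also have "\<dots> \<le> ((1 - r) * total_weight + r * ?L1) * M + d * ?L1"
      using sum_weight_le_total[OF A] r(2) M0 d
      by (intro add_mono mult_right_mono mult_left_mono) (auto intro: sum_nonneg weight_nonneg L1)
    finally show ?thesis unfolding eq .
  qed
  show "cmod (\<Sum>(c, x)\<leftarrow>l. c * T x) \<le> ((1 - r) * total_weight + r * ?L1) * M"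
  proof (rule field_le_epsilon)
    fix e :: real assume e: "0 < e"
    \<comment> \<open>This choice of \<open>d\<close> makes the error \<open>d * L 1\<close> at most
      \<open>e\<close>, including when \<open>L 1 = 0\<close>.\<close>
    have "0 < e / (?L1 + 1)" using e L1 by simp
    from step[OF this] show "cmod (\<Sum>(c, x)\<leftarrow>l. c * T x) \<le> ((1 - r) * total_weight + r * ?L1) * M + e"
    proof (rule order_trans)
      have "e / (?L1 + 1) * ?L1 \<le> e" using e L1 by (simp add: field_simps)
      then show "((1 - r) * total_weight + r * ?L1) * M + e / (?L1 + 1) * ?L1
        \<le> ((1 - r) * total_weight + r * ?L1) * M + e" by simp
    qed
  qed
qed

text \<open>When the atoms exhaust \<open>L\<close>, the bound in \<open>remainder_bound\<close>
  tends to 0 along the finite sets of extreme points. This is an unordered sum over a possibly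
  uncountable set.\<close>

lemma slice_has_sum:
  assumes full: "total_weight = L (\<lambda>_. 1)" and x: "x \<in> F0.points"
  shows "((\<lambda>e. e (x 0) * slice e (restrict x {1..N})) has_sum T x) Ext"
  unfolding has_sum_def tendsto_iff
proof (intro allI impI)
  let ?n = "\<Prod>i\<in>{0..N}. nrm (X i) (x i)"
  have n: "0 \<le> ?n"
    using x by (intro prod_nonneg) (auto intro!: normed_space_over.nrm_nonneg[OF spaces] simp: PiE_iff)
  fix d :: real assume d: "0 < d"
  have "total_weight - d / (?n + 1) < total_weight" using d n by simp
  then obtain A where A: "finite A" "A \<subseteq> Ext" "total_weight - d / (?n + 1) < (\<Sum>e\<in>A. weight e)"
    unfolding total_weight_def by (subst (asm) less_cSUP_iff[OF _ total_weight_bdd]) auto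
  have "dist (\<Sum>e\<in>B. e (x 0) * slice e (restrict x {1..N})) (T x) < d"
    if B: "finite B" "A \<subseteq> B" "B \<subseteq> Ext" for B
  proof -
    have "(\<Sum>e\<in>A. weight e) \<le> (\<Sum>e\<in>B. weight e)"
      using B by (intro sum_mono2) (auto simp: weight_nonneg)
    then have "L (\<lambda>_. 1) - (\<Sum>e\<in>B. weight e) \<le> d / (?n + 1)" using A(3) full by simp
    then have "?n * (L (\<lambda>_. 1) - (\<Sum>e\<in>B. weight e)) \<le> ?n * (d / (?n + 1))" by (rule mult_left_mono[OF _ n])
    also have "\<dots> < d" using d n by (simp add: field_simps)
    finally show ?thesis using remainder_bound[OF x B(1,3)] by (simp add: dist_norm norm_minus_commute)
  qed
  then show "\<forall>\<^sub>F B in finite_subsets_at_top Ext. dist (\<Sum>e\<in>B. e (x 0) * slice e (restrict x {1..N})) (T x) < d"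
    unfolding eventually_finite_subsets_at_top using A(1,2) by blast
qed

end

section \<open>From slices to a nuclear representation\<close>

lemma (in normed_space_over) dual_norm_zero: "dual_norm X (\<lambda>x. 0) = 0"
proof -
  have "{x \<in> carrier X. nrm X x \<le> 1} \<noteq> {}" using M.zero_closed nrm_zero by force
  then show ?thesis by (simp add: dual_norm_def)
qed

lemma has_sum_transport:
  assumes "inj_on g J" "(f has_sum s) J" "\<And>j. j \<in> J \<Longrightarrow> h (g j) = f j" "\<And>k. k \<notin> g ` J \<Longrightarrow> h k = 0"
  shows "(h has_sum s) UNIV"
proof -
  have "((h \<circ> g) has_sum s) J" using assms(2,3) by (subst has_sum_cong[of J "h \<circ> g" f]) auto
  then have "(h has_sum s) (g ` J)" using has_sum_reindex[OF assms(1), of h s] by simp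
  then show ?thesis using has_sum_cong_neutral[of UNIV "g ` J" h h s] assms(4) by auto
qed

text \<open>Enumerating \<open>J\<close> injectively by natural numbers and padding with zero
  functionals yields a series indexed by all of \<open>nat\<close>; this covers finite
  \<open>J\<close> as well.\<close>

lemma (in nspace_family) countable_nuclear_representation:
  fixes \<eta> :: "nat \<Rightarrow> 'j \<Rightarrow> 'a \<Rightarrow> complex"
  assumes J: "countable J" and ne: "I \<noteq> {}"
    and dual: "\<And>i j. i \<in> I \<Longrightarrow> j \<in> J \<Longrightarrow> \<eta> i j \<in> dual K (E i)"
    and norms: "((\<lambda>j. \<Prod>i\<in>I. dual_norm (E i) (\<eta> i j)) has_sum s) J"
    and T: "\<And>x. x \<in> points \<Longrightarrow> ((\<lambda>j. prod_eval I (\<lambda>i. \<eta> i j) x) has_sum T x) J"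
  obtains \<xi> where "represents_nuclear K E I T \<xi>" "representation_sum E I \<xi> = s"
proof -
  define g where "g = to_nat_on J"
  have inj: "inj_on g J" unfolding g_def by (rule inj_on_to_nat_on[OF J])
  define \<xi> where "\<xi> i k = (if k \<in> g ` J then \<eta> i (inv_into J g k) else (\<lambda>x. 0))" for i k
  have xi_g: "\<xi> i (g j) = \<eta> i j" if "j \<in> J" for i j using that inj by (simp add: \<xi>_def)
  have xi_0: "\<xi> i k = (\<lambda>x. 0)" if "k \<notin> g ` J" for i k using that by (simp add: \<xi>_def)
  \<comment> \<open>Some factor must exist for the padding terms to vanish, since an empty product
    is 1.\<close>
  obtain i0 where i0: "i0 \<in> I" using ne by auto
  have "((\<lambda>k. \<Prod>i\<in>I. dual_norm (E i) (\<xi> i k)) has_sum s) UNIV"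
  proof (rule has_sum_transport[OF inj norms])
    show "(\<Prod>i\<in>I. dual_norm (E i) (\<xi> i k)) = 0" if "k \<notin> g ` J" for k
      by (rule prod_zero[OF I])
        (use i0 normed_space_over.dual_norm_zero[OF spaces[OF i0]] xi_0[OF that] in auto)
  qed (simp add: xi_g)
  then have sums: "(\<lambda>k. \<Prod>i\<in>I. dual_norm (E i) (\<xi> i k)) sums s" by (rule has_sum_imp_sums)
  have "represents_nuclear K E I T \<xi>"
    unfolding represents_nuclear_def
  proof (intro conjI ballI allI)
    have "(\<lambda>x. 0) \<in> dual K (E i)" if "i \<in> I" for i
      using normed_space_over.zero_in_dual_ball[OF spaces[OF that] K] by (simp add: dual_ball_def)
    then show "\<xi> i k \<in> dual K (E i)" if "i \<in> I" for i k
      using dual[OF that] that inj by (cases "k \<in> g ` J") (auto simp: xi_g xi_0)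
    show "summable (\<lambda>k. \<Prod>i\<in>I. dual_norm (E i) (\<xi> i k))" using sums by (rule sums_summable)
    fix x assume x: "x \<in> points"
    have "((\<lambda>k. \<Prod>i\<in>I. \<xi> i k (x i)) has_sum T x) UNIV"
    proof (rule has_sum_transport[OF inj T[OF x]])
      show "(\<Prod>i\<in>I. \<xi> i k (x i)) = 0" if "k \<notin> g ` J" for k
        by (rule prod_zero[OF I]) (use i0 xi_0[OF that] in auto)
    qed (simp add: xi_g prod_eval_def)
    then show "(\<lambda>k. \<Prod>i\<in>I. \<xi> i k (x i)) sums T x" by (rule has_sum_imp_sums)
  qed
  moreover have "representation_sum E I \<xi> = s"
    unfolding representation_sum_def using sums by (rule sums_unique[symmetric])
  ultimately show ?thesis by (rule that)
qed

lemma (in nspace_family) cmod_prod_eval_dual_le: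
  assumes "\<And>i. i \<in> I \<Longrightarrow> \<phi> i \<in> dual K (E i)" "x \<in> points"
  shows "cmod (prod_eval I \<phi> x) \<le> (\<Prod>i\<in>I. dual_norm (E i) (\<phi> i)) * (\<Prod>i\<in>I. nrm (E i) (x i))"
proof -
  have "cmod (prod_eval I \<phi> x) \<le> (\<Prod>i\<in>I. dual_norm (E i) (\<phi> i) * nrm (E i) (x i))"
    unfolding prod_eval_def prod_norm[symmetric]
    by (intro prod_mono) (use assms normed_space_over.cmod_le_dual_norm[OF spaces K] in \<open>auto simp: PiE_iff\<close>)
  then show ?thesis by (simp add: prod.distrib)
qed

context disintegrated_form
begin

lemma slice_zero: "weight e = 0 \<Longrightarrow> slice e x = 0"
  using dominatedD[OF slice_dominated, of "[(1, x)]" "\<Prod>i\<in>{1..N}. nrm (X i) (x i)" e] K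
    F1.cmod_prod_eval_le[of _ x] by (cases "x \<in> F1.points") (auto simp: slice_def)

text \<open>The representation has the terms \<open>e\<close> tensor \<open>\<Xi> e j\<close>,
  indexed by pairs \<open>(e, j)\<close>. Extreme points have norm at most 1, so row
  \<open>e\<close> costs at most \<open>weight e\<close>, and all rows together at most
  \<open>L 1\<close>. Absolute summability then permits summing first over \<open>j\<close>, which
  yields the slice, and then over \<open>e\<close>.\<close>

lemma nuclear_representation:
  assumes full: "total_weight = L (\<lambda>_. 1)"
    and slices: "\<And>e. represents_nuclear K X {1..N} (slice e) (\<Xi> e)"
      "\<And>e. representation_sum X {1..N} (\<Xi> e) \<le> weight e"
  obtains \<xi> where "represents_nuclear K X {0..N} T \<xi>" "representation_sum X {0..N} \<xi> \<le> L (\<lambda>_. 1)"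
proof -
  \<comment> \<open>Only extreme points of nonzero weight are kept. They are countably many because
    the weights are summable, and the discarded slices are zero.\<close>
  define E where "E = {e \<in> Ext. weight e \<noteq> 0}"
  define J where "J = E \<times> (UNIV :: nat set)"
  define \<eta> where "\<eta> i = (\<lambda>(e, j). if i = 0 then e else \<Xi> e i j)" for i :: nat
  define b where "b e j = (\<Prod>i\<in>{1..N}. dual_norm (X i) (\<Xi> e i j))" for e j
  define m where "m p = (\<Prod>i\<in>{0..N}. dual_norm (X i) (\<eta> i p))" for p
  have Xi_dual: "\<Xi> e i j \<in> dual K (X i)" if "i \<in> {1..N}" for e i j
    using slices(1)[of e] that unfolding represents_nuclear_def by blast
  have b0: "0 \<le> b e j" for e j
    unfolding b_def by (intro prod_nonneg) (use normed_space_over.dual_norm_nonneg[OF F1.spaces Xi_dual] in auto)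
  have bsum: "summable (b e)" "suminf (b e) \<le> weight e" for e
    using slices[of e] unfolding represents_nuclear_def representation_sum_def b_def by auto
  have eta_dual: "\<eta> i p \<in> dual K (X i)" if "i \<in> {0..N}" "p \<in> J" for i p
    using that Xi_dual[of i] dual_ball_subset_dual[OF Ext_subset] unfolding \<eta>_def J_def E_def by auto
  have m0: "0 \<le> m p" if "p \<in> J" for p
    unfolding m_def by (intro prod_nonneg) (use normed_space_over.dual_norm_nonneg[OF F0.spaces eta_dual] that in auto)
  have mb: "m (e, j) \<le> b e j" if "e \<in> E" for e j
  proof -
    have "m (e, j) = dual_norm (X 0) e * b e j"
      unfolding m_def b_def \<eta>_def by (subst prod.atLeast_Suc_atMost) auto
    also have "\<dots> \<le> 1 * b e j"
    proof (rule mult_right_mono[OF _ b0])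
      show "dual_norm (X 0) e \<le> 1" using Ext_subset[of e] that by (simp add: E_def dual_ball_def)
    qed
    finally show ?thesis by simp
  qed
  have fin: "sum m F \<le> L (\<lambda>_. 1)" if F: "finite F" "F \<subseteq> J" for F
  proof -
    have "finite (snd ` F)" using F by simp
    then obtain n where n: "snd ` F \<subseteq> {..<n}" using finite_nat_iff_bounded by blast
    have FE: "fst ` F \<subseteq> E" using F(2) unfolding J_def by auto
    \<comment> \<open>A finite index set is enlarged to a rectangle, so that each of its rows is a
      partial sum of the series for one slice.\<close>
    have sub: "F \<subseteq> fst ` F \<times> {..<n}"
    proof
      fix p assume "p \<in> F"
      then have "fst p \<in> fst ` F" "snd p \<in> {..<n}" using n by blast+
      then show "p \<in> fst ` F \<times> {..<n}" by (simp only: mem_Times_iff)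
    qed
    have "fst ` F \<times> {..<n} \<subseteq> J" unfolding J_def using FE by blast
    then have "sum m F \<le> sum m (fst ` F \<times> {..<n})"
      using F(1) m0 by (intro sum_mono2[OF _ sub]) blast+
    also have "\<dots> = (\<Sum>e\<in>fst ` F. \<Sum>j<n. m (e, j))" by (simp add: sum.cartesian_product)
    also have "\<dots> \<le> (\<Sum>e\<in>fst ` F. weight e)"
    proof (rule sum_mono)
      fix e assume e: "e \<in> fst ` F"
      have "(\<Sum>j<n. m (e, j)) \<le> (\<Sum>j<n. b e j)" by (rule sum_mono) (use mb FE e in auto)
      also have "\<dots> \<le> suminf (b e)" by (rule sum_le_suminf[OF bsum(1)]) (use b0 in auto)
      finally show "(\<Sum>j<n. m (e, j)) \<le> weight e" using bsum(2)[of e] by simp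
    qed
    also have "\<dots> \<le> L (\<lambda>_. 1)" by (rule sum_weight_le) (use F in simp)
    finally show ?thesis .
  qed
  have msum: "m summable_on J"
    by (rule nonneg_bdd_above_summable_on[OF m0]) (use fin in \<open>auto intro!: bdd_aboveI[of _ "L (\<lambda>_. 1)"]\<close>)
  have mle: "infsum m J \<le> L (\<lambda>_. 1)" by (rule infsum_le_finite_sums[OF msum fin])
  have "weight summable_on Ext"
    by (rule nonneg_bdd_above_summable_on) (auto intro!: bdd_aboveI[of _ "L (\<lambda>_. 1)"] sum_weight_le weight_nonneg)
  then have "countable E" unfolding E_def by (rule summable_countable_real)
  then have J: "countable J" unfolding J_def by simp
  have T: "((\<lambda>p. prod_eval {0..N} (\<lambda>i. \<eta> i p) x) has_sum T x) J" if x: "x \<in> F0.points" for x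
  proof -
    let ?t = "\<lambda>p. prod_eval {0..N} (\<lambda>i. \<eta> i p) x"
    let ?y = "restrict x {1..N}"
    note y = points_restrict[OF x]
    have le: "norm (?t p) \<le> m p * (\<Prod>i\<in>{0..N}. nrm (X i) (x i))" if "p \<in> J" for p
      unfolding m_def by (rule F0.cmod_prod_eval_dual_le[OF eta_dual[OF _ that] x])
    have "(\<lambda>p. norm (?t p)) summable_on J"
      by (rule Infinite_Sum.abs_summable_on_comparison_test'[OF summable_on_cmult_left[OF msum] le])
    then have ts: "?t summable_on J" by (rule abs_summable_summable)
    have te: "?t (e, j) = e (x 0) * prod_eval {1..N} (\<lambda>i. \<Xi> e i j) ?y" for e j
    proof -
      have "prod_eval {1..N} (\<lambda>i. \<eta> i (e, j)) x = prod_eval {1..N} (\<lambda>i. \<Xi> e i j) ?y"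
        by (rule prod_eval_cong) (auto simp: \<eta>_def)
      then show ?thesis unfolding prod_eval_split by (simp add: \<eta>_def)
    qed
    have inner: "(\<Sum>\<^sub>\<infinity>j\<in>UNIV. ?t (e, j)) = e (x 0) * slice e ?y" for e
    proof -
      have s: "(\<lambda>j. prod_eval {1..N} (\<lambda>i. \<Xi> e i j) ?y) sums slice e ?y"
        using slices(1)[of e] y(2) unfolding represents_nuclear_def prod_eval_def by blast
      have "summable (\<lambda>j. norm (prod_eval {1..N} (\<lambda>i. \<Xi> e i j) ?y))"
        by (rule summable_comparison_test'[OF summable_mult2[OF bsum(1)[of e]], of 0])
          (use F1.cmod_prod_eval_dual_le[OF Xi_dual y(2)] in \<open>simp add: b_def\<close>)
      then have "((\<lambda>j. prod_eval {1..N} (\<lambda>i. \<Xi> e i j) ?y) has_sum slice e ?y) UNIV"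
        by (rule norm_summable_imp_has_sum[OF _ s])
      then show ?thesis unfolding te by (intro infsumI has_sum_cmult_right)
    qed
    have eta: "(\<lambda>(e, j). ?t (e, j)) = ?t" by (rule case_prod_eta)
    have "infsum ?t J = (\<Sum>\<^sub>\<infinity>e\<in>E. \<Sum>\<^sub>\<infinity>j\<in>UNIV. ?t (e, j))"
      unfolding J_def
      by (rule infsum_Sigma'_banach[of "\<lambda>e j. ?t (e, j)" E "\<lambda>_. UNIV", unfolded eta, OF ts[unfolded J_def],
            symmetric])
    \<comment> \<open>The omitted extreme points have vanishing slices, so the sum may run over all
      of \<open>Ext\<close> again.\<close>
    also have "\<dots> = (\<Sum>\<^sub>\<infinity>e\<in>Ext. e (x 0) * slice e ?y)"
      unfolding inner by (rule infsum_cong_neutral) (auto simp: E_def slice_zero)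
    also have "\<dots> = T x" by (rule infsumI[OF slice_has_sum[OF full x]])
    finally show ?thesis using has_sum_infsum[OF ts] by simp
  qed
  have "(m has_sum infsum m J) J" by (rule has_sum_infsum[OF msum])
  then obtain \<xi> where "represents_nuclear K X {0..N} T \<xi>" "representation_sum X {0..N} \<xi> = infsum m J"
    using F0.countable_nuclear_representation[OF J _ eta_dual _ T] unfolding m_def by auto
  then show ?thesis using that mle by simp
qed

end

text \<open>A single representation whose cost does not exceed the integral norm settles both claims
  at once: equality of the norms and attainment.\<close>

lemma (in product_with_factor) attained_nuclear_representation:
  assumes poly: "II_polyhedral K (X 0)"
    and iso: "nuclear_eq_integral_isometrically K X {1..N}"
    and att: "nuclear_forms K X {1..N} = NA_nu K X {1..N}"
    and T: "T \<in> integral_forms K X {0..N}"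
  obtains \<xi> where "represents_nuclear K X {0..N} T \<xi>"
    "representation_sum X {0..N} \<xi> \<le> integral_norm K X {0..N} T"
proof -
  obtain r where r: "0 \<le> r" "r < 1"
    and cluster: "weak_star K (X 0) derived_set_of Ext \<subseteq> {f \<in> dual K (X 0). dual_norm (X 0) f \<le> r}"
    using poly unfolding II_polyhedral_def by blast
  define C where "C = integral_norm K X {0..N} T"
  have dom: "F0.tensor_dominated T C" and C: "0 \<le> C"
    unfolding C_def using F0.integral_form_dominated[OF T] by auto
  have Tm: "T \<in> multilinear_forms K X {0..N}" using T unfolding integral_forms_def by simp
  let ?Y = "Ext \<times> F1.balls"
  let ?ev = "\<lambda>y x. fst y (x 0) * prod_eval {1..N} (snd y) x"
  have "Ext \<noteq> {}"
    using X0.ext_point_norming[OF K X0.zero_in_dual_ball[OF K]] by blast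
  then have Y: "?Y \<noteq> {}" using F1.balls_nonempty by simp
  have ev_eq: "?ev y x = prod_eval {0..N} ((snd y)(0 := fst y)) x" "(snd y)(0 := fst y) \<in> F0.balls"
    if "y \<in> ?Y" for y x
  proof -
    have y: "fst y \<in> dual_ball K (X 0)" "snd y \<in> F1.balls"
      using that Ext_subset by (simp_all only: mem_Times_iff)
    show "?ev y x = prod_eval {0..N} ((snd y)(0 := fst y)) x" by (rule balls_join(2)[OF y, symmetric])
    show "(snd y)(0 := fst y) \<in> F0.balls" by (rule balls_join(1)[OF y])
  qed
  have evK: "?ev y x \<in> K" if "y \<in> ?Y" "x \<in> F0.points" for y x
    unfolding ev_eq(1)[OF that(1)] by (rule F0.prod_eval_in_K[OF ev_eq(2)[OF that(1)] that(2)])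
  have bdd: "bounded ((\<lambda>y. ?ev y x) ` ?Y)" if x: "x \<in> F0.points" for x
  proof -
    have "cmod (?ev y x) \<le> (\<Prod>i\<in>{0..N}. nrm (X i) (x i))" if "y \<in> ?Y" for y
      unfolding ev_eq(1)[OF that] by (rule F0.cmod_prod_eval_le[OF ev_eq(2)[OF that] x])
    then show ?thesis unfolding bounded_iff by blast
  qed
  have TK: "T x \<in> K" if "x \<in> F0.points" for x using Tm that unfolding multilinear_forms_def by blast
  obtain L where L: "positive_functional (unit_scalars K \<times> ?Y) L" "L (\<lambda>_. 1) \<le> C"
    "\<And>x. x \<in> F0.points \<Longrightarrow> T x = positive_functional.clift L (\<lambda>(u, y). u * ?ev y x)"
    by (rule positive_functional_representation[OF K Y C evK TK bdd dominated_on_extreme_points[OF dom]]) auto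
  interpret D: disintegrated_form K N X T L
  proof (rule disintegrated_form.intro[OF product_with_factor_axioms disintegrated_form_axioms.intro])
    show "T x = positive_functional.clift L (\<lambda>q. fst q * (fst (snd q) (x 0) * prod_eval {1..N} (snd (snd q)) x))"
      if "x \<in> F0.points" for x using L(3)[OF that] by (simp add: case_prod_unfold)
  qed (rule L(1))
  have L1: "0 \<le> L (\<lambda>_. 1)" by (rule D.L_nonneg) auto
  have tw: "0 \<le> D.total_weight" "D.total_weight \<le> L (\<lambda>_. 1)"
  proof -
    show "0 \<le> D.total_weight" using D.sum_weight_le_total[of "{}"] by simp
    show "D.total_weight \<le> L (\<lambda>_. 1)"
      unfolding D.total_weight_def by (rule cSUP_least) (auto intro: D.sum_weight_le)
  qed
  \<comment> \<open>Any dominating constant bounds the integral norm from above, in particular the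
    one found from the cluster points.\<close>
  have "C \<le> (1 - r) * D.total_weight + r * L (\<lambda>_. 1)"
    unfolding C_def
    by (rule F0.dominated_integral_form(2)[OF Tm _ D.dominated_total_weight[OF cluster r(1)]])
      (use r tw L1 in auto)
  \<comment> \<open>Uses that the mass of \<open>L\<close> is at most \<open>C\<close>; cancelling
    \<open>1 - r > 0\<close> then shows that all mass is atomic.\<close>
  then have "(1 - r) * L (\<lambda>_. 1) \<le> (1 - r) * D.total_weight" using L(2) by (simp add: algebra_simps)
  then have full: "D.total_weight = L (\<lambda>_. 1)" using tw r(2) by simp
  have "\<exists>\<xi>. represents_nuclear K X {1..N} (D.slice e) \<xi> \<and> representation_sum X {1..N} \<xi> \<le> D.weight e" for e
  proof -
    have s: "D.slice e \<in> integral_forms K X {1..N}" "integral_norm K X {1..N} (D.slice e) \<le> D.weight e"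
      by (rule F1.dominated_integral_form[OF D.slice_multilinear D.weight_nonneg D.slice_dominated])+
    then have "D.slice e \<in> nuclear_forms K X {1..N}"
      and n: "nuclear_norm K X {1..N} (D.slice e) = integral_norm K X {1..N} (D.slice e)"
      using iso unfolding nuclear_eq_integral_isometrically_def by auto
    \<comment> \<open>Attainment gives each slice a representation of cost at most its weight,
      without an error term that would accumulate over the slices.\<close>
    then have "D.slice e \<in> NA_nu K X {1..N}" using att by simp
    then obtain \<xi> where "represents_nuclear K X {1..N} (D.slice e) \<xi>"
      "representation_sum X {1..N} \<xi> = nuclear_norm K X {1..N} (D.slice e)" unfolding NA_nu_def by blast
    then show ?thesis using n s(2) by auto
  qed
  then obtain \<Xi> where "\<And>e. represents_nuclear K X {1..N} (D.slice e) (\<Xi> e)"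
    "\<And>e. representation_sum X {1..N} (\<Xi> e) \<le> D.weight e" by metis
  then obtain \<xi> where "represents_nuclear K X {0..N} T \<xi>" "representation_sum X {0..N} \<xi> \<le> L (\<lambda>_. 1)"
    using D.nuclear_representation[OF full] by blast
  then show ?thesis using that L(2) unfolding C_def by auto
qed

theorem theorem3p3:
  fixes K :: "complex set" and N :: nat and X :: "nat \<Rightarrow> 'a nspace"
  assumes "K = \<real> \<or> K = UNIV"
    and "N \<ge> 1"
    and "\<And>i. i \<le> N \<Longrightarrow> banach_space_over K (X i)"
    and "II_polyhedral K (X 0)"
    and "nuclear_eq_integral_isometrically K X {1..N}"
    and "nuclear_forms K X {1..N} = NA_nu K X {1..N}"
  shows "nuclear_eq_integral_isometrically K X {0..N} \<and>
         nuclear_forms K X {0..N} = NA_nu K X {0..N}"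
proof -
  interpret product_with_factor K N X
    by (rule product_with_factor.intro[OF assms(1) banach_space_over.axioms(1)[OF assms(3)]])
  have main: "T \<in> nuclear_forms K X {0..N} \<and> nuclear_norm K X {0..N} T = integral_norm K X {0..N} T
      \<and> T \<in> NA_nu K X {0..N}" if T: "T \<in> integral_forms K X {0..N}" for T
  proof -
    obtain \<xi> where xi: "represents_nuclear K X {0..N} T \<xi>"
      "representation_sum X {0..N} \<xi> \<le> integral_norm K X {0..N} T"
      by (rule attained_nuclear_representation[OF assms(4-6) T])
    then have nuc: "T \<in> nuclear_forms K X {0..N}"
      using T unfolding nuclear_forms_def integral_forms_def by blast
    \<comment> \<open>The chain \<open>nuclear_norm \<le> representation_sum \<le> integral_norm
      \<le> nuclear_norm\<close> closes up, so all three numbers agree.\<close>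
    have "nuclear_norm K X {0..N} T \<le> representation_sum X {0..N} \<xi>" by (rule F0.nuclear_norm_le[OF xi(1)])
    moreover have "integral_norm K X {0..N} T \<le> nuclear_norm K X {0..N} T"
      by (rule F0.nuclear_form_integral(2)[OF nuc])
    ultimately have eq: "nuclear_norm K X {0..N} T = integral_norm K X {0..N} T"
      "representation_sum X {0..N} \<xi> = nuclear_norm K X {0..N} T" using xi(2) by linarith+
    then show ?thesis using nuc xi(1) unfolding NA_nu_def by blast
  qed
  have "nuclear_forms K X {0..N} = integral_forms K X {0..N}"
    using main F0.nuclear_form_integral(1) by blast
  then show ?thesis
    using main unfolding nuclear_eq_integral_isometrically_def NA_nu_def by blast
qed

end
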